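(* Let $(F_n)_{n\ge 1}$ be the Fibonacci sequence ($F_1=F_2=1$, $F_{n+2}=F_{n+1}+F_n$), and let $\mathcal{A}:=\{\gcd(n,F_n) : n\ge 1\}$. Then $\#\big(\mathcal{A}\cap[1,x]\big)=o(x)$ as $x\to+\infty$; that is, $\mathcal{A}$ has asymptotic density zero. *)

theory Defs
  imports "HOL-Number_Theory.Fib" "HOL-Library.Landau_Symbols"
begin

text \<open>The set A = { gcd(n, F_n) : n >= 1 }, with the library Fibonacci numbers
  (fib 0 = 0, fib 1 = 1, fib 2 = 1, so fib n = F_n for n >= 1).\<close>
definition gcd_fib_set :: "nat set" where
  "gcd_fib_set = {gcd n (fib n) | n. n \<ge> 1}"

end

theory Submission
  imports Defs "HOL-Number_Theory.Number_Theory" "HOL-Analysis.Analysis"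
    "HOL-Computational_Algebra.Nth_Powers" "HOL-Computational_Algebra.Squarefree"
begin

text \<open>If \<open>n = gcd(m, F\<^sub>m)\<close> has a prime factor \<open>p\<close> dividing only Fibonacci numbers of index divisible by
  \<open>2\<^sup>k\<close>, and a prime factor \<open>q\<close> dividing only those of index divisible by 3, then \<open>3 \<cdot> 2\<^sup>k\<close> divides \<open>m\<close>,
  hence \<open>2\<^sup>k\<close> divides \<open>F\<^sub>m\<close> and \<open>n\<close>. So the upper density is at most \<open>2\<^sup>-\<^sup>k\<close> once the reciprocals of the
  primes of either kind have a divergent sum, since then almost all integers have prime factors of both kinds.

  Primes \<open>p \<equiv> -1\<close> modulo \<open>2\<^sup>k\<close> with \<open>p \<equiv> 2\<close> modulo 5 are of the first kind, and Dirichlet's theorem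
  applies (proved from Mertens-type estimates for characters). For the second kind, if \<open>p\<close> divides some
  \<open>F\<^sub>m\<close> with \<open>m\<close> prime to 3, then a cube root of the golden ratio modulo \<open>p\<close> makes
  \<open>X\<^sup>3 + 3 X - 1\<close> have a root modulo \<open>p\<close>, and even three roots if \<open>p \<equiv> 1\<close> modulo 60. Were the
  reciprocals of the primes of the second kind summable, this cubic would have more than one root modulo
  \<open>p\<close> on average. But a pigeonhole argument in \<open>\<int>[\<theta>]\<close>, for \<open>\<theta>\<close> a root of the cubic, shows that its
  numbers of roots modulo \<open>n \<le> x\<close> add up to \<open>O(x)\<close>, and a comparison of Euler products bounds
  that average by one.\<close>

section \<open>Integers without prime factors in a large set\<close>

text \<open>Congruences on p are enough to put 2^k into every index m with p dividing
  \<open>F\<^sub>m\<close>. For the factor 3 the question is whether the golden ratio is a cube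
  modulo p, that is, how a cubic with nonabelian Galois group splits; the usual tool would be the
  Chebotarev density theorem. A one-sided estimate replaces it, since an upper bound for the average
  number of roots already contradicts a shortage of primes of the second kind. The discriminant of
  the cubic is -135 = -15 * 3^2, so one root modulo p brings two more when -15 is a square, and p =
  1 modulo 60 makes -1, 3 and 5 squares. The surplus of 2 at these primes is essential: one root at
  nearly every prime would be compatible with the bound.\<close>

lemma card_coprime_le:
  assumes "M > 0"
  shows "card {n\<in>{1..N}. coprime n M} \<le> totient M * (N div M + 1)"
proof -
  have "card {n\<in>{1..N}. coprime n M} \<le> card (totatives M \<times> {..N div M})"
  \<comment> \<open>Shifting by one puts the residues into 1..M, the range of
    \<open>totatives M\<close>; the quotient counts the completed blocks of length M.\<close>
  proof (rule card_inj_on_le[where f = "\<lambda>n. ((n - 1) mod M + 1, (n - 1) div M)"])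
    show "inj_on (\<lambda>n. ((n - 1) mod M + 1, (n - 1) div M)) {n\<in>{1..N}. coprime n M}"
    proof (rule inj_onI)
      fix x y assume xy: "x \<in> {n\<in>{1..N}. coprime n M}" "y \<in> {n\<in>{1..N}. coprime n M}"
        "((x - 1) mod M + 1, (x - 1) div M) = ((y - 1) mod M + 1, (y - 1) div M)"
      then have "x - 1 = y - 1"
        by (metis add_right_cancel div_mult_mod_eq prod.inject)
      with xy show "x = y" by auto
    qed
    show "(\<lambda>n. ((n - 1) mod M + 1, (n - 1) div M)) ` {n\<in>{1..N}. coprime n M}
            \<subseteq> totatives M \<times> {..N div M}"
    proof safe
      fix n assume n: "n \<in> {1..N}" "coprime n M"
      have "[(n - 1) mod M + 1 = n - 1 + 1] (mod M)"
        by (intro cong_add) (auto simp: Cong.cong_def)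
      with n have "[(n - 1) mod M + 1 = n] (mod M)" by simp
      with n have "coprime ((n - 1) mod M + 1) M"
        using cong_imp_coprime cong_sym by blast
      moreover have "(n - 1) mod M < M" using assms by simp
      ultimately show "(n - 1) mod M + 1 \<in> totatives M"
        unfolding in_totatives_iff by auto
      show "(n - 1) div M \<le> N div M" using n by (intro div_le_mono) auto
    qed
  qed auto
  also have "\<dots> = totient M * (N div M + 1)"
    by (simp add: card_cartesian_product totient_def)
  finally show ?thesis .
qed

lemma totient_prod_primes:
  assumes "finite Q" "\<And>p. p \<in> Q \<Longrightarrow> prime p"
  shows "real (totient (\<Prod>Q)) = real (\<Prod>Q) * (\<Prod>p\<in>Q. 1 - 1 / real p)"
proof -
  have "totient (\<Prod>p\<in>Q. p) = (\<Prod>p\<in>Q. totient p)"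
    using assms by (intro totient_prod_coprime) (auto simp: pairwise_def intro!: primes_coprime)
  then have "real (totient (\<Prod>Q)) = (\<Prod>p\<in>Q. real (totient p))" by simp
  also have "\<dots> = (\<Prod>p\<in>Q. real p * (1 - 1 / real p))"
    using assms(2)
    by (intro prod.cong) (auto simp: totient_prime of_nat_diff prime_ge_1_nat right_diff_distrib
      dest: prime_gt_0_nat)
  finally show ?thesis by (simp add: prod.distrib)
qed

text \<open>By \<open>1 - t \<le> exp (- t)\<close>, a product M of distinct primes has
  \<open>totient M / M\<close> at most exp of minus the sum of their reciprocals, and a divergent
  sum has finite parts beyond \<open>- ln e\<close>. Integers without prime factors in P are then
  among those coprime to M.\<close>

lemma small_totient_ratio:
  assumes "\<And>p. p \<in> P \<Longrightarrow> prime p" "\<not> (\<lambda>p. 1 / real p) summable_on P" "e > 0"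
  obtains M where "M > 0" "\<And>p. prime p \<Longrightarrow> p dvd M \<Longrightarrow> p \<in> P" "real (totient M) < e * real M"
proof -
  have "\<not> bdd_above (sum (\<lambda>p. 1 / real p) ` {F. F \<subseteq> P \<and> finite F})"
    using assms(2) nonneg_bdd_above_summable_on[of P "\<lambda>p. 1 / real p"] by auto
  then obtain Q where Q: "Q \<subseteq> P" "finite Q" "(\<Sum>p\<in>Q. 1 / real p) > - ln e"
    by (auto simp: bdd_above_def not_le)
  have pr: "prime p" if "p \<in> Q" for p using that Q(1) assms(1) by auto
  have pos: "(\<Prod>Q) > 0" by (intro prod_pos) (simp add: pr prime_gt_0_nat)
  have "(\<Prod>p\<in>Q. 1 - 1 / real p) \<le> (\<Prod>p\<in>Q. exp (- 1 / real p))"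
  proof (intro prod_mono)
    fix p assume "p \<in> Q"
    then have "real p \<ge> 1" using pr prime_ge_1_nat by fastforce
    then show "0 \<le> 1 - 1 / real p \<and> 1 - 1 / real p \<le> exp (- 1 / real p)"
      using exp_ge_add_one_self[of "- 1 / real p"] by auto
  qed
  also have "\<dots> = exp (- (\<Sum>p\<in>Q. 1 / real p))"
    using Q(2) by (simp add: exp_sum flip: sum_negf)
  also have "\<dots> < exp (ln e)" using Q(3) by (subst exp_less_cancel_iff) simp
  finally have lt: "(\<Prod>p\<in>Q. 1 - 1 / real p) < e" using assms(3) by simp
  show ?thesis
  proof
    show "\<Prod>Q > 0" by (rule pos)
    show "p \<in> P" if "prime p" "p dvd \<Prod>Q" for p
      using that Q pr by (metis prime_dvd_prod_iff primes_dvd_imp_eq subsetD)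
    show "real (totient (\<Prod>Q)) < e * real (\<Prod>Q)"
      using totient_prod_primes[OF Q(2) pr] lt pos by (simp add: mult.commute del: of_nat_prod)
  qed
qed

section \<open>Fibonacci numbers modulo primes\<close>

lemma fib_double: "fib (2 * n) = fib n * (2 * fib (n + 1) - fib n)"
proof (cases n)
  case (Suc k)
  then show ?thesis using fib_rec_even[of n] by (simp add: algebra_simps)
qed auto



text \<open>Doubling the index gains a factor 2: the second factor in \<open>fib_double\<close> is
  even as soon as \<open>fib n\<close> is, and 3 is the index of the first even Fibonacci
  number.\<close>

lemma two_power_dvd_fib: "2 ^ k dvd fib (3 * 2 ^ k)"
proof (induction k)
  case (Suc k)
  have ev: "even (fib (3 * 2 ^ k))"
  proof -
    have "fib 3 = 2" by (simp add: numeral_3_eq_3)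
    then show ?thesis
      using fib_gcd[of 3 "3 * 2 ^ k"] gcd_nat.absorb1[of 3 "3 * 2 ^ k"]
        gcd_dvd2[of "fib 3" "fib (3 * 2 ^ k)"] by simp
  qed
  have "fib (3 * 2 ^ Suc k) = fib (2 * (3 * 2 ^ k))" by (simp add: mult.left_commute)
  also have "\<dots> = fib (3 * 2 ^ k) * (2 * fib (3 * 2 ^ k + 1) - fib (3 * 2 ^ k))"
    by (rule fib_double)
  finally show ?case
    using mult_dvd_mono[OF Suc.IH, of 2 "2 * fib (3 * 2 ^ k + 1) - fib (3 * 2 ^ k)"] ev
    by (simp add: mult.commute)
qed auto

lemma fib_binomial:
  defines "a \<equiv> 1 + sqrt 5" and "b \<equiv> 1 - sqrt 5"
  shows "2 ^ n * sqrt 5 * real (fib n) = a ^ n - b ^ n"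
proof -
  have sq: "sqrt 5 * sqrt 5 = (5::real)" by simp
  have a: "a * a = 2 * a + 4" and b: "b * b = 2 * b + 4"
    by (auto simp: a_def b_def algebra_simps)
  show ?thesis
  proof (induction n rule: fib.induct)
    case 2
    then show ?case by (simp add: a_def b_def)
  next
    case (3 n)
    have "a ^ Suc (Suc n) = 2 * a ^ Suc n + 4 * a ^ n"
      using arg_cong[OF a, of "\<lambda>x. x * a ^ n"] by (simp add: algebra_simps)
    moreover have "b ^ Suc (Suc n) = 2 * b ^ Suc n + 4 * b ^ n"
      using arg_cong[OF b, of "\<lambda>x. x * b ^ n"] by (simp add: algebra_simps)
    moreover have "2 ^ Suc (Suc n) * sqrt 5 * real (fib (Suc (Suc n)))
      = 2 * (2 ^ Suc n * sqrt 5 * real (fib (Suc n))) + 4 * (2 ^ n * sqrt 5 * real (fib n))"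
      by (simp add: algebra_simps)
    ultimately show ?case using 3 by (simp add: algebra_simps)
  qed simp
qed

text \<open>In Binet's formula the even powers of sqrt 5 cancel. For n = p or n = p + 1 nearly all
  of these binomial coefficients are divisible by p, which makes the Fibonacci number readable
  modulo p.\<close>

lemma fib_sum_odd_binomials:
  "2 ^ n * fib n = 2 * (\<Sum>k | k \<le> n \<and> odd k. (n choose k) * 5 ^ (k div 2))"
proof -
  have "2 ^ n * sqrt 5 * real (fib n) = (1 + sqrt 5) ^ n - (1 - sqrt 5) ^ n"
    using fib_binomial by simp
  also have "\<dots> = (\<Sum>k\<le>n. real (n choose k) * (sqrt 5 ^ k - (- sqrt 5) ^ k))"
    using binomial_ring[of "sqrt 5" 1 n] binomial_ring[of "- sqrt 5" 1 n]
    by (simp add: sum_subtractf algebra_simps)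
  also have "\<dots> = (\<Sum>k | k \<le> n \<and> odd k. real (n choose k) * (sqrt 5 ^ k - (- sqrt 5) ^ k))"
    by (intro sum.mono_neutral_cong_right) auto
  also have "\<dots> = (\<Sum>k | k \<le> n \<and> odd k. sqrt 5 * (2 * (real (n choose k) * 5 ^ (k div 2))))"
  proof (intro sum.cong refl)
    fix k assume "k \<in> {k. k \<le> n \<and> odd k}"
    then obtain i where "k = 2 * i + 1" by (auto elim: oddE)
    then show "real (n choose k) * (sqrt 5 ^ k - (- sqrt 5) ^ k)
        = sqrt 5 * (2 * (real (n choose k) * 5 ^ (k div 2)))"
      by (simp add: power_mult)
  qed
  finally have "sqrt 5 * real (2 ^ n * fib n)
      = sqrt 5 * real (2 * (\<Sum>k | k \<le> n \<and> odd k. (n choose k) * 5 ^ (k div 2)))"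
    by (simp add: sum_distrib_left mult_ac)
  then show ?thesis by (simp only: mult_cancel_left of_nat_eq_iff) auto
qed

text \<open>Only the term k = p of the binomial sum survives modulo p, and Euler's criterion
  evaluates its power of 5; the powers of 2 are removed by Fermat's theorem.\<close>

lemma cong_fib_prime:
  assumes "prime p" "p > 2"
  shows "[int (fib p) = Legendre 5 (int p)] (mod int p)"
proof -
  have odd: "odd p" using assms prime_odd_nat by auto
  have "2 ^ p * fib p = 2 * (\<Sum>k | k \<le> p \<and> odd k. (p choose k) * 5 ^ (k div 2))"
    by (rule fib_sum_odd_binomials)
  moreover have "[(\<Sum>k | k \<le> p \<and> odd k. (p choose k) * 5 ^ (k div 2))
      = (\<Sum>k | k \<le> p \<and> odd k. if k = p then 5 ^ (p div 2) else 0)] (mod p)"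
  proof (intro cong_sum)
    fix k assume "k \<in> {k. k \<le> p \<and> odd k}"
    then have "k \<noteq> p \<Longrightarrow> p dvd (p choose k)"
      using assms by (intro dvd_choose_prime) (auto intro: Nat.gr0I)
    then show "[(p choose k) * 5 ^ (k div 2) = (if k = p then 5 ^ (p div 2) else 0)] (mod p)"
      by (auto simp: cong_0_iff)
  qed
  moreover have "(\<Sum>k | k \<le> p \<and> odd k. if k = p then 5 ^ (p div 2) else 0) = (5::nat) ^ (p div 2)"
    using odd by (subst sum.delta) auto
  ultimately have "[2 ^ p * fib p = 2 * 5 ^ (p div 2)] (mod p)"
    by (simp only:) (rule cong_scalar_left)
  moreover have "[2 ^ p * fib p = 2 * fib p] (mod p)"
  proof -
    have "\<not> p dvd 2" using assms(2) by (auto dest: dvd_imp_le)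
    then have "[2 ^ (p - 1) = 1] (mod p)" by (rule fermat_theorem[OF assms(1)])
    then have "[2 * 2 ^ (p - 1) = 2 * 1] (mod p)" by (rule cong_scalar_left)
    moreover have "2 * 2 ^ (p - 1) = (2::nat) ^ p" using assms(2) by (cases p) auto
    ultimately show ?thesis by (simp add: cong_scalar_right)
  qed
  ultimately have "[2 * fib p = 2 * 5 ^ (p div 2)] (mod p)"
    using cong_sym cong_trans by blast
  then have "[fib p = 5 ^ (p div 2)] (mod p)"
    using odd by (subst (asm) cong_mult_lcancel_nat) (auto simp: coprime_commute)
  then have "[int (fib p) = 5 ^ (p div 2)] (mod int p)"
    by (simp flip: cong_int_iff)
  moreover have "(p - 1) div 2 = p div 2" using odd by (auto elim: oddE)
  then have "[5 ^ (p div 2) = Legendre 5 (int p)] (mod int p)"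
    using euler_criterion[OF assms, of 5] by (simp add: cong_sym_eq)
  ultimately show ?thesis by (rule cong_trans)
qed

text \<open>Here the terms k = 1 and k = p survive; they contribute 1 and 5^((p-1)/2) = -1 and
  cancel.\<close>

lemma dvd_fib_Suc_prime:
  assumes "prime p" "p > 2" "Legendre 5 (int p) = -1"
  shows "p dvd fib (p + 1)"
proof -
  have odd: "odd p" using assms prime_odd_nat by auto
  define S where "S = {k. k \<le> p + 1 \<and> odd k}"
  have "[(\<Sum>k\<in>S. (p + 1 choose k) * 5 ^ (k div 2))
      = (\<Sum>k\<in>S. (if k = p then 5 ^ (p div 2) else 0) + (if k = 1 then 1 else 0))] (mod p)"
  proof (intro cong_sum)
    fix k assume k: "k \<in> S"
    show "[(p + 1 choose k) * 5 ^ (k div 2)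
      = (if k = p then 5 ^ (p div 2) else 0) + (if k = 1 then 1 else 0)] (mod p)"
    proof (cases "k = 1 \<or> k = p")
      case True
      have "[p + 1 = 1] (mod p)" unfolding Cong.cong_def by (rule mod_add_self1)
      moreover have "[5 ^ (p div 2) + p * 5 ^ (p div 2) = 5 ^ (p div 2)] (mod p)"
        unfolding Cong.cong_def by (rule mod_mult_self2)
      ultimately show ?thesis using True assms(2) by (auto simp: add_mult_distrib)
    next
      case False
      with k odd obtain j where j: "k = Suc j" "0 < j" "j < p" "Suc j < p"
        by (cases k) (auto simp: S_def le_Suc_eq)
      then have "p dvd (p choose j)" "p dvd (p choose Suc j)"
        using assms by (auto intro!: dvd_choose_prime)
      then have "p dvd (p + 1 choose k)" by (simp add: j)
      with False show ?thesis by (simp add: cong_0_iff)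
    qed
  qed
  moreover have "(\<Sum>k\<in>S. (if k = p then 5 ^ (p div 2) else 0) + (if k = 1 then 1 else 0))
      = (5::nat) ^ (p div 2) + 1"
    using odd by (subst sum.distrib, subst (1 2) sum.delta) (auto simp: S_def)
  moreover have "2 ^ (p + 1) * fib (p + 1) = 2 * (\<Sum>k\<in>S. (p + 1 choose k) * 5 ^ (k div 2))"
    unfolding S_def by (rule fib_sum_odd_binomials)
  ultimately have "[2 ^ (p + 1) * fib (p + 1) = 2 * (5 ^ (p div 2) + 1)] (mod p)"
    by (simp only:) (rule cong_scalar_left)
  moreover have "[5 ^ (p div 2) + 1 = (0::nat)] (mod p)"
  proof -
    have "(p - 1) div 2 = p div 2" using odd by (auto elim: oddE)
    then have "[5 ^ (p div 2) = - 1] (mod int p)"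
      using euler_criterion[OF assms(1,2), of 5] assms(3) by (simp add: cong_sym_eq)
    then have "int p dvd 5 ^ (p div 2) + 1" by (simp add: cong_iff_dvd_diff)
    then have "int p dvd int (5 ^ (p div 2) + 1)" by (simp add: add.commute)
    then show ?thesis by (simp only: cong_0_iff of_nat_dvd_iff)
  qed
  then have "[2 * (5 ^ (p div 2) + 1) = 2 * (0::nat)] (mod p)"
    by (rule cong_scalar_left)
  ultimately have "[2 ^ (p + 1) * fib (p + 1) = 0] (mod p)"
    unfolding mult_zero_right by (rule cong_trans)
  then have "p dvd 2 ^ (p + 1) * fib (p + 1)" by (simp only: cong_0_iff)
  moreover have "\<not> p dvd 2 ^ (p + 1)"
    using assms by (metis prime_dvd_power primes_dvd_imp_eq two_is_prime_nat less_irrefl)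
  ultimately show ?thesis using assms(1) prime_dvd_mult_nat by blast
qed

lemma Legendre_5:
  assumes "prime p" "p > 2" "p mod 5 = 2"
  shows "Legendre 5 (int p) = -1"
proof -
  have "Legendre (int p) 5 * Legendre 5 (int p) = 1"
    using Quadratic_Reciprocity[of p 5] assms
    by (cases "p = 5") (auto simp: power_mult minus_one_power_iff)
  moreover have "Legendre (int p) 5 = -1"
  proof -
    have p2: "[int p = 2] (mod 5)"
      using assms(3) unfolding Cong.cong_def by (metis mod_mod_trivial of_nat_mod of_nat_numeral)
    have "\<not> [x\<^sup>2 = int p] (mod 5)" for x :: int
    proof
      assume "[x\<^sup>2 = int p] (mod 5)"
      with p2 have "x\<^sup>2 mod 5 = 2" by (simp add: Cong.cong_def)
      moreover have "x\<^sup>2 mod 5 = (x mod 5)\<^sup>2 mod 5" by (simp add: power_mod)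
      moreover have "x mod 5 \<in> {0, 1, 2, 3, 4}" by auto
      ultimately show False by auto
    qed
    moreover have "\<not> [int p = 0] (mod 5)" using p2 by (simp add: Cong.cong_def)
    ultimately show ?thesis by (simp add: Legendre_def QuadRes_def)
  qed
  ultimately show ?thesis by simp
qed

text \<open>As 5 is a nonresidue, p divides \<open>fib (p + 1)\<close>. If 2^k did not divide m, p
  would even divide \<open>fib M\<close> for M = (p + 1)/2. Writing p = 2 M - 1, the addition
  formula and Cassini's identity would then give \<open>fib p\<close> = 1 modulo p, against the
  value -1 of the Legendre symbol.\<close>

lemma two_power_dvd_index:
  assumes "prime p" "k \<ge> 2" "[p + 1 = 0] (mod 2 ^ k)" "p mod 5 = 2" "p dvd fib m"
  shows "2 ^ k dvd m"
proof (rule ccontr)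
  assume *: "\<not> 2 ^ k dvd m"
  have dvd: "2 ^ k dvd p + 1" using assms(3) by (simp add: cong_0_iff)
  have "4 dvd (2::nat) ^ k" using assms(2) le_imp_power_dvd[of 2 k "2::nat"] by simp
  with dvd have four: "4 dvd p + 1" by (rule dvd_trans[rotated])
  then have p2: "p > 2" using assms(1) prime_ge_2_nat[of p] by (cases "p = 2") auto
  define M where "M = (p + 1) div 2"
  \<comment> \<open>\<open>k \<ge> 2\<close> makes M even, which decides the sign in Cassini's
    identity.\<close>
  have M: "2 * M = p + 1" "even M" using four unfolding M_def by auto
  have L: "Legendre 5 (int p) = -1" using Legendre_5 assms(1,4) p2 by blast
  have "p dvd fib (gcd m (p + 1))"
    using dvd_fib_Suc_prime[OF assms(1) p2 L] assms(5) by (simp add: fib_gcd)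
  \<comment> \<open>The cofactor of the gcd in p + 1 must be even, or else all of 2^k would remain
    in the gcd.\<close>
  moreover have "gcd m (p + 1) dvd M"
  proof -
    obtain c where c: "p + 1 = gcd m (p + 1) * c" by (meson dvdE gcd_dvd2)
    have "even c"
    proof (rule ccontr)
      assume "odd c"
      then have "coprime (2 ^ k) c" by simp
      with dvd c have "2 ^ k dvd gcd m (p + 1)" by (metis coprime_dvd_mult_left_iff)
      with * show False by simp
    qed
    then obtain c' where "c = 2 * c'" by (auto elim: evenE)
    with c M(1) have "M = gcd m (p + 1) * c'" by auto
    then show ?thesis by (rule dvdI)
  qed
  ultimately have pM: "p dvd fib M"
    by (metis dvd_trans fib_gcd gcd_dvd2 gcd_nat.absorb1)
  obtain q where q: "M = Suc q" using M(1) by (cases M) auto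
  have "p = Suc (q + q)" using M(1) q by simp
  then have "int (fib p) = int (fib (Suc q)) * int (fib (Suc q)) + int (fib q) * int (fib q)"
    using fib_add[of q q] by (metis of_nat_add of_nat_mult)
  moreover have "int (fib (Suc (Suc q)) * fib q) - int ((fib (Suc q))\<^sup>2) = 1"
    using fib_Cassini_int[of q] M(2) q by simp
  ultimately have "int (fib p) = 1 + int (fib M) * (2 * int (fib M) - int (fib q))"
    unfolding q by (simp add: power2_eq_square algebra_simps)
  moreover have "int p dvd int (fib M)" using pM by simp
  ultimately have "[int (fib p) = 1] (mod int p)"
    by (simp add: cong_iff_dvd_diff)
  with cong_fib_prime[OF assms(1) p2] L have "[1 = - 1] (mod int p)"
    by (metis cong_sym cong_trans)
  then have "int p dvd 2" by (simp add: cong_iff_dvd_diff)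
  then show False using p2 zdvd_imp_le by fastforce
qed

section \<open>The cubic attached to the rank of apparition\<close>

text \<open>If a^3 and b^3 are the golden ratio and its conjugate and a b = -1, then (a + b)^3 = 1 -
  3 (a + b), so a + b is a root.\<close>

definition cubic :: "int \<Rightarrow> int" where
  "cubic x = x ^ 3 + 3 * x - 1"

definition cubic_roots :: "nat \<Rightarrow> nat set" where
  "cubic_roots n = {a. a < n \<and> int n dvd cubic (int a)}"

text \<open>The Lucas number \<open>F\<^sub>n\<^sub>+\<^sub>1 + F\<^sub>n\<^sub>-\<^sub>1\<close>,
  written without the index n - 1.\<close>

definition lucas :: "nat \<Rightarrow> int" where
  "lucas n = 2 * int (fib (n + 1)) - int (fib n)"

lemma finite_cubic_roots [simp]: "finite (cubic_roots n)"
  unfolding cubic_roots_def by (rule finite_subset[of _ "{..<n}"]) auto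

lemma fib_Cassini_odd:
  assumes "odd e"
  shows "int (fib (e + 1)) ^ 2 - int (fib e) * int (fib (e + 1)) - int (fib e) ^ 2 = -1"
  using fib_Cassini_int[of e] assms by (simp add: algebra_simps power2_eq_square)

text \<open>The norm equation for odd powers of the golden ratio. It turns the discriminant -3 (y^2
  + 4) of the quadratic cofactor at a root y = \<open>lucas e\<close> into -15 times a
  square.\<close>

lemma lucas_square:
  assumes "odd e"
  shows "lucas e ^ 2 + 4 = 5 * int (fib e) ^ 2"
proof -
  define a b where "a = int (fib e)" and "b = int (fib (e + 1))"
  have "b ^ 2 - a * b - a ^ 2 = -1"
    using fib_Cassini_odd[OF assms] unfolding a_def b_def .
  then have "(2 * b - a) ^ 2 + 4 = 5 * a ^ 2" by Groebner_Basis.algebra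
  then show ?thesis unfolding lucas_def a_def b_def .
qed

text \<open>With \<open>lucas e\<close> = a + b for conjugate powers satisfying a b = -1, this is
  the formula for a^3 + b^3; the proof expresses everything through two consecutive Fibonacci
  numbers, tied by Cassini's identity.\<close>

lemma lucas_triple:
  assumes "odd e"
  shows "lucas (3 * e) = lucas e ^ 3 + 3 * lucas e"
proof -
  define a b where "a = int (fib e)" and "b = int (fib (e + 1))"
  have c: "b ^ 2 - a * b - a ^ 2 = -1"
    using fib_Cassini_odd[OF assms] unfolding a_def b_def .
  have e1: "int (fib (2 * e + 1)) = a ^ 2 + b ^ 2"
    using fib_add[of e e] unfolding a_def b_def
    by (simp add: power2_eq_square mult_2)
  have "int (fib (2 * e + 2)) = int (fib (Suc (e + Suc e)))" by (simp add: mult_2)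
  also have "\<dots> = (a + b) * b + b * a"
    unfolding fib_add[of e "Suc e"] unfolding a_def b_def by (simp add: algebra_simps)
  finally have e2: "int (fib (2 * e)) = a * (2 * b - a)"
    using e1 by (simp add: algebra_simps power2_eq_square)
  have "int (fib (3 * e + 1)) = int (fib (Suc (2 * e + e)))" by simp
  also have "\<dots> = b * int (fib (2 * e + 1)) + a * int (fib (2 * e))"
    unfolding fib_add[of "2 * e" e] by (simp add: a_def b_def)
  finally have e3: "int (fib (3 * e + 1)) = b * (a ^ 2 + b ^ 2) + a * (a * (2 * b - a))"
    unfolding e1 e2 .
  have "int (fib (3 * e + 2)) = int (fib (Suc (2 * e + Suc e)))" by (simp add: algebra_simps)
  also have "\<dots> = (a + b) * int (fib (2 * e + 1)) + b * int (fib (2 * e))"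
    unfolding fib_add[of "2 * e" "Suc e"] by (simp add: a_def b_def algebra_simps)
  also have "\<dots> = (a + b) * (a ^ 2 + b ^ 2) + b * (a * (2 * b - a))"
    unfolding e1 e2 ..
  finally have "lucas (3 * e) = 3 * (b * (a ^ 2 + b ^ 2) + a * (a * (2 * b - a)))
      - ((a + b) * (a ^ 2 + b ^ 2) + b * (a * (2 * b - a)))"
    using e3 by (simp add: lucas_def)
  moreover have "lucas e = 2 * b - a" by (simp add: lucas_def a_def b_def)
  ultimately show ?thesis using c by Groebner_Basis.algebra
qed

text \<open>If p divides \<open>fib m\<close>, shifting the index by m multiplies the sequence
  modulo p by \<open>fib (m + 1)\<close>, whose square is (-1)^m and whose fourth power is therefore
  1. So 4 m is a period.\<close>

lemma fib_period:
  assumes "int p dvd int (fib m)"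
  shows "int p dvd int (fib (4 * m * j))" "int p dvd int (fib (4 * m * j + 1)) - 1"
proof -
  have dbl: "int (fib (Suc (a + b))) =
      int (fib (Suc b)) * int (fib (Suc a)) + int (fib b) * int (fib a)" for a b
    by (simp add: fib_add)
  have mono: "int p dvd int (fib (m * i))" for i
  proof -
    have "fib m dvd fib (m * i)"
      using fib_gcd[of m "m * i"] by (metis gcd_dvd2 dvd_triv_left gcd_nat.absorb1)
    then show ?thesis using assms by (metis dvd_trans int_dvd_int_iff)
  qed
  show z: "int p dvd int (fib (4 * m * j))" for j
    using mono[of "4 * j"] by (simp add: mult_ac)
  have cas: "int (fib (m + 1)) ^ 2 - int (fib (m + 2)) * int (fib m) = (-1) ^ m"
    using fib_Cassini_int[of m] by simp
  have "((-1::int) ^ m) ^ 2 = 1" by (simp flip: power_mult)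
  moreover have "int (fib (2 * m + 1)) = int (fib (m + 1)) ^ 2 + int (fib m) ^ 2"
    using dbl[of m m] by (simp add: mult_2 power2_eq_square)
  moreover have "int (fib (4 * m + 1)) = int (fib (2 * m + 1)) ^ 2 + int (fib (2 * m)) ^ 2"
    using dbl[of "2 * m" "2 * m"] by (simp add: power2_eq_square)
  moreover have "int p dvd int (fib (2 * m))" using mono[of 2] by (simp add: mult.commute)
  moreover have "(P::int) dvd A4 - 1"
    if "s ^ 2 = 1" "A2 = A1 ^ 2 + A ^ 2" "A4 = A2 ^ 2 + B ^ 2" "P dvd B" "A1 ^ 2 - C * A = s" "P dvd A"
    for P s A A1 A2 A4 B C :: int
    using that by Groebner_Basis.algebra
  ultimately have one: "int p dvd int (fib (4 * m + 1)) - 1"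
    using cas assms by blast
  show "int p dvd int (fib (4 * m * j + 1)) - 1"
  proof (induction j)
    case (Suc j)
    have "int (fib (4 * m * Suc j + 1)) = int (fib (4 * m * j + 1)) * int (fib (4 * m + 1))
      + int (fib (4 * m * j)) * int (fib (4 * m))"
      using dbl[of "4 * m" "4 * m * j"] by (simp add: algebra_simps)
    moreover have "(P::int) dvd a * b + c * d - 1" if "P dvd a - 1" "P dvd b - 1" "P dvd c"
      for P a b c d :: int using that by Groebner_Basis.algebra
    ultimately show ?case using Suc.IH one z[of j] by metis
  qed simp
qed

text \<open>With \<open>3 e = 1 + 4 m j\<close>, the Lucas number \<open>L\<^sub>e\<close> is a trace of the cube root of the golden ratio
  modulo \<open>p\<close>.\<close>

lemma cubic_root_lucas:
  assumes "int p dvd int (fib m)" "\<not> 3 dvd m"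
  obtains e where "odd e" "int p dvd cubic (lucas e)"
proof -
  \<comment> \<open>A congruence solvable because 3 does not divide m. The even term also makes e
    odd, as \<open>lucas_triple\<close> demands.\<close>
  obtain j where "3 dvd 1 + 4 * m * j"
  proof (cases "m mod 3 = 1")
    case True
    then have "3 dvd 1 + 4 * m * 2" by presburger
    then show ?thesis by (rule that)
  next
    case False
    then have "m mod 3 = 2" using assms(2) by presburger
    then have "3 dvd 1 + 4 * m * 1" by presburger
    then show ?thesis by (rule that)
  qed
  then obtain e where e: "1 + 4 * m * j = 3 * e" by (auto elim: dvdE)
  have "odd (1 + 4 * m * j)" by simp
  then have odd: "odd e" unfolding e by simp
  \<comment> \<open>By periodicity this is congruent to the Lucas number of index 1, which is 1;
    hence \<open>lucas e\<close> is a root.\<close>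
  have "lucas (3 * e) = int (fib (4 * m * j + 1)) + 2 * int (fib (4 * m * j))"
    unfolding lucas_def e[symmetric] by simp
  then have "lucas (3 * e) - 1 = (int (fib (4 * m * j + 1)) - 1) + 2 * int (fib (4 * m * j))"
    by simp
  then have "int p dvd lucas (3 * e) - 1"
    using fib_period[OF assms(1), of j] by (metis dvd_add dvd_mult)
  then have "int p dvd cubic (lucas e)"
    unfolding cubic_def lucas_triple[OF odd] .
  with odd show ?thesis by (rule that)
qed

lemma cubic_mod: "int n dvd cubic (x mod int n) \<longleftrightarrow> int n dvd cubic x"
proof -
  have "[cubic (x mod int n) = cubic x] (mod int n)"
    unfolding cubic_def by (intro cong_diff cong_add cong_mult cong_pow) (auto simp: Cong.cong_def)
  then show ?thesis by (metis cong_dvd_iff)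
qed

lemma nat_mod_in_cubic_roots:
  assumes "n > 0" "int n dvd cubic x"
  shows "nat (x mod int n) \<in> cubic_roots n"
  using assms unfolding cubic_roots_def by (auto simp: cubic_mod nat_less_iff)

lemma card_cubic_roots_ge_1:
  assumes "p > 0" "p dvd fib m" "\<not> 3 dvd m"
  shows "card (cubic_roots p) \<ge> 1"
proof -
  obtain e where "int p dvd cubic (lucas e)"
    using cubic_root_lucas[of p m] assms by auto
  then have "cubic_roots p \<noteq> {}" using nat_mod_in_cubic_roots[OF assms(1)] by blast
  then show ?thesis by (simp add: card_gt_0_iff Suc_le_eq)
qed

text \<open>Dividing the cubic by X - y leaves X^2 + y X + y^2 + 3, of discriminant -3 (y^2 + 4) =
  -15 F^2. With w^2 = -15 modulo p the other roots are (-y + F w)/2 and (-y - F w)/2; the three are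
  distinct because p does not divide the discriminant -135.\<close>

lemma card_cubic_roots_ge_3:
  assumes "prime p" "p > 5" "p dvd fib m" "\<not> 3 dvd m" "int p dvd w ^ 2 + 15"
  shows "card (cubic_roots p) \<ge> 3"
proof -
  obtain e where e: "odd e" "int p dvd cubic (lucas e)"
    using cubic_root_lucas[of p m] assms by auto
  define y F P where "y = lucas e" and "F = int (fib e)" and "P = int p"
  have y: "P dvd y ^ 3 + 3 * y - 1" using e(2) unfolding cubic_def y_def P_def .
  have yF: "y ^ 2 + 4 = 5 * F ^ 2" using lucas_square[OF e(1)] unfolding y_def F_def .
  have w: "P dvd w ^ 2 + 15" using assms(5) unfolding P_def .
  have P: "prime P" "P > 5" using assms unfolding P_def by auto
  have pd: "P dvd a \<or> P dvd b" if "P dvd a * b" for a b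
    using that P(1) prime_dvd_mult_iff by blast
  have small: "\<not> P dvd 2" "\<not> P dvd 3" "\<not> P dvd 5"
    using P(2) by (auto dest!: zdvd_imp_le)
  \<comment> \<open>The inverse of 2 modulo P.\<close>
  define h where "h = (P + 1) div 2"
  have "odd P" using P prime_odd_int[of P] by auto
  then have h: "2 * h = P + 1" unfolding h_def by (auto elim: oddE)
  define z1 z2 where "z1 = h * (- y + F * w)" and "z2 = h * (- y - F * w)"
  have root: "P dvd cubic z" if s: "s = - y + F * v" and z: "2 * z = (P + 1) * s"
    and v: "P dvd v ^ 2 + 15" for z s v
  proof -
    \<comment> \<open>Multiplying by 8 brings in 2 z, congruent to s. The value at s is then split
      into multiples of the three quantities known to vanish modulo P or exactly.\<close>
    have "8 * cubic z = (2 * z) ^ 3 + 12 * (2 * z) - 8"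
      unfolding cubic_def by Groebner_Basis.algebra
    also have "\<dots> = P * ((P ^ 2 + 3 * P + 3) * s ^ 3 + 12 * s) + (s ^ 3 + 12 * s - 8)"
      unfolding z by Groebner_Basis.algebra
    also have "s ^ 3 + 12 * s - 8 = 8 * (y ^ 3 + 3 * y - 1)
        + (v ^ 2 + 15) * (F ^ 3 * v - 3 * y * F ^ 2) + 3 * (F * v - 3 * y) * (y ^ 2 + 4 - 5 * F ^ 2)"
      unfolding s by Groebner_Basis.algebra
    finally have "8 * cubic z = P * ((P ^ 2 + 3 * P + 3) * s ^ 3 + 12 * s)
        + (8 * (y ^ 3 + 3 * y - 1) + (v ^ 2 + 15) * (F ^ 3 * v - 3 * y * F ^ 2))"
      using yF by simp
    then have "P dvd 8 * cubic z"
      using y v by (metis dvd_add dvd_mult dvd_mult2 dvd_triv_left)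
    then have "P dvd 2 * (2 * (2 * cubic z))" by simp
    then show ?thesis using pd small by blast
  qed
  have "2 * z1 = (P + 1) * (- y + F * w)" "2 * z2 = (P + 1) * (- y + F * (- w))"
    unfolding z1_def z2_def h[symmetric] by simp_all
  moreover have "P dvd (- w) ^ 2 + 15" using w by simp
  ultimately have z1: "P dvd cubic z1" and z2: "P dvd cubic z2"
    using root[OF refl] w by blast+
  have F: "\<not> P dvd F"
  proof
    assume "P dvd F"
    moreover have e1: "y + 1 = F * (5 * y * F) - (y ^ 3 + 3 * y - 1)"
      using yF by Groebner_Basis.algebra
    ultimately have "P dvd y + 1" unfolding e1 using y by (metis dvd_diff dvd_mult2)
    moreover have "5 = F * (5 * F) - (y + 1) * (y - 1)" using yF by Groebner_Basis.algebra
    ultimately have "P dvd 5" using \<open>P dvd F\<close> by (metis dvd_diff dvd_mult2)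
    with small show False by simp
  qed
  have wn: "\<not> P dvd w"
  proof
    assume "P dvd w"
    moreover have "3 * 5 = (w ^ 2 + 15) - w * w" by (simp add: power2_eq_square)
    ultimately have "P dvd 3 * 5" using w by (metis dvd_diff dvd_mult2)
    then show False using pd small by blast
  qed
  \<comment> \<open>A new root equal to y would mean 3 y = F w or 3 y = - F w modulo P, hence this
    divisibility by squaring.\<close>
  have key: False if "P dvd 9 * y ^ 2 + 15 * F ^ 2"
  proof -
    have "9 * y ^ 2 + 15 * F ^ 2 = 2 * (2 * (3 * (y ^ 2 + 1)))" using yF by simp
    then have *: "P dvd y ^ 2 + 1" using that pd small by metis
    moreover have e1: "2 * y - 1 = (y ^ 3 + 3 * y - 1) - (y ^ 2 + 1) * y"
      by Groebner_Basis.algebra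
    ultimately have "P dvd 2 * y - 1" unfolding e1 using y by (metis dvd_diff dvd_mult2)
    moreover have "5 = (y ^ 2 + 1) * 4 - (2 * y - 1) * (2 * y + 1)" by Groebner_Basis.algebra
    ultimately have "P dvd 5" using * by (metis dvd_diff dvd_mult2)
    with small show False by simp
  qed
  have d1: "\<not> P dvd z1 - z2"
  proof
    assume "P dvd z1 - z2"
    moreover have "F * w = (z1 - z2) - P * (F * w)"
      unfolding z1_def z2_def using h by Groebner_Basis.algebra
    ultimately have "P dvd F * w" by (metis dvd_diff dvd_triv_left)
    then show False using pd small F wn by blast
  qed
  have d2: "\<not> P dvd z1 - y"
  proof
    assume "P dvd z1 - y"
    moreover have "3 * y - F * w = P * (- y + F * w) - (z1 - y) * 2"
      unfolding z1_def using h by Groebner_Basis.algebra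
    ultimately have "P dvd 3 * y - F * w" by (metis dvd_diff dvd_mult2 dvd_triv_left)
    moreover have "9 * y ^ 2 + 15 * F ^ 2 = (3 * y - F * w) * (3 * y + F * w) + (w ^ 2 + 15) * F ^ 2"
      by Groebner_Basis.algebra
    ultimately have "P dvd 9 * y ^ 2 + 15 * F ^ 2" using w by (metis dvd_add dvd_mult2)
    then show False by (rule key)
  qed
  have d3: "\<not> P dvd z2 - y"
  proof
    assume "P dvd z2 - y"
    moreover have "3 * y + F * w = P * (- y - F * w) - (z2 - y) * 2"
      unfolding z2_def using h by Groebner_Basis.algebra
    ultimately have "P dvd 3 * y + F * w" by (metis dvd_diff dvd_mult2 dvd_triv_left)
    moreover have "9 * y ^ 2 + 15 * F ^ 2 = (3 * y + F * w) * (3 * y - F * w) + (w ^ 2 + 15) * F ^ 2"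
      by Groebner_Basis.algebra
    ultimately have "P dvd 9 * y ^ 2 + 15 * F ^ 2" using w by (metis dvd_add dvd_mult2)
    then show False by (rule key)
  qed
  have neq: "nat (a mod P) \<noteq> nat (b mod P)" if "\<not> P dvd a - b" for a b
    using that P(2) by (auto simp: mod_eq_dvd_iff eq_nat_nat_iff)
  have "card {nat (z1 mod P), nat (z2 mod P), nat (y mod P)} = 3"
    using neq[OF d1] neq[OF d2] neq[OF d3] by simp
  moreover have "{nat (z1 mod P), nat (z2 mod P), nat (y mod P)} \<subseteq> cubic_roots p"
    using z1 z2 e(2) assms(1) unfolding P_def y_def
    by (auto intro!: nat_mod_in_cubic_roots prime_gt_0_nat)
  ultimately show ?thesis by (metis card_mono finite_cubic_roots)
qed

section \<open>Primes for which -15 is a square\<close>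

lemma Legendre_eq_1_obtain:
  assumes "Legendre a p = 1"
  obtains x where "p dvd x ^ 2 - a"
proof -
  have "QuadRes p a" using assms by (auto simp: Legendre_def split: if_splits)
  then show ?thesis using that by (auto simp: QuadRes_def cong_iff_dvd_diff)
qed

text \<open>Since p is 1 modulo 4, -1 is a square and reciprocity holds without sign; since p is 1
  modulo 3 and 5, these two are squares as well. The product of the three roots is w.\<close>

lemma minus_15_square:
  assumes "prime p" "p mod 60 = 1"
  obtains w where "int p dvd w ^ 2 + 15"
proof -
  have p2: "p > 2" using assms prime_ge_2_nat[of p] by (cases "p = 2") auto
  define c where "c = p div 60"
  have c: "p = 60 * c + 1" using div_mult_mod_eq[of p 60] assms(2) unfolding c_def by simp
  have "(p - 1) div 2 = 2 * (15 * c)" unfolding c by simp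
  then have ev: "even ((p - 1) div 2)" by simp
  have QR: "Legendre (int q) (int p) = Legendre (int p) (int q)" if "prime q" "q > 2" "p \<noteq> q" for q
  proof -
    have "even ((q - 1) div 2 * ((p - 1) div 2))" using ev by (rule dvd_mult)
    then have "Legendre (int q) (int p) * Legendre (int p) (int q) = 1"
      unfolding Quadratic_Reciprocity[OF that(1,2) assms(1) p2 that(3)[symmetric]]
      by (rule neg_one_even_power)
    then show ?thesis by (auto simp: zmult_eq_1_iff)
  qed
  have one: "Legendre (int p) q = 1" if "q dvd int p - 1" "q > 1" for q
  proof -
    have "[int p = 1] (mod q)" using that(1) by (simp add: cong_iff_dvd_diff)
    then have "QuadRes q (int p)" "\<not> [int p = 0] (mod q)"
      using that(2) unfolding QuadRes_def
      by (auto intro!: exI[of _ 1] simp: cong_sym_eq) (auto simp: Cong.cong_def)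
    then show ?thesis by (simp add: Legendre_def)
  qed
  have "int p - 1 = 3 * (20 * int c)" "int p - 1 = 5 * (12 * int c)" unfolding c by simp_all
  then have "3 dvd int p - 1" "5 dvd int p - 1" by (metis dvd_triv_left)+
  moreover have "p \<noteq> 3" "p \<noteq> 5" using assms(2) by auto
  ultimately have "Legendre 3 (int p) = 1" "Legendre 5 (int p) = 1"
    using QR[of 3] QR[of 5] one[of 3] one[of 5] by simp_all
  then obtain s t where s: "int p dvd s ^ 2 - 3" and t: "int p dvd t ^ 2 - 5"
    using Legendre_eq_1_obtain by metis
  have "[Legendre (- 1) (int p) = 1] (mod int p)"
    using euler_criterion[OF assms(1) p2, of "-1"] ev by simp
  then have "Legendre (- 1) (int p) = 1"
    using p2 by (auto simp: Legendre_def cong_iff_dvd_diff split: if_splits dest!: zdvd_imp_le)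
  then obtain i where i: "int p dvd i ^ 2 - (- 1)" by (rule Legendre_eq_1_obtain)
  have "int p dvd (i * s * t) ^ 2 + 15" using s t i by Groebner_Basis.algebra
  then show ?thesis by (rule that)
qed

section \<open>Counting roots of the cubic modulo all integers\<close>

text \<open>The norm of \<open>u + v \<theta> + w \<theta>\<^sup>2\<close>, where \<open>\<theta>\<^sup>3 + 3 \<theta> - 1 = 0\<close>.\<close>

definition cnorm :: "int \<Rightarrow> int \<Rightarrow> int \<Rightarrow> int" where
  "cnorm u v w = u ^ 3 - 6 * u ^ 2 * w + 9 * u * w ^ 2 - 3 * u * v * w + 3 * u * v ^ 2
     + 3 * v * w ^ 2 + v ^ 3 + w ^ 3"

text \<open>The coordinates of the complementary factor \<open>\<beta>*\<close>, where \<open>\<beta> \<beta>*\<close> is the norm of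
  \<open>\<beta> = u + v \<theta> + w \<theta>\<^sup>2\<close>.\<close>

definition conj0 :: "int \<Rightarrow> int \<Rightarrow> int \<Rightarrow> int" where
  "conj0 u v w = (u - 3 * w) ^ 2 - v * (w - 3 * v)"

definition conj1 :: "int \<Rightarrow> int \<Rightarrow> int \<Rightarrow> int" where
  "conj1 u v w = w ^ 2 - u * v"

definition conj2 :: "int \<Rightarrow> int \<Rightarrow> int \<Rightarrow> int" where
  "conj2 u v w = v ^ 2 - w * (u - 3 * w)"

lemma cnorm_conj:
  "cnorm u v w = u * conj0 u v w + w * conj1 u v w + v * conj2 u v w"
  "u * conj1 u v w + v * conj0 u v w - 3 * (v * conj2 u v w + w * conj1 u v w) + w * conj2 u v w = 0"
  "u * conj2 u v w + v * conj1 u v w + w * conj0 u v w - 3 * (w * conj2 u v w) = 0"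
  unfolding cnorm_def conj0_def conj1_def conj2_def by (Groebner_Basis.algebra)+

text \<open>If \<open>\<beta>(a) \<equiv> 0\<close> modulo \<open>n\<close> for a root \<open>a\<close> of the cubic modulo \<open>n\<close>, then
  \<open>n\<close> divides \<open>(\<theta> - a) \<beta>*\<close>.\<close>

lemma dvd_conj:
  assumes "n dvd cubic a" "n dvd u + v * a + w * a ^ 2"
  shows "n dvd conj2 u v w - a * conj0 u v w"
    and "n dvd conj0 u v w - 3 * conj2 u v w - a * conj1 u v w"
    and "n dvd conj1 u v w - a * conj2 u v w"
    and "n dvd cnorm u v w"
proof -
  obtain k where k: "a ^ 3 + 3 * a - 1 = n * k"
    using assms(1) unfolding cubic_def by (auto elim: dvdE)
  obtain l where l: "u + v * a + w * a ^ 2 = n * l"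
    using assms(2) by (auto elim: dvdE)
  have u: "u = n * l - v * a - w * a ^ 2" using l by simp
  have "conj2 u v w - a * conj0 u v w = n * (- (v ^ 2 * k) - 2 * v * w * a * k + 2 * v * a ^ 2 * l
      - w ^ 2 * a ^ 2 * k - 3 * w ^ 2 * k + 2 * w * n * k * l + w * l - a * n * l ^ 2)"
    unfolding conj0_def conj2_def u using k by Groebner_Basis.algebra
  then show 0: "n dvd conj2 u v w - a * conj0 u v w" by (rule dvdI)
  have "conj0 u v w - 3 * conj2 u v w - a * conj1 u v w = n * (v * w * k - v * a * l
      + w ^ 2 * a * k - 2 * w * a ^ 2 * l - 3 * w * l + n * l ^ 2)"
    unfolding conj0_def conj1_def conj2_def u using k by Groebner_Basis.algebra
  then show "n dvd conj0 u v w - 3 * conj2 u v w - a * conj1 u v w" by (rule dvdI)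
  have "conj1 u v w - a * conj2 u v w = n * (- (v * l) - w ^ 2 * k + w * a * l)"
    unfolding conj1_def conj2_def u using k by Groebner_Basis.algebra
  then show 2: "n dvd conj1 u v w - a * conj2 u v w" by (rule dvdI)
  have "cnorm u v w = (u + v * a + w * a ^ 2) * conj0 u v w + (conj1 u v w - a * conj2 u v w) * w
      + (conj2 u v w - a * conj0 u v w) * (w * a + v)"
    unfolding cnorm_conj(1) by Groebner_Basis.algebra
  then show "n dvd cnorm u v w" using 0 2 assms(2) by (metis dvd_add dvd_mult2)
qed

lemma even_cnorm:
  assumes "even (cnorm u v w)"
  shows "even u \<and> even v \<and> even w"
  \<comment> \<open>since \<open>X\<^sup>3 + X + 1\<close> is irreducible modulo 2\<close>
proof -
  have "even (cnorm u v w) \<longleftrightarrow> even (u ^ 3 + u * w ^ 2 + u * v * w + u * v ^ 2 + v * w ^ 2 + v ^ 3 + w ^ 3)"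
    unfolding cnorm_def by simp
  with assms show ?thesis by auto
qed

text \<open>Infinite descent: a zero of the norm form has even coordinates by
  \<open>even_cnorm\<close>, and halving them gives another zero because the form is
  homogeneous.\<close>

lemma cnorm_eq_0_iff: "cnorm u v w = 0 \<longleftrightarrow> u = 0 \<and> v = 0 \<and> w = 0"
proof
  show "u = 0 \<and> v = 0 \<and> w = 0" if "cnorm u v w = 0"
    using that
  proof (induction "nat (\<bar>u\<bar> + \<bar>v\<bar> + \<bar>w\<bar>)" arbitrary: u v w rule: less_induct)
    case less
    show ?case
    proof (rule ccontr)
      assume *: "\<not> (u = 0 \<and> v = 0 \<and> w = 0)"
      from even_cnorm[of u v w] less.prems obtain a b c where abc: "u = 2 * a" "v = 2 * b" "w = 2 * c"
        by (auto elim!: evenE)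
      have "8 * cnorm a b c = cnorm u v w" unfolding abc cnorm_def by Groebner_Basis.algebra
      then have "cnorm a b c = 0" using less.prems by simp
      moreover have "nat (\<bar>a\<bar> + \<bar>b\<bar> + \<bar>c\<bar>) < nat (\<bar>u\<bar> + \<bar>v\<bar> + \<bar>w\<bar>)"
        using * unfolding abc by (auto simp: abs_mult)
      ultimately have "a = 0 \<and> b = 0 \<and> c = 0" using less.hyps by blast
      with * abc show False by simp
    qed
  qed
qed (simp add: cnorm_def)

text \<open>The absolute values of the coefficients of the form add up to 27.\<close>

lemma cnorm_bound:
  assumes "\<bar>u\<bar> \<le> t" "\<bar>v\<bar> \<le> t" "\<bar>w\<bar> \<le> t"
  shows "\<bar>cnorm u v w\<bar> \<le> 27 * t ^ 3"
proof -
  have t: "t \<ge> 0" using assms by linarith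
  have m: "\<bar>x * y * z\<bar> \<le> t ^ 3" if "\<bar>x\<bar> \<le> t" "\<bar>y\<bar> \<le> t" "\<bar>z\<bar> \<le> t" for x y z
    using that t unfolding abs_mult power3_eq_cube by (intro mult_mono) auto
  have eq: "cnorm u v w = u * u * u - 6 * (u * u * w) + 9 * (u * w * w) - 3 * (u * v * w)
      + 3 * (u * v * v) + 3 * (v * w * w) + v * v * v + w * w * w"
    unfolding cnorm_def by (simp add: power2_eq_square power3_eq_cube)
  have m': "x * y * z \<le> t ^ 3 \<and> - (x * y * z) \<le> t ^ 3"
    if "\<bar>x\<bar> \<le> t" "\<bar>y\<bar> \<le> t" "\<bar>z\<bar> \<le> t" for x y z
    using m[OF that] unfolding abs_le_iff by simp
  note a = assms and b = m'[OF a(1) a(1) a(1)] m'[OF a(1) a(1) a(3)] m'[OF a(1) a(3) a(3)]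
    m'[OF a(1,2,3)] m'[OF a(1) a(2) a(2)] m'[OF a(2) a(3) a(3)] m'[OF a(2) a(2) a(2)]
    m'[OF a(3) a(3) a(3)]
  have "cnorm u v w \<le> 27 * t ^ 3" "- cnorm u v w \<le> 27 * t ^ 3"
    using b unfolding eq by linarith+
  then show ?thesis by (rule abs_leI)
qed

text \<open>Thue's argument: with t the integer part of the cube root of n, there are (t + 1)^3 > n
  triples with entries in 0..t, so two of them take the same value modulo n; their difference is the
  required element.\<close>

lemma small_multiple:
  fixes n :: nat and a :: int
  assumes "n > 0"
  obtains u v w :: int and t :: nat
  where "(u, v, w) \<noteq> (0, 0, 0)" "\<bar>u\<bar> \<le> int t" "\<bar>v\<bar> \<le> int t" "\<bar>w\<bar> \<le> int t" "t ^ 3 \<le> n"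
    "int n dvd u + v * a + w * a ^ 2"
proof -
  define t where "t = nth_root_nat 3 n"
  have t: "t ^ 3 \<le> n" "n < (Suc t) ^ 3"
    using nth_root_nat_power_le[of 3 n] nth_root_nat_ge[of 3 "Suc t" n]
    unfolding t_def by (auto simp flip: not_le)
  define f where "f = (\<lambda>(u, v, w). (u + v * a + w * a ^ 2) mod int n)"
  define B where "B = {0..int t} \<times> {0..int t} \<times> {0..int t}"
  have "card (f ` B) \<le> card {0..<int n}"
    using assms by (intro card_mono) (auto simp: f_def)
  also have "\<dots> < card B"
    using t(2) by (simp add: B_def card_cartesian_product power3_eq_cube nat_add_distrib algebra_simps)
  finally have "\<not> inj_on f B" by (intro pigeonhole)
  then obtain x y where "x \<in> B" "y \<in> B" "x \<noteq> y" "f x = f y" unfolding inj_on_def by blast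
  moreover obtain u v w u' v' w' where "x = (u, v, w)" "y = (u', v', w')" by (metis prod_cases3)
  ultimately have *: "(u, v, w) \<in> B" "(u', v', w') \<in> B" "(u, v, w) \<noteq> (u', v', w')"
    "f (u, v, w) = f (u', v', w')" by simp_all
  have "int n dvd (u + v * a + w * a ^ 2) - (u' + v' * a + w' * a ^ 2)"
    using *(4) by (simp add: f_def mod_eq_dvd_iff)
  then have "int n dvd (u - u') + (v - v') * a + (w - w') * a ^ 2"
    by (simp add: algebra_simps)
  with * t(1) show ?thesis
    by (intro that[of "u - u'" "v - v'" "w - w'" t]) (auto simp: B_def)
qed

text \<open>To a root \<open>a\<close> modulo \<open>n\<close> one attaches a short \<open>\<beta>\<close> with \<open>n\<close> dividing \<open>\<beta>(a)\<close>; its norm is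
  \<open>n j\<close> with \<open>j\<close> bounded. Then \<open>\<beta>\<close> and \<open>j\<close> determine \<open>n\<close>, and the class of
  \<open>(\<theta> - a) \<beta>* / n\<close> modulo \<open>j\<close> determines \<open>a\<close>, because multiplying by \<open>\<beta>\<close> gives
  \<open>j (\<theta> - a)\<close>, and \<open>\<beta>\<close> vanishes at \<open>a\<close> modulo \<open>n\<close>.\<close>

lemma sum_card_cubic_roots_le:
  obtains K :: real where "K > 0" "\<And>x. real (\<Sum>n=1..x. card (cubic_roots n)) \<le> K * real x"
proof -
  define good where "good n a \<beta> \<longleftrightarrow> (case \<beta> of (u, v, w) \<Rightarrow> (u, v, w) \<noteq> (0, 0, 0) \<and>
      int n dvd u + v * int a + w * (int a) ^ 2 \<and>
      (\<exists>t. t ^ 3 \<le> n \<and> \<bar>u\<bar> \<le> int t \<and> \<bar>v\<bar> \<le> int t \<and> \<bar>w\<bar> \<le> int t))" for n a \<beta>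
  have "\<exists>\<beta>. good n a \<beta>" if n: "n > 0" for n a
  proof -
    obtain u v w t where "(u, v, w) \<noteq> (0, 0, 0)" "\<bar>u\<bar> \<le> int t" "\<bar>v\<bar> \<le> int t" "\<bar>w\<bar> \<le> int t"
      "t ^ 3 \<le> n" "int n dvd u + v * int a + w * (int a) ^ 2"
      by (rule small_multiple[OF n, of "int a"])
    then have "good n a (u, v, w)" unfolding good_def by auto
    then show ?thesis ..
  qed
  then obtain \<beta> where \<beta>: "\<And>n a. n > 0 \<Longrightarrow> good n a (\<beta> n a)" by metis
  \<comment> \<open>The last three entries are the coordinates of
    \<open>(\<theta> - a) \<beta>* / n\<close> reduced modulo j.\<close>
  define key where "key = (\<lambda>(n, a). case \<beta> n a of (u, v, w) \<Rightarrow>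
    (let j = cnorm u v w div int n in ((u, v, w), j,
       ((conj2 u v w - int a * conj0 u v w) div int n) mod j,
       ((conj0 u v w - 3 * conj2 u v w - int a * conj1 u v w) div int n) mod j,
       ((conj1 u v w - int a * conj2 u v w) div int n) mod j)))"
  define I where "I = {-27..27::int}"
  \<comment> \<open>The factor 27 comes from (2 T + 1)^3 \<le> (3 T)^3 choices of \<beta>, and 55 is
    the number of integers in -27..27, the range of j and of the three remainders.\<close>
  have "real (\<Sum>n=1..x. card (cubic_roots n)) \<le> 27 * 55 ^ 4 * real x" for x
  proof (cases "x = 0")
    case False
    define D where "D = (SIGMA n:{1..x}. cubic_roots n)"
    define T where "T = nth_root_nat 3 x"
    have T: "T ^ 3 \<le> x" "T > 0"
      using nth_root_nat_power_le[of 3 x] nth_root_nat_ge[of 3 1 x] False unfolding T_def by auto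
    define B where "B = {-int T..int T} \<times> {-int T..int T} \<times> {-int T..int T}"
    have "inj_on key D"
    proof (rule inj_onI)
      fix q q' assume q: "q \<in> D" "q' \<in> D" "key q = key q'"
      obtain n a n' a' where qe: "q = (n, a)" "q' = (n', a')" by (metis surj_pair)
      have D: "(n, a) \<in> D" "(n', a') \<in> D" and eq: "key (n, a) = key (n', a')"
        using q unfolding qe by auto
      obtain u v w where b: "\<beta> n a = (u, v, w)" by (cases "\<beta> n a") auto
      have b': "\<beta> n' a' = (u, v, w)" using eq b by (auto simp: key_def Let_def split: prod.splits)
      have pos: "n > 0" "n' > 0" using D by (auto simp: D_def)
      have dv: "int n dvd u + v * int a + w * (int a) ^ 2" "int n' dvd u + v * int a' + w * (int a') ^ 2"
        "(u, v, w) \<noteq> (0, 0, 0)"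
        using \<beta>[OF pos(1), of a] \<beta>[OF pos(2), of a'] b b' by (auto simp: good_def)
      have rt: "int n dvd cubic (int a)" "int n' dvd cubic (int a')" "a < n" "a' < n'"
        using D by (auto simp: D_def cubic_roots_def)
      define N where "N = cnorm u v w"
      have N0: "N \<noteq> 0" using dv(3) unfolding N_def cnorm_eq_0_iff by simp
      define j where "j = N div int n"
      have j: "N = int n * j" "j \<noteq> 0" using dvd_conj(4)[OF rt(1) dv(1)] N0 unfolding j_def N_def by auto
      have "N div int n' = j" using eq b b' by (auto simp: key_def Let_def j_def N_def)
      then have "N = int n' * j" using dvd_conj(4)[OF rt(2) dv(2)] unfolding N_def by auto
      with j have nn: "n' = n" by simp
      have diff: "N dvd X - Y"
        if XY: "int n dvd X" "int n dvd Y" "(X div int n) mod j = (Y div int n) mod j" for X Y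
      proof -
        obtain X' Y' where X': "X = int n * X'" "Y = int n * Y'" using XY(1,2) by (auto elim!: dvdE)
        then have "j dvd X' - Y'" using XY(3) pos by (simp add: mod_eq_dvd_iff)
        then show ?thesis unfolding X' j(1) by (simp flip: right_diff_distrib)
      qed
      define A0 A1 A2 where "A0 = conj0 u v w" and "A1 = conj1 u v w" and "A2 = conj2 u v w"
      note dc = dvd_conj[OF rt(1) dv(1), folded A0_def A1_def A2_def]
        dvd_conj[OF rt(2) dv(2), folded A0_def A1_def A2_def, unfolded nn]
      define d where "d = int a' - int a"
      have "((A2 - int a * A0) div int n) mod j = ((A2 - int a' * A0) div int n) mod j"
        "((A0 - 3 * A2 - int a * A1) div int n) mod j = ((A0 - 3 * A2 - int a' * A1) div int n) mod j"
        "((A1 - int a * A2) div int n) mod j = ((A1 - int a' * A2) div int n) mod j"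
        using eq b b' by (auto simp: key_def Let_def nn A0_def A1_def A2_def N_def j_def)
      then have "N dvd (A2 - int a * A0) - (A2 - int a' * A0)"
        "N dvd (A0 - 3 * A2 - int a * A1) - (A0 - 3 * A2 - int a' * A1)"
        "N dvd (A1 - int a * A2) - (A1 - int a' * A2)"
        using diff dc by blast+
      then have "N dvd d * A0" "N dvd d * A1" "N dvd d * A2"
        unfolding d_def by (simp_all add: algebra_simps)
      then obtain x0 x1 x2 where x: "d * A0 = N * x0" "d * A1 = N * x1" "d * A2 = N * x2"
        by (auto elim!: dvdE)
      note id = cnorm_conj[of u v w, folded A0_def A1_def A2_def N_def]
      \<comment> \<open>With x0, x1, x2 the coordinates of \<open>d \<beta>* / N\<close>,
        multiplication by \<beta> must give back the constant d, coordinate by coordinate.\<close>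
      have "N * d = N * (u * x0 + w * x1 + v * x2)"
        "N * (u * x1 + v * x0 - 3 * (v * x2 + w * x1) + w * x2) = 0"
        "N * (u * x2 + v * x1 + w * x0 - 3 * (w * x2)) = 0"
        using id x by (Groebner_Basis.algebra)+
      then have y: "d = u * x0 + w * x1 + v * x2"
        "u * x1 + v * x0 - 3 * (v * x2 + w * x1) + w * x2 = 0"
        "u * x2 + v * x1 + w * x0 - 3 * (w * x2) = 0"
        using N0 by simp_all
      define \<alpha> where "\<alpha> = int a"
      \<comment> \<open>The ring identity between \<beta>, its multiplier and d, lifted to
        polynomials at the price of a multiple of the cubic and evaluated at the integer a.\<close>
      have "d = (u + v * \<alpha> + w * \<alpha> ^ 2) * (x0 + x1 * \<alpha> + x2 * \<alpha> ^ 2)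
          - cubic \<alpha> * (v * x2 + w * x1 + w * x2 * \<alpha>)"
        unfolding cubic_def using y by Groebner_Basis.algebra
      then have "int n dvd d" using dv(1) rt(1) unfolding \<alpha>_def by (metis dvd_diff dvd_mult2)
      then have "a' = a" using rt nn unfolding d_def
        by (metis mod_eq_dvd_iff mod_less of_nat_eq_iff of_nat_mod)
      with nn show "q = q'" unfolding qe by simp
    qed
    moreover have "key ` D \<subseteq> B \<times> I \<times> I \<times> I \<times> I"
    proof (rule image_subsetI)
      fix q assume q: "q \<in> D"
      obtain n a where qe: "q = (n, a)" by (metis surj_pair)
      have D: "(n, a) \<in> D" using q unfolding qe .
      obtain u v w where b: "\<beta> n a = (u, v, w)" by (cases "\<beta> n a") auto
      have pos: "n > 0" "n \<le> x" using D by (auto simp: D_def)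
      have gd: "good n a (u, v, w)" using \<beta>[OF pos(1), of a] b by simp
      then obtain t where t: "t ^ 3 \<le> n" "\<bar>u\<bar> \<le> int t" "\<bar>v\<bar> \<le> int t" "\<bar>w\<bar> \<le> int t"
        by (auto simp: good_def)
      have "t ^ 3 \<le> x" using t(1) pos(2) by simp
      then have "t \<le> T" unfolding T_def by (metis nth_root_nat_mono nth_root_nat_nth_power zero_less_numeral)
      then have uB: "(u, v, w) \<in> B" using t unfolding B_def by auto
      define j where "j = cnorm u v w div int n"
      have "int n dvd cnorm u v w"
        using dvd_conj(4)[of "int n" "int a" u v w] D gd by (auto simp: good_def D_def cubic_roots_def)
      then have j: "cnorm u v w = int n * j" unfolding j_def by simp
      have "int n * \<bar>j\<bar> \<le> 27 * int t ^ 3"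
        using cnorm_bound[OF t(2-4)] unfolding j by (simp add: abs_mult)
      also have "\<dots> \<le> 27 * int n" using t(1) by (simp flip: of_nat_power)
      finally have j27: "\<bar>j\<bar> \<le> 27" using pos(1) by simp
      have "j \<noteq> 0" using j gd cnorm_eq_0_iff[of u v w] by (auto simp: good_def)
      \<comment> \<open>The remainder takes the sign of j, which may be negative; hence the
        symmetric interval.\<close>
      then have mI: "z mod j \<in> I" for z
        using j27 pos_mod_sign[of j z] pos_mod_bound[of j z] neg_mod_sign[of j z] neg_mod_bound[of j z]
        unfolding I_def atLeastAtMost_iff by linarith
      have "j \<in> I" using j27 by (auto simp: I_def)
      then show "key q \<in> B \<times> I \<times> I \<times> I \<times> I"
        unfolding qe using uB mI by (simp add: key_def b Let_def flip: j_def)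
    qed
    ultimately have "card D \<le> card (B \<times> I \<times> I \<times> I \<times> I)"
      by (rule card_inj_on_le) (auto simp: B_def I_def)
    also have "\<dots> = (2 * T + 1) ^ 3 * 55 ^ 4"
      by (simp add: card_cartesian_product B_def I_def power3_eq_cube nat_add_distrib nat_mult_distrib)
    also have "\<dots> \<le> (3 * T) ^ 3 * 55 ^ 4" using T(2) by (intro mult_right_mono power_mono) auto
    also have "\<dots> \<le> 27 * 55 ^ 4 * x" using T(1) by (simp add: power_mult_distrib)
    finally have "real (card D) \<le> real (27 * 55 ^ 4 * x)" by (simp only: of_nat_le_iff)
    moreover have "card D = (\<Sum>n=1..x. card (cubic_roots n))"
      unfolding D_def by (subst card_SigmaI) auto
    ultimately show ?thesis by (simp only: of_nat_mult) simp
  qed simp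
  then show ?thesis by (rule that[rotated]) simp
qed

section \<open>Comparing Euler products\<close>

text \<open>Partial summation as an induction: the numbers K - r n have nonnegative partial sums,
  and decreasing weights keep the weighted sum at least g x times the plain one.\<close>

lemma sum_antimono_weight_le:
  fixes r g :: "nat \<Rightarrow> real"
  assumes B: "\<And>k. (\<Sum>n=1..k. r n) \<le> K * real k"
    and g: "\<And>n. n \<ge> 1 \<Longrightarrow> g (Suc n) \<le> g n" "\<And>n. n \<ge> 1 \<Longrightarrow> g n \<ge> 0"
  shows "(\<Sum>n=1..x. r n * g n) \<le> K * (\<Sum>n=1..x. g n)"
proof -
  have S: "(\<Sum>n=1..k. K - r n) \<ge> 0" for k
    using B[of k] by (simp add: sum_subtractf mult.commute)
  have "(\<Sum>n=1..x. (K - r n) * g n) \<ge> g x * (\<Sum>n=1..x. K - r n)" if "x \<ge> 1"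
    using that
  proof (induction x rule: dec_induct)
    case (step x)
    have "g (Suc x) * (\<Sum>n=1..x. K - r n) \<le> g x * (\<Sum>n=1..x. K - r n)"
      using g(1)[OF step.hyps(1)] S by (rule mult_right_mono)
    with step show ?case by (simp add: algebra_simps)
  qed simp
  moreover have "g x * (\<Sum>n=1..x. K - r n) \<ge> 0" if "x \<ge> 1"
    using g(2)[OF that] S by simp
  ultimately have "(\<Sum>n=1..x. (K - r n) * g n) \<ge> 0" by (cases "x \<ge> 1") force+
  then show ?thesis by (simp add: algebra_simps sum_subtractf sum_distrib_left)
qed

text \<open>Chinese remaindering sends pairs of roots injectively to roots modulo the
  product.\<close>

lemma card_cubic_roots_mult:
  assumes "coprime a b" "a > 0" "b > 0"
  shows "card (cubic_roots a) * card (cubic_roots b) \<le> card (cubic_roots (a * b))"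
proof -
  have "\<exists>x. x < a * b \<and> [x = u] (mod a) \<and> [x = v] (mod b)" for u v
    using binary_chinese_remainder_unique_nat[of a b u v] assms by blast
  then obtain f where f: "\<And>u v. f u v < a * b \<and> [f u v = u] (mod a) \<and> [f u v = v] (mod b)"
    by metis
  have cubic_cong: "int n dvd cubic (int x) \<longleftrightarrow> int n dvd cubic (int y)" if "[x = y] (mod n)" for n x y
    using that cubic_mod[of n "int x"] cubic_mod[of n "int y"]
    by (simp add: Cong.cong_def flip: zmod_int)
  have "card (cubic_roots a \<times> cubic_roots b) \<le> card (cubic_roots (a * b))"
  proof (rule card_inj_on_le[where f = "\<lambda>(u, v). f u v"])
    show "inj_on (\<lambda>(u, v). f u v) (cubic_roots a \<times> cubic_roots b)"
    proof (rule inj_onI, clarify)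
      fix u v u' v' assume *: "u \<in> cubic_roots a" "v \<in> cubic_roots b"
        "u' \<in> cubic_roots a" "v' \<in> cubic_roots b" "f u v = f u' v'"
      have "[u = u'] (mod a)" "[v = v'] (mod b)"
        using f[of u v] f[of u' v'] *(5) by (metis cong_sym cong_trans)+
      with * show "u = u' \<and> v = v'" by (auto simp: cubic_roots_def Cong.cong_def)
    qed
    show "(\<lambda>(u, v). f u v) ` (cubic_roots a \<times> cubic_roots b) \<subseteq> cubic_roots (a * b)"
    proof clarify
      fix u v assume *: "u \<in> cubic_roots a" "v \<in> cubic_roots b"
      have "int a dvd cubic (int (f u v))" "int b dvd cubic (int (f u v))"
        using * f[of u v] by (auto simp: cubic_roots_def cubic_cong)
      moreover have "coprime (int a) (int b)" using assms(1) by simp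
      ultimately have "int a * int b dvd cubic (int (f u v))" by (intro divides_mult)
      then show "f u v \<in> cubic_roots (a * b)" using f[of u v] by (simp add: cubic_roots_def)
    qed
  qed simp
  then show ?thesis by (simp add: card_cartesian_product)
qed

lemma prod_card_cubic_roots_le:
  assumes "finite A" "\<And>p. p \<in> A \<Longrightarrow> prime p"
  shows "(\<Prod>p\<in>A. card (cubic_roots p)) \<le> card (cubic_roots (\<Prod>A))"
  using assms
proof (induction A rule: finite_induct)
  case empty
  have "cubic_roots 1 = {0}" by (auto simp: cubic_roots_def)
  then show ?case by simp
next
  case (insert p A)
  have "coprime p (\<Prod>A)"
    using insert by (intro prod_coprime_right) (metis insertCI primes_coprime)
  moreover have "p > 0" "\<Prod>A > 0"
    using insert.prems by (auto intro!: prime_gt_0_nat prod_pos)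
  ultimately have "card (cubic_roots p) * card (cubic_roots (\<Prod>A)) \<le> card (cubic_roots (p * \<Prod>A))"
    by (rule card_cubic_roots_mult)
  moreover have "(\<Prod>p\<in>A. card (cubic_roots p)) \<le> card (cubic_roots (\<Prod>A))"
    using insert by simp
  ultimately show ?case using insert.hyps
    by (simp) (meson le_trans mult_le_mono2)
qed

lemma prime_factors_prod_primes:
  assumes "finite A" "\<And>p. p \<in> A \<Longrightarrow> prime (p :: nat)"
  shows "prime_factors (\<Prod>A) = A"
proof -
  have "p dvd \<Prod>A \<longleftrightarrow> p \<in> A" if "prime p" for p
    using assms that by (metis dvd_prodI prime_dvd_prod_iff primes_dvd_imp_eq)
  moreover have "\<Prod>A \<noteq> 0" using assms by (metis not_prime_0 prod_zero_iff)
  ultimately show ?thesis using assms by (auto simp: prime_factors_dvd)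
qed

lemma inj_on_prod_primes:
  assumes "\<And>p. p \<in> S \<Longrightarrow> prime (p :: nat)" "finite S"
  shows "inj_on (\<lambda>A. \<Prod>A) (Pow S)"
  by (rule inj_on_inverseI[where g = prime_factors])
     (metis PowD assms finite_subset prime_factors_prod_primes subsetD)

text \<open>Writing n as a squarefree number times a square bounds the sum by the product of 1 +
  p^(-s) over the primes up to x, times the sum of m^(-2 s), which is at most 2. The bound is
  uniform down to s = 1.\<close>

lemma sum_powr_le_exp_primes:
  assumes "s \<ge> (1::real)"
  shows "(\<Sum>n=1..x. real n powr (-s)) \<le> 2 * exp (\<Sum>p | prime p \<and> p \<le> x. real p powr (-s))"
proof -
  define S where "S = {p. prime p \<and> p \<le> x}"
  have S: "finite S" "\<And>p. p \<in> S \<Longrightarrow> prime p" by (auto simp: S_def)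
  define w where "w = (\<lambda>(A, m). (\<Prod>p\<in>A. real p powr (-s)) * real m powr (-2 * s))"
  define h where "h = (\<lambda>n::nat. (prime_factors (squarefree_part n), square_part n))"
  have sf: "(\<Prod>(prime_factors (squarefree_part n))) = squarefree_part n" for n :: nat
  proof -
    have "squarefree_part n = (\<Prod>p\<in>prime_factors (squarefree_part n). p ^ multiplicity p (squarefree_part n))"
      by (simp add: prod_prime_factors)
    also have "\<dots> = (\<Prod>p\<in>prime_factors (squarefree_part n). p)"
      using squarefree_factorial_semiring'[of "squarefree_part n"] by (intro prod.cong) auto
    finally show ?thesis by simp
  qed
  have "(\<Sum>n=1..x. real n powr (-s)) = (\<Sum>n=1..x. w (h n))"
  proof (intro sum.cong refl)
    fix n assume n: "n \<in> {1..x}"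
    have "real n powr (-s) = real (squarefree_part n * square_part n ^ 2) powr (-s)"
      by (simp flip: squarefree_decompose)
    also have "\<dots> = real (\<Prod>(prime_factors (squarefree_part n))) powr (-s) * (real (square_part n) ^ 2) powr (-s)"
      unfolding sf by (simp add: powr_mult)
    also have "(real (square_part n) ^ 2) powr (-s) = real (square_part n) powr (-2 * s)"
    proof -
      have "real (square_part n) > 0" using n by (auto intro: Nat.gr0I)
      then have "real (square_part n) ^ 2 = real (square_part n) powr 2" by simp
      then show ?thesis by (simp only: powr_powr mult_minus_left mult_minus_right)
    qed
    also have "real (\<Prod>(prime_factors (squarefree_part n))) powr (-s)
        = (\<Prod>p\<in>prime_factors (squarefree_part n). real p powr (-s))"
      by (simp add: prod_powr_distrib)
    finally show "real n powr (-s) = w (h n)" by (simp add: w_def h_def)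
  qed
  also have "\<dots> = sum w (h ` {1..x})"
  proof (rule sum.reindex[symmetric, unfolded comp_def])
    show "inj_on h {1..x}"
      by (rule inj_onI) (metis h_def prod.inject sf squarefree_decompose)
  qed
  also have "\<dots> \<le> sum w (Pow S \<times> {1..x})"
  proof (rule sum_mono2)
    show "h ` {1..x} \<subseteq> Pow S \<times> {1..x}"
    proof (rule image_subsetI)
      fix n assume n: "n \<in> {1..x}"
      then have "squarefree_part n dvd n" "square_part n dvd n"
        by (metis dvd_triv_left squarefree_decompose)
           (metis dvd_mult_left dvd_triv_right power2_eq_square squarefree_decompose dvd_trans)
      then have "squarefree_part n \<le> n" "square_part n \<le> n" using n by (auto intro!: dvd_imp_le)
      moreover have "p \<le> squarefree_part n" if "p \<in> prime_factors (squarefree_part n)" for p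
        using that by (intro dvd_imp_le) (auto intro: Nat.gr0I)
      moreover have "square_part n > 0" using n by (auto intro: Nat.gr0I)
      ultimately show "h n \<in> Pow S \<times> {1..x}" using n unfolding h_def S_def by force
    qed
  qed (auto simp: w_def S intro!: mult_nonneg_nonneg prod_nonneg)
  also have "\<dots> = (\<Sum>A\<in>Pow S. \<Prod>p\<in>A. real p powr (-s)) * (\<Sum>m=1..x. real m powr (-2 * s))"
    unfolding w_def by (simp add: sum_product sum.cartesian_product)
  also have "(\<Sum>A\<in>Pow S. \<Prod>p\<in>A. real p powr (-s)) = (\<Prod>p\<in>S. real p powr (-s) + 1)"
    using prod_add[OF S(1), of "\<lambda>p. real p powr (-s)" "\<lambda>_. 1"] by simp
  also have "\<dots> * (\<Sum>m=1..x. real m powr (-2 * s)) \<le> exp (\<Sum>p\<in>S. real p powr (-s)) * 2"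
  proof (rule mult_mono)
    show "(\<Prod>p\<in>S. real p powr (-s) + 1) \<le> exp (\<Sum>p\<in>S. real p powr (-s))"
      unfolding exp_sum[OF S(1)] by (intro prod_mono) (auto simp: add.commute)
    \<comment> \<open>The sharper bound with 1/k makes the induction telescope.\<close>
    have "(\<Sum>m=1..k. real m powr (-2 * s)) \<le> 2 - 1 / real k" if "k \<ge> 1" for k
      using that
    proof (induction k rule: dec_induct)
      case (step k)
      have "real (Suc k) powr (-2 * s) \<le> real (Suc k) powr (-2)"
        using assms by (intro powr_mono) auto
      also have "\<dots> = 1 / real (Suc k) ^ 2"
        by (simp add: powr_minus_divide powr_numeral del: of_nat_Suc)
      also have "\<dots> \<le> 1 / (real k * real (Suc k))"
        using step.hyps unfolding power2_eq_square
        by (intro divide_left_mono mult_right_mono) (auto intro!: mult_pos_pos)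
      also have "\<dots> = 1 / real k - 1 / real (Suc k)"
        using step.hyps by (simp add: field_simps)
      finally show ?case using step.IH by simp
    qed simp
    from this[of x] show "(\<Sum>m=1..x. real m powr (-2 * s)) \<le> 2"
      by (cases "x \<ge> 1") (force intro: order_trans)+
  qed (auto intro!: sum_nonneg)
  finally show ?thesis by (simp add: S_def mult.commute)
qed

text \<open>Partial summation turns the linear bound on the root counts into a bound of their Dirichlet series
  by a multiple of the zeta function, uniformly in \<open>s \<ge> 1\<close>; the inequality compares the logarithms of
  the two Euler products.\<close>

lemma prime_sum_cubic_roots_le:
  obtains C :: real where "\<And>s S \<rho>. s \<ge> 1 \<Longrightarrow> finite S \<Longrightarrow> (\<And>p. p \<in> S \<Longrightarrow> prime p) \<Longrightarrow>
    (\<And>p. p \<in> S \<Longrightarrow> \<rho> p \<le> 3 \<and> \<rho> p \<le> card (cubic_roots p)) \<Longrightarrow>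
    (\<Sum>p\<in>S. real (\<rho> p) * real p powr (-s)) \<le> C + (\<Sum>p | prime p \<and> p \<le> \<Prod>S. real p powr (-s))"
proof -
  obtain K where K: "K > 0" "\<And>x. real (\<Sum>n=1..x. card (cubic_roots n)) \<le> K * real x"
    using sum_card_cubic_roots_le by blast
  define c where "c = (\<Sum>n. real n powr (-2))"
  have sm: "summable (\<lambda>n. real n powr (-2))" by (simp add: summable_real_powr_iff)
  show ?thesis
  \<comment> \<open>K comes from the linear count of roots, 2 from
    \<open>sum_powr_le_exp_primes\<close>; 9 c pays for the quadratic terms, each at most 9 p^(-2)
    because \<open>\<rho> p \<le> 3\<close>.\<close>
  proof (rule that[of "ln (2 * K) + 9 * c"])
    fix s :: real and S :: "nat set" and \<rho> :: "nat \<Rightarrow> nat"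
    assume s: "s \<ge> 1" and S: "finite S" "\<And>p. p \<in> S \<Longrightarrow> prime p"
      and \<rho>: "\<And>p. p \<in> S \<Longrightarrow> \<rho> p \<le> 3 \<and> \<rho> p \<le> card (cubic_roots p)"
    define g where "g n = real n powr (-s)" for n :: nat
    define x where "x = \<Prod>S"
    have "exp (\<Sum>p\<in>S. real (\<rho> p) * g p - (real (\<rho> p) * g p) ^ 2)
        \<le> (\<Prod>p\<in>S. real (\<rho> p) * g p + 1)"
      unfolding exp_sum[OF S(1)]
    proof (intro prod_mono conjI)
      fix p
      define t where "t = real (\<rho> p) * g p"
      have t: "t \<ge> 0" by (simp add: t_def g_def)
      \<comment> \<open>Beyond t = 1 the left side is not positive, so the bound holds for all
        nonnegative t, as small primes require.\<close>
      have "t - t ^ 2 \<le> ln (1 + t)"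
      proof (cases "t \<le> 1")
        case False
        then have "t - t ^ 2 \<le> 0" "ln (1 + t) \<ge> 0" by (simp_all add: power2_eq_square)
        then show ?thesis by simp
      qed (use ln_one_plus_pos_lower_bound t in auto)
      then show "exp (real (\<rho> p) * g p - (real (\<rho> p) * g p) ^ 2) \<le> real (\<rho> p) * g p + 1"
        using t unfolding t_def[symmetric] by (simp add: ln_ge_iff add.commute)
    qed simp
    also have "\<dots> = (\<Sum>A\<in>Pow S. \<Prod>p\<in>A. real (\<rho> p) * g p)"
      using prod_add[OF S(1), of "\<lambda>p. real (\<rho> p) * g p" "\<lambda>_. 1"] by simp
    also have "\<dots> \<le> (\<Sum>A\<in>Pow S. real (card (cubic_roots (\<Prod>A))) * g (\<Prod>A))"
    proof (rule sum_mono)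
      fix A assume A: "A \<in> Pow S"
      then have A': "finite A" "\<And>p. p \<in> A \<Longrightarrow> prime p" using S finite_subset by auto
      have "(\<Prod>p\<in>A. \<rho> p) \<le> (\<Prod>p\<in>A. card (cubic_roots p))" using A \<rho> by (intro prod_mono) auto
      also have "\<dots> \<le> card (cubic_roots (\<Prod>A))" by (rule prod_card_cubic_roots_le[OF A'])
      finally have "real (\<Prod>p\<in>A. \<rho> p) \<le> real (card (cubic_roots (\<Prod>A)))" by (rule of_nat_mono)
      moreover have "(\<Prod>p\<in>A. g p) = g (\<Prod>A)" by (simp add: g_def prod_powr_distrib)
      ultimately show "(\<Prod>p\<in>A. real (\<rho> p) * g p) \<le> real (card (cubic_roots (\<Prod>A))) * g (\<Prod>A)"
        by (simp add: prod.distrib mult_right_mono g_def)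
    qed
    also have "\<dots> = (\<Sum>n\<in>(\<lambda>A. \<Prod>A) ` Pow S. real (card (cubic_roots n)) * g n)"
      by (rule sum.reindex[OF inj_on_prod_primes[OF S(2,1)], symmetric, unfolded comp_def]) auto
    also have "\<dots> \<le> (\<Sum>n=1..x. real (card (cubic_roots n)) * g n)"
    proof (rule sum_mono2)
      show "(\<lambda>A. \<Prod>A) ` Pow S \<subseteq> {1..x}"
      proof (rule image_subsetI)
        fix A assume A: "A \<in> Pow S"
        then have "\<Prod>A dvd \<Prod>S" using S(1) by (intro prod_dvd_prod_subset) auto
        moreover have "\<Prod>S > 0" by (intro prod_pos) (simp add: S(2) prime_gt_0_nat)
        ultimately show "\<Prod>A \<in> {1..x}" unfolding x_def
          by (auto intro!: dvd_imp_le simp: Suc_le_eq dvd_pos_nat)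
      qed
    qed (auto simp: g_def)
    also have "\<dots> \<le> K * (\<Sum>n=1..x. g n)"
      using K s by (intro sum_antimono_weight_le) (auto simp: g_def intro!: powr_mono2')
    also have "\<dots> \<le> K * (2 * exp (\<Sum>p | prime p \<and> p \<le> x. g p))"
      unfolding g_def using K(1) s by (intro mult_left_mono sum_powr_le_exp_primes) auto
    also have "\<dots> = exp (ln (2 * K) + (\<Sum>p | prime p \<and> p \<le> x. g p))"
      using K(1) by (simp add: exp_add)
    finally have "(\<Sum>p\<in>S. real (\<rho> p) * g p) - (\<Sum>p\<in>S. (real (\<rho> p) * g p) ^ 2)
        \<le> ln (2 * K) + (\<Sum>p | prime p \<and> p \<le> x. g p)"
      by (simp add: sum_subtractf)
    moreover have "(\<Sum>p\<in>S. (real (\<rho> p) * g p) ^ 2) \<le> (\<Sum>p\<in>S. 9 * real p powr (-2))"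
    proof (rule sum_mono)
      fix p assume p: "p \<in> S"
      have "g p \<le> real p powr (-1)"
        unfolding g_def using s S(2)[OF p] prime_ge_1_nat by (intro powr_mono) auto
      moreover have "real (\<rho> p) \<le> 3" using \<rho>[OF p] by simp
      ultimately have "(real (\<rho> p) * g p) ^ 2 \<le> (3 * real p powr (-1)) ^ 2"
        by (intro power_mono mult_mono) (auto simp: g_def)
      also have "\<dots> = 9 * real p powr (-2)"
      proof -
        have "real p powr (-1) * real p powr (-1) = real p powr (-2)"
          by (subst powr_add[symmetric]) simp
        then show ?thesis by (simp only: power2_eq_square mult_ac)
      qed
      finally show "(real (\<rho> p) * g p) ^ 2 \<le> 9 * real p powr (-2)" .
    qed
    moreover have "(\<Sum>p\<in>S. real p powr (-2)) \<le> c"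
      unfolding c_def using S(1) sm by (intro sum_le_suminf) auto
    ultimately show "(\<Sum>p\<in>S. real (\<rho> p) * real p powr (-s))
        \<le> ln (2 * K) + 9 * c + (\<Sum>p | prime p \<and> p \<le> \<Prod>S. real p powr (-s))"
      unfolding g_def x_def by (simp flip: sum_distrib_left)
  qed
qed

text \<open>Let T be the exceptional set and U the primes 1 modulo 60 outside T. The comparison of
  Euler products bounds the sum of (\<rho> p - 1) p^(-s), that is, twice the sum over U minus the
  sum over T. If T were summable, so would be U, and then all primes 1 modulo 60.\<close>

lemma not_summable_three_dvd_index:
  assumes "\<not> (\<lambda>p. 1 / real p) summable_on {p. prime p \<and> p mod 60 = 1}"
  shows "\<not> (\<lambda>p. 1 / real p) summable_on {p. prime p \<and> (\<forall>m. p dvd fib m \<longrightarrow> 3 dvd m)}"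
proof
  define T where "T = {p. prime p \<and> (\<forall>m. p dvd fib m \<longrightarrow> 3 dvd m)}"
  define U where "U = {p. prime p \<and> p mod 60 = 1} - T"
  assume "(\<lambda>p. 1 / real p) summable_on {p. prime p \<and> (\<forall>m. p dvd fib m \<longrightarrow> 3 dvd m)}"
  then have sT: "(\<lambda>p. 1 / real p) summable_on T" unfolding T_def .
  define \<rho> :: "nat \<Rightarrow> nat" where "\<rho> p = (if p \<in> T then 0 else if p \<in> U then 3 else 1)" for p
  have \<rho>: "\<rho> p \<le> 3 \<and> \<rho> p \<le> card (cubic_roots p)" if p: "prime p" for p
  proof -
    have "3 \<le> card (cubic_roots p)" if "p \<in> U"
    proof -
      have "\<exists>m. p dvd fib m \<and> \<not> 3 dvd m" using that p unfolding U_def T_def by auto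
      moreover have "\<exists>w. int p dvd w ^ 2 + 15"
        using minus_15_square[OF p] that unfolding U_def by blast
      moreover have "p > 5"
      proof (rule ccontr)
        assume "\<not> p > 5"
        then have "p mod 60 = p" by simp
        with that p show False by (auto simp: U_def)
      qed
      ultimately show ?thesis using card_cubic_roots_ge_3 p by blast
    qed
    moreover have "1 \<le> card (cubic_roots p)" if "p \<notin> T"
      using card_cubic_roots_ge_1[of p] prime_gt_0_nat p that unfolding T_def by blast
    ultimately show ?thesis by (auto simp: \<rho>_def)
  qed
  obtain C where C: "\<And>s S \<rho>. s \<ge> 1 \<Longrightarrow> finite S \<Longrightarrow> (\<And>p. p \<in> S \<Longrightarrow> prime p) \<Longrightarrow>
    (\<And>p. p \<in> S \<Longrightarrow> \<rho> p \<le> 3 \<and> \<rho> p \<le> card (cubic_roots p)) \<Longrightarrow>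
    (\<Sum>p\<in>S. real (\<rho> p) * real p powr (-s)) \<le> C + (\<Sum>p | prime p \<and> p \<le> \<Prod>S. real p powr (-s))"
    using prime_sum_cubic_roots_le by blast
  define D where "D = C + 1 + infsum (\<lambda>p. 1 / real p) T"
  have bound: "2 * (\<Sum>p\<in>F. real p powr (-s)) \<le> D" if F: "finite F" "F \<subseteq> U" and s: "s > 1" for F s
  proof -
    define g where "g n = real n powr (-s)" for n :: nat
    define h where "h n = (if prime n then g n else 0)" for n
    have "summable g" using s unfolding g_def by (simp add: summable_real_powr_iff)
    then have sh: "summable h" by (rule summable_comparison_test_ev[rotated]) (auto simp: h_def g_def)
    have "(\<lambda>N. \<Sum>n<N. h n) \<longlonglongrightarrow> suminf h" by (rule summable_LIMSEQ[OF sh])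
    then have "eventually (\<lambda>N. (\<Sum>n<N. h n) > suminf h - 1) sequentially"
      by (rule order_tendstoD) simp
    then obtain N where N: "(\<Sum>n<N. h n) > suminf h - 1" by (auto simp: eventually_sequentially)
    \<comment> \<open>The right side of the comparison runs over all primes up to the product of S,
      far beyond S itself. Because s > 1, N could be chosen so that the primes from N on contribute
      less than 1.\<close>
    define S where "S = {p. prime p \<and> p < N} \<union> F"
    have S: "finite S" "\<And>p. p \<in> S \<Longrightarrow> prime p" using F by (auto simp: S_def U_def)
    have hp: "h n \<ge> 0" for n by (simp add: h_def g_def)
    have "(\<Sum>p\<in>S. real (\<rho> p) * g p) \<le> C + (\<Sum>p | prime p \<and> p \<le> \<Prod>S. g p)"
      unfolding g_def using s S \<rho> by (intro C) auto
    also have "(\<Sum>p | prime p \<and> p \<le> \<Prod>S. g p) = (\<Sum>p | prime p \<and> p \<le> \<Prod>S. h p)"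
      by (intro sum.cong) (auto simp: h_def)
    also have "\<dots> \<le> suminf h" using hp sh by (intro sum_le_suminf) auto
    also have "\<dots> \<le> (\<Sum>n<N. h n) + 1" using N by simp
    also have "(\<Sum>n<N. h n) = (\<Sum>p | prime p \<and> p < N. g p)"
      by (intro sum.mono_neutral_cong_right) (auto simp: h_def)
    also have "\<dots> \<le> (\<Sum>p\<in>S. g p)" by (rule sum_mono2[OF S(1)]) (auto simp: S_def g_def)
    finally have 1: "(\<Sum>p\<in>S. (real (\<rho> p) - 1) * g p) \<le> C + 1"
      by (simp add: left_diff_distrib sum_subtractf)
    have "2 * (\<Sum>p\<in>F. g p) - (\<Sum>p\<in>S \<inter> T. g p)
        = (\<Sum>p\<in>S. (if p \<in> F then 2 * g p else 0) - (if p \<in> T then g p else 0))"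
    proof -
      have "S \<inter> F = F" by (auto simp: S_def)
      then have "2 * (\<Sum>p\<in>F. g p) = (\<Sum>p\<in>S. if p \<in> F then 2 * g p else 0)"
        using sum.inter_restrict[OF S(1), of "\<lambda>p. 2 * g p" F] by (simp add: sum_distrib_left)
      then show ?thesis using sum.inter_restrict[OF S(1), of g T] by (simp add: sum_subtractf)
    qed
    \<comment> \<open>\<open>\<rho> p - 1\<close> is -1 on T, 2 on U and 0 elsewhere.\<close>
    also have "\<dots> \<le> (\<Sum>p\<in>S. (real (\<rho> p) - 1) * g p)"
      using F(2) by (intro sum_mono) (auto simp: \<rho>_def U_def g_def)
    finally have 2: "2 * (\<Sum>p\<in>F. g p) - (\<Sum>p\<in>S \<inter> T. g p) \<le> C + 1" using 1 by simp
    have "(\<Sum>p\<in>S \<inter> T. g p) \<le> (\<Sum>p\<in>S \<inter> T. 1 / real p)"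
    proof (rule sum_mono)
      fix p assume "p \<in> S \<inter> T"
      then have "p \<ge> 1" using S(2) prime_ge_1_nat by blast
      then have "g p \<le> real p powr (-1)" unfolding g_def using s by (intro powr_mono) auto
      then show "g p \<le> 1 / real p" by (simp add: powr_minus_divide)
    qed
    also have "\<dots> \<le> infsum (\<lambda>p. 1 / real p) T" using sT S(1) by (intro finite_sum_le_infsum) auto
    finally show ?thesis using 2 unfolding D_def g_def by simp
  qed
  have bound1: "(\<Sum>p\<in>F. 1 / real p) \<le> D / 2" if F: "finite F" "F \<subseteq> U" for F
  proof -
    \<comment> \<open>D is independent of s and F, so s may tend to 1 for a fixed finite F.\<close>
    have "((\<lambda>s. 2 * (\<Sum>p\<in>F. real p powr (-s))) \<longlongrightarrow> 2 * (\<Sum>p\<in>F. real p powr (-1))) (at_right 1)"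
      using F by (intro tendsto_intros) (auto simp: U_def)
    moreover have "eventually (\<lambda>s. 2 * (\<Sum>p\<in>F. real p powr (-s)) \<le> D) (at_right (1::real))"
      using bound[OF F] by (auto simp: eventually_at_right_less eventually_at_filter)
    ultimately have "2 * (\<Sum>p\<in>F. real p powr (-1)) \<le> D"
      by (intro tendsto_upperbound) auto
    then show ?thesis by (simp add: powr_minus_divide)
  qed
  have "(\<lambda>p. 1 / real p) summable_on U"
    using bound1 by (intro nonneg_bdd_above_summable_on) (auto intro!: bdd_aboveI2[where M = "D / 2"])
  then have "(\<lambda>p. 1 / real p) summable_on (U \<union> T)"
    using sT by (intro summable_on_union)
  then have "(\<lambda>p. 1 / real p) summable_on {p. prime p \<and> p mod 60 = 1}"
    by (rule summable_on_subset_banach) (auto simp: U_def)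
  with assms show False by simp
qed

section \<open>Dirichlet characters\<close>

text \<open>Characters are periodic functions on all naturals, zero off the units, so that each
  character is exactly one function and the set is finite.\<close>

definition dchars :: "nat \<Rightarrow> (nat \<Rightarrow> complex) set" where
  "dchars m = {\<xi>. \<xi> 1 = 1 \<and> (\<forall>a b. \<xi> (a * b) = \<xi> a * \<xi> b) \<and> (\<forall>a. \<xi> (a mod m) = \<xi> a)
     \<and> (\<forall>a. \<not> coprime a m \<longrightarrow> \<xi> a = 0)}"

definition principal :: "nat \<Rightarrow> nat \<Rightarrow> complex" where
  "principal m a = (if coprime a m then 1 else 0)"

text \<open>A character of a subgroup of the units modulo m; the subgroup is represented by H, a
  union of residue classes.\<close>

definition partial_char :: "nat \<Rightarrow> nat set \<Rightarrow> (nat \<Rightarrow> complex) \<Rightarrow> bool" where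
  "partial_char m H \<xi> \<longleftrightarrow> (\<forall>a\<in>H. coprime a m) \<and> 1 \<in> H \<and> (\<forall>a\<in>H. \<forall>b\<in>H. a * b \<in> H) \<and>
     (\<forall>a\<in>H. \<forall>b. [a = b] (mod m) \<longrightarrow> b \<in> H \<and> \<xi> a = \<xi> b) \<and>
     \<xi> 1 = 1 \<and> (\<forall>a\<in>H. \<forall>b\<in>H. \<xi> (a * b) = \<xi> a * \<xi> b)"

section \<open>Extension of characters from subgroups of the unit group\<close>

context
  fixes m :: nat and H :: "nat set" and \<xi> :: "nat \<Rightarrow> complex"
  assumes pc: "partial_char m H \<xi>" and m: "m > 1"
begin

lemma
  shows pc_coprime: "a \<in> H \<Longrightarrow> coprime a m" and pc_1: "1 \<in> H" "\<xi> 1 = 1"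
    and pc_mult: "a \<in> H \<Longrightarrow> b \<in> H \<Longrightarrow> a * b \<in> H"
    and pc_char_mult: "a \<in> H \<Longrightarrow> b \<in> H \<Longrightarrow> \<xi> (a * b) = \<xi> a * \<xi> b"
    and pc_cong: "a \<in> H \<Longrightarrow> [a = b] (mod m) \<Longrightarrow> b \<in> H"
    and pc_char_cong: "a \<in> H \<Longrightarrow> [a = b] (mod m) \<Longrightarrow> \<xi> a = \<xi> b"
  using pc unfolding partial_char_def by blast+

lemma pc_power: "a \<in> H \<Longrightarrow> a ^ n \<in> H \<and> \<xi> (a ^ n) = \<xi> a ^ n"
  using pc_1 pc_mult pc_char_mult by (induction n) auto

lemma pc_nonzero: "a \<in> H \<Longrightarrow> \<xi> a \<noteq> 0"
proof -
  assume a: "a \<in> H"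
  have "[a ^ totient m = 1] (mod m)" using pc_coprime[OF a] by (rule euler_theorem)
  then have "\<xi> (a ^ totient m) = 1" using pc_char_cong pc_power[OF a] pc_1 by metis
  then have "\<xi> a ^ totient m = 1" using pc_power[OF a] by metis
  then show "\<xi> a \<noteq> 0" using m by (auto simp: power_0_left)
qed

lemma pc_cancel:
  assumes "a \<in> H" "a * b \<in> H"
  shows "b \<in> H"
proof -
  have "a ^ (totient m - 1) * (a * b) = a ^ totient m * b"
    using m by (cases "totient m") (auto simp: mult_ac)
  moreover have "[a ^ totient m * b = 1 * b] (mod m)"
    using pc_coprime[OF assms(1)] by (intro cong_mult cong_refl euler_theorem)
  ultimately show ?thesis
    using pc_cong pc_mult[OF conjunct1[OF pc_power[OF assms(1)]] assms(2)] by (metis mult_1)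
qed

context
  fixes g k :: nat and c :: complex
  assumes g: "coprime g m" and k: "k > 0" "g ^ k \<in> H" "\<And>j. 0 < j \<Longrightarrow> j < k \<Longrightarrow> g ^ j \<notin> H"
    and c: "c ^ k = \<xi> (g ^ k)"
begin

text \<open>Cancelling g^i puts g^d into H, so d is a multiple of the least exponent k, and c^k =
  \<xi>(g^k) makes both values agree.\<close>

lemma pc_ext_well_defined_aux:
  assumes "h \<in> H" "h' \<in> H" "[h * g ^ i = h' * g ^ (i + d)] (mod m)"
  shows "\<xi> h * c ^ i = \<xi> h' * c ^ (i + d)"
proof -
  have "[g ^ i * h = g ^ i * (h' * g ^ d)] (mod m)"
    using assms(3) by (simp add: power_add mult_ac)
  moreover have "coprime (g ^ i) m" using g by simp
  ultimately have hh: "[h = h' * g ^ d] (mod m)" by (simp add: cong_mult_lcancel_nat)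
  then have "h' * g ^ d \<in> H" using pc_cong assms(1) by blast
  then have gd: "g ^ d \<in> H" using pc_cancel assms(2) by blast
  define q r where "q = d div k" and "r = d mod k"
  have d: "d = k * q + r" by (simp add: q_def r_def)
  have gq: "g ^ (k * q) \<in> H" "\<xi> (g ^ (k * q)) = c ^ (k * q)"
    using pc_power[OF k(2), of q] by (simp_all add: power_mult c)
  have "g ^ r \<in> H" using pc_cancel[OF gq(1)] gd by (simp add: d power_add)
  moreover have "r < k" using k(1) by (simp add: r_def)
  ultimately have "r = 0" using k(3) by blast
  then have "\<xi> (h' * g ^ d) = \<xi> h' * c ^ d"
    using pc_char_mult[OF assms(2) gq(1)] gq(2) d by simp
  moreover have "\<xi> h = \<xi> (h' * g ^ d)" using pc_char_cong assms(1) hh by blast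
  ultimately show ?thesis by (simp add: power_add)
qed

lemma pc_ext_well_defined:
  assumes "h \<in> H" "h' \<in> H" "[h * g ^ i = h' * g ^ j] (mod m)"
  shows "\<xi> h * c ^ i = \<xi> h' * c ^ j"
proof (cases "i \<le> j")
  case True
  then show ?thesis using pc_ext_well_defined_aux[of h h' i "j - i"] assms by simp
next
  case False
  then show ?thesis
    using pc_ext_well_defined_aux[of h' h j "i - j"] assms by (simp add: cong_sym)
qed

text \<open>On the subgroup generated by H and g the value at h g^i is \<xi>(h) c^i. Any k-th root c
  of \<xi>(g^k) is admissible; this freedom is what yields characters with a value other than
  1.\<close>

lemma partial_char_extend:
  obtains H' \<xi>' where "partial_char m H' \<xi>'" "H \<subseteq> H'" "g \<in> H'" "\<And>h. h \<in> H \<Longrightarrow> \<xi>' h = \<xi> h" "\<xi>' g = c"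
proof -
  define H' where "H' = {n. \<exists>h\<in>H. \<exists>i. [n = h * g ^ i] (mod m)}"
  define P where "P n v \<longleftrightarrow> (\<exists>h\<in>H. \<exists>i. [n = h * g ^ i] (mod m) \<and> v = \<xi> h * c ^ i)" for n v
  define \<xi>' where "\<xi>' n = (SOME v. P n v)" for n
  have val: "\<xi>' n = \<xi> h * c ^ i" if "h \<in> H" "[n = h * g ^ i] (mod m)" for n h i
  proof -
    have "P n (\<xi> h * c ^ i)" using that unfolding P_def by blast
    then have "P n (\<xi>' n)" unfolding \<xi>'_def by (rule someI)
    then obtain h' i' where h': "h' \<in> H" "[n = h' * g ^ i'] (mod m)" "\<xi>' n = \<xi> h' * c ^ i'"
      unfolding P_def by blast
    have "[h' * g ^ i' = h * g ^ i] (mod m)"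
      using h'(2) that(2) by (meson cong_sym cong_trans)
    then show ?thesis using pc_ext_well_defined[OF h'(1) that(1)] h'(3) by simp
  qed
  have prod: "a * b \<in> H' \<and> \<xi>' (a * b) = \<xi>' a * \<xi>' b" if ab: "a \<in> H'" "b \<in> H'" for a b
  proof -
    obtain h i h' j where *: "h \<in> H" "[a = h * g ^ i] (mod m)" "h' \<in> H" "[b = h' * g ^ j] (mod m)"
      using ab unfolding H'_def by blast
    have "[a * b = (h * g ^ i) * (h' * g ^ j)] (mod m)" using * by (intro cong_mult)
    then have **: "[a * b = (h * h') * g ^ (i + j)] (mod m)" by (simp add: power_add mult_ac)
    have hh: "h * h' \<in> H" using * pc_mult by blast
    with ** have "a * b \<in> H'" unfolding H'_def by blast
    moreover have "\<xi>' (a * b) = \<xi>' a * \<xi>' b"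
      using val[OF hh **] val[OF *(1,2)] val[OF *(3,4)] pc_char_mult[OF *(1,3)]
      by (simp add: power_add)
    ultimately show ?thesis ..
  qed
  have H: "h \<in> H' \<and> \<xi>' h = \<xi> h" if "h \<in> H" for h
    using that val[of h h 0] unfolding H'_def by (auto intro!: bexI[of _ h] exI[of _ 0])
  have gH: "g \<in> H' \<and> \<xi>' g = c"
    using pc_1 val[of 1 g 1] unfolding H'_def by (auto intro!: bexI[of _ 1] exI[of _ 1])
  show ?thesis
  proof (rule that)
    show "partial_char m H' \<xi>'" unfolding partial_char_def
    proof (intro conjI ballI allI impI)
      show "coprime a m" if a: "a \<in> H'" for a
      proof -
        obtain h i where h: "h \<in> H" "[a = h * g ^ i] (mod m)" using a unfolding H'_def by blast
        have "coprime (h * g ^ i) m" using pc_coprime[OF h(1)] g by simp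
        then show ?thesis using h(2) cong_imp_coprime cong_sym by blast
      qed
      show "b \<in> H'" "\<xi>' a = \<xi>' b" if a: "a \<in> H'" "[a = b] (mod m)" for a b
      proof -
        obtain h i where h: "h \<in> H" "[a = h * g ^ i] (mod m)" using a unfolding H'_def by blast
        moreover have "[b = h * g ^ i] (mod m)" using h(2) a(2) by (meson cong_sym cong_trans)
        ultimately show "b \<in> H'" "\<xi>' a = \<xi>' b" using val unfolding H'_def by auto
      qed
    qed (use prod H pc_1 in auto)
  qed (use H gH in auto)
qed

end

end

lemma partial_char_extend_full:
  assumes "m > 1" "partial_char m H \<xi>"
  obtains \<psi> where "\<psi> \<in> dchars m" "\<And>h. h \<in> H \<Longrightarrow> \<psi> h = \<xi> h"
proof -
  have "\<exists>\<psi>\<in>dchars m. \<forall>h\<in>H. \<psi> h = \<xi> h"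
    using assms(2)
  proof (induction "card ({g. g < m \<and> coprime g m} - H)" arbitrary: H \<xi> rule: less_induct)
    case less
    note pc = less.prems
    show ?case
    proof (cases "{g. g < m \<and> coprime g m} \<subseteq> H")
      case True
      have H: "a \<in> H" if "coprime a m" for a
      proof -
        have "a mod m \<in> H" using True that assms(1) by auto
        then show ?thesis using pc_cong[OF pc assms(1)] by (metis cong_mod_left cong_refl)
      qed
      define \<psi> where "\<psi> a = (if coprime a m then \<xi> a else 0)" for a
      have "\<psi> (a mod m) = \<psi> a" for a
      proof (cases "coprime a m")
        case True
        then show ?thesis
          using pc_char_cong[OF pc assms(1) H, of a "a mod m"] assms(1)
          by (simp add: \<psi>_def Cong.cong_def)
      qed (use assms(1) in \<open>simp add: \<psi>_def\<close>)
      then have "\<psi> \<in> dchars m"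
        using pc_1[OF pc assms(1)] pc_char_mult[OF pc assms(1)] H
        unfolding dchars_def by (auto simp: \<psi>_def)
      moreover have "\<forall>h\<in>H. \<psi> h = \<xi> h" using pc_coprime[OF pc assms(1)] by (simp add: \<psi>_def)
      ultimately show ?thesis by blast
    next
      case False
      then obtain g where g: "g < m" "coprime g m" "g \<notin> H" by blast
      have "g ^ totient m \<in> H"
        using euler_theorem[OF g(2)] pc_1[OF pc assms(1)] pc_cong[OF pc assms(1)] cong_sym by blast
      then have ex: "\<exists>k. 0 < k \<and> g ^ k \<in> H" using assms(1) by (metis totient_gt_0_iff gr_implies_not0 not_gr0)
      define k where "k = (LEAST k. 0 < k \<and> g ^ k \<in> H)"
      have k: "0 < k" "g ^ k \<in> H" using LeastI_ex[OF ex] unfolding k_def by auto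
      have kl: "g ^ j \<notin> H" if "0 < j" "j < k" for j
        using not_less_Least[of j "\<lambda>k. 0 < k \<and> g ^ k \<in> H"] that unfolding k_def by blast
      \<comment> \<open>A k-th root by way of the complex logarithm, available because characters do
        not vanish on H.\<close>
      define c where "c = exp (Ln (\<xi> (g ^ k)) / of_nat k)"
      have "c ^ k = exp (of_nat k * (Ln (\<xi> (g ^ k)) / of_nat k))"
        unfolding c_def by (rule exp_of_nat_mult[symmetric])
      also have "\<dots> = \<xi> (g ^ k)" using k pc_nonzero[OF pc assms(1) k(2)] by simp
      finally have c: "c ^ k = \<xi> (g ^ k)" .
      obtain H' \<xi>' where ext: "partial_char m H' \<xi>'" "H \<subseteq> H'" "g \<in> H'" "\<And>h. h \<in> H \<Longrightarrow> \<xi>' h = \<xi> h"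
        using partial_char_extend[OF pc assms(1) g(2) k kl c] by blast
      have "card ({g. g < m \<and> coprime g m} - H') < card ({g. g < m \<and> coprime g m} - H)"
        using ext g by (intro psubset_card_mono) auto
      from less.hyps[OF this ext(1)] show ?thesis using ext by (metis subsetD)
    qed
  qed
  then show ?thesis using that by blast
qed

text \<open>The trivial character on the class of 1 is extended to n; the order k of n exceeds 1, so
  a k-th root of unity other than 1 can be prescribed as the value.\<close>

lemma dchars_separate:
  assumes "m > 1" "coprime n m" "\<not> [n = 1] (mod m)"
  obtains \<xi> where "\<xi> \<in> dchars m" "\<xi> n \<noteq> 1"
proof -
  define H where "H = {a. [a = 1] (mod m)}"
  have "[a * b = 1] (mod m)" if "[a = 1] (mod m)" "[b = 1] (mod m)" for a b
    using cong_mult[OF that] by simp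
  then have pc: "partial_char m H (\<lambda>_. 1)"
    unfolding partial_char_def H_def
    by (auto intro: cong_imp_coprime[OF cong_sym] cong_trans[OF cong_sym])
  have "n ^ totient m \<in> H" using euler_theorem[OF assms(2)] by (simp add: H_def)
  then have ex: "\<exists>k. 0 < k \<and> n ^ k \<in> H" using assms(1) by (metis totient_gt_0_iff gr_implies_not0 not_gr0)
  define k where "k = (LEAST k. 0 < k \<and> n ^ k \<in> H)"
  have k: "0 < k" "n ^ k \<in> H" using LeastI_ex[OF ex] unfolding k_def by auto
  have kl: "n ^ j \<notin> H" if "0 < j" "j < k" for j
    using not_less_Least[of j "\<lambda>k. 0 < k \<and> n ^ k \<in> H"] that unfolding k_def by blast
  have "k \<noteq> 1" using k(2) assms(3) by (auto simp: H_def)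
  then have "card {z::complex. z ^ k = 1} > 1" using k(1) by (simp add: card_roots_unity_eq)
  then have "\<not> {z::complex. z ^ k = 1} \<subseteq> {1}"
    by (metis card_mono card.empty card_insert_disjoint empty_iff finite.emptyI finite_insert not_le One_nat_def)
  then obtain c :: complex where c: "c ^ k = 1" "c \<noteq> 1" by blast
  obtain H' \<xi>' where ext: "partial_char m H' \<xi>'" "n \<in> H'" "\<xi>' n = c"
    using partial_char_extend[OF pc assms(1,2) k kl c(1)] by blast
  obtain \<psi> where "\<psi> \<in> dchars m" "\<psi> n = c"
    using partial_char_extend_full[OF assms(1) ext(1)] ext by metis
  with c show ?thesis using that by blast
qed

section \<open>Values and partial sums of a single character\<close>

context
  fixes m :: nat and \<xi> :: "nat \<Rightarrow> complex"
  assumes m: "m > 1" and \<xi>: "\<xi> \<in> dchars m"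
begin

lemma
  shows dchar_1: "\<xi> 1 = 1" and dchar_mult: "\<xi> (a * b) = \<xi> a * \<xi> b"
    and dchar_mod: "\<xi> (a mod m) = \<xi> a" and dchar_eq_0: "\<not> coprime a m \<Longrightarrow> \<xi> a = 0"
  using \<xi> unfolding dchars_def by blast+

lemma dchar_cong: "[a = b] (mod m) \<Longrightarrow> \<xi> a = \<xi> b"
  using dchar_mod[of a] dchar_mod[of b] by (simp add: Cong.cong_def)

lemma dchar_power: "\<xi> (a ^ n) = \<xi> a ^ n"
  using dchar_1 dchar_mult by (induction n) auto

lemma dchar_power_totient: "coprime a m \<Longrightarrow> \<xi> a ^ totient m = 1"
  using dchar_cong[OF euler_theorem[of a m]] dchar_power dchar_1 by simp

lemma norm_dchar: "coprime a m \<Longrightarrow> norm (\<xi> a) = 1"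
proof -
  assume "coprime a m"
  then have "norm (\<xi> a) ^ totient m = 1 ^ totient m"
    using dchar_power_totient by (metis norm_one norm_power power_one)
  then show ?thesis using m by (subst (asm) power_eq_iff_eq_base) auto
qed

lemma norm_dchar_le: "norm (\<xi> a) \<le> 1"
  using norm_dchar[of a] dchar_eq_0[of a] by (cases "coprime a m") auto

lemma cnj_dchar: "(\<lambda>a. cnj (\<xi> a)) \<in> dchars m"
  using \<xi> unfolding dchars_def by auto

lemma dchar_mult_dchar:
  assumes "\<psi> \<in> dchars m"
  shows "(\<lambda>a. \<psi> a * \<xi> a) \<in> dchars m"
  using \<xi> assms unfolding dchars_def by auto

lemma dchar_cnj_mult: "coprime a m \<Longrightarrow> cnj (\<xi> a) * \<xi> a = 1"
  using norm_dchar[of a] by (simp add: complex_norm_square[symmetric] mult.commute flip: of_real_power)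

text \<open>Multiplication by a unit a with \<xi>(a) other than 1 permutes the residues and
  multiplies the sum by \<xi>(a).\<close>

lemma sum_dchar_period:
  assumes "\<xi> \<noteq> principal m"
  shows "(\<Sum>n<m. \<xi> n) = 0"
proof -
  obtain a where a: "\<xi> a \<noteq> principal m a" using assms by blast
  then have cop: "coprime a m" and ne: "\<xi> a \<noteq> 1"
    using dchar_eq_0[of a] by (auto simp: principal_def split: if_splits)
  have "bij_betw (\<lambda>n. a * n mod m) {..<m} {..<m}"
  proof (rule bij_betwI')
    show "a * x mod m = a * y mod m \<longleftrightarrow> x = y" if "x \<in> {..<m}" "y \<in> {..<m}" for x y
      using that cop cong_mult_lcancel_nat[of a m x y] by (auto simp: Cong.cong_def)
    show "\<exists>x\<in>{..<m}. y = a * x mod m" if y: "y \<in> {..<m}" for y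
    proof -
      obtain b where b: "[a * b = 1] (mod m)" using cong_solve_coprime_nat[OF cop] by auto
      have "[a * (b * y mod m) = a * b * y] (mod m)" by (simp add: Cong.cong_def mod_mult_right_eq mult.assoc)
      also have "[a * b * y = 1 * y] (mod m)" using b by (intro cong_mult cong_refl)
      finally show ?thesis using y m by (intro bexI[of _ "b * y mod m"]) (auto simp: Cong.cong_def)
    qed
  qed (use m in auto)
  then have "(\<Sum>n<m. \<xi> n) = (\<Sum>n<m. \<xi> (a * n mod m))"
    by (rule sum.reindex_bij_betw[symmetric])
  also have "\<dots> = \<xi> a * (\<Sum>n<m. \<xi> n)" by (simp add: dchar_mod dchar_mult sum_distrib_left)
  finally show ?thesis using ne by (simp add: algebra_simps)
qed

lemma norm_sum_dchar_lessThan: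
  assumes "\<xi> \<noteq> principal m"
  shows "norm (\<Sum>n<k. \<xi> n) \<le> real m"
proof (induction k rule: less_induct)
  case (less k)
  show ?case
  proof (cases "k < m")
    case True
    have "norm (\<Sum>n<k. \<xi> n) \<le> (\<Sum>n<k. 1)" by (intro sum_norm_le norm_dchar_le)
    with True show ?thesis by simp
  next
    case False
    then obtain j where j: "k = m + j" using le_Suc_ex not_le by blast
    have "(\<Sum>n<m + j. \<xi> n) = (\<Sum>n<m. \<xi> n) + (\<Sum>n<j. \<xi> (m + n))"
      by (induction j) (simp_all add: add.assoc)
    also have "(\<Sum>n<j. \<xi> (m + n)) = (\<Sum>n<j. \<xi> n)"
      by (intro sum.cong refl dchar_cong) (simp add: Cong.cong_def)
    finally show ?thesis using less.IH[of j] j m sum_dchar_period[OF assms] by simp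
  qed
qed

lemma norm_sum_dchar_interval:
  assumes "\<xi> \<noteq> principal m"
  shows "norm (\<Sum>n=a..b. \<xi> n) \<le> 2 * real m"
proof (cases "a \<le> b")
  case True
  have "(\<Sum>n=a..b. \<xi> n) = (\<Sum>n<Suc b. \<xi> n) - (\<Sum>n<a. \<xi> n)"
  proof -
    have "{..<Suc b} = {..<a} \<union> {a..b}" using True by auto
    moreover have "(\<Sum>n\<in>{..<a} \<union> {a..b}. \<xi> n) = (\<Sum>n<a. \<xi> n) + (\<Sum>n=a..b. \<xi> n)"
      by (intro sum.union_disjoint) auto
    ultimately show ?thesis by simp
  qed
  also have "norm \<dots> \<le> norm (\<Sum>n<Suc b. \<xi> n) + norm (\<Sum>n<a. \<xi> n)" by (rule norm_triangle_ineq4)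
  finally show ?thesis using norm_sum_dchar_lessThan[OF assms, of "Suc b"] norm_sum_dchar_lessThan[OF assms, of a] by simp
qed simp

end

section \<open>Finiteness and orthogonality of the characters\<close>

lemma principal_dchar: "m > 1 \<Longrightarrow> principal m \<in> dchars m"
  unfolding dchars_def principal_def by auto

lemma finite_dchars:
  assumes "m > 1"
  shows "finite (dchars m)"
proof -
  define V where "V = insert 0 {z::complex. z ^ totient m = 1}"
  have "finite {z::complex. z ^ totient m = 1}"
    using assms by (intro finite_roots_unity) (auto simp: Suc_le_eq)
  then have "finite (PiE {..<m} (\<lambda>_. V))" by (intro finite_PiE) (auto simp: V_def)
  moreover have "(\<lambda>\<xi>. restrict \<xi> {..<m}) ` dchars m \<subseteq> PiE {..<m} (\<lambda>_. V)"
  proof (intro image_subsetI, rule restrict_PiE_iff[THEN iffD2], rule ballI)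
    fix \<xi> a assume "\<xi> \<in> dchars m"
    then show "\<xi> a \<in> V" unfolding V_def
      using dchar_power_totient[OF assms, of \<xi> a] dchar_eq_0[OF assms, of \<xi> a] by auto
  qed
  moreover have "inj_on (\<lambda>\<xi>. restrict \<xi> {..<m}) (dchars m)"
  proof (rule inj_onI, rule ext)
    fix \<xi> \<psi> a assume *: "\<xi> \<in> dchars m" "\<psi> \<in> dchars m" "restrict \<xi> {..<m} = restrict \<psi> {..<m}"
    have "\<xi> (a mod m) = \<psi> (a mod m)"
      using fun_cong[OF *(3), of "a mod m"] assms by simp
    then show "\<xi> a = \<psi> a" using dchar_mod[OF assms] * by metis
  qed
  ultimately show ?thesis by (metis inj_on_finite)
qed

text \<open>Multiplication by a character \<psi> with \<psi>(n) other than 1 permutes the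
  characters, so the sum equals \<psi>(n) times itself.\<close>

lemma sum_dchars:
  assumes "m > 1"
  shows "(\<Sum>\<xi>\<in>dchars m. \<xi> n) = (if [n = 1] (mod m) then of_nat (card (dchars m)) else 0)"
proof (cases "[n = 1] (mod m)")
  case True
  then have "\<xi> n = 1" if "\<xi> \<in> dchars m" for \<xi>
    using dchar_cong[OF assms that] dchar_1[OF assms that] by metis
  then have "(\<Sum>\<xi>\<in>dchars m. \<xi> n) = (\<Sum>\<xi>\<in>dchars m. 1)" by (intro sum.cong) auto
  with True show ?thesis by simp
next
  case False
  show ?thesis
  proof (cases "coprime n m")
    case True
    obtain \<psi> where \<psi>: "\<psi> \<in> dchars m" "\<psi> n \<noteq> 1" using dchars_separate[OF assms True False] .
    have cm: "cnj (\<psi> a) * \<psi> a = 1 \<or> \<xi> a = 0" if "\<xi> \<in> dchars m" for \<xi> a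
      using dchar_cnj_mult[OF assms \<psi>(1), of a] dchar_eq_0[OF assms that, of a] by blast
    have "(\<Sum>\<xi>\<in>dchars m. \<psi> n * \<xi> n) = (\<Sum>\<xi>\<in>dchars m. \<xi> n)"
    proof (rule sum.reindex_bij_witness[of _ "\<lambda>\<xi> a. cnj (\<psi> a) * \<xi> a" "\<lambda>\<xi> a. \<psi> a * \<xi> a"])
      fix \<xi> assume \<xi>: "\<xi> \<in> dchars m"
      show "(\<lambda>a. \<psi> a * \<xi> a) \<in> dchars m" using dchar_mult_dchar[OF assms \<xi> \<psi>(1)] .
      show "(\<lambda>a. cnj (\<psi> a) * \<xi> a) \<in> dchars m"
        using dchar_mult_dchar[OF assms \<xi> cnj_dchar[OF assms \<psi>(1)]] .
      show "(\<lambda>a. cnj (\<psi> a) * (\<psi> a * \<xi> a)) = \<xi>"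
      proof
        show "cnj (\<psi> a) * (\<psi> a * \<xi> a) = \<xi> a" for a
          using cm[OF \<xi>, of a] by (metis mult.assoc mult_1 mult_zero_right)
      qed
      show "(\<lambda>a. \<psi> a * (cnj (\<psi> a) * \<xi> a)) = \<xi>"
      proof
        show "\<psi> a * (cnj (\<psi> a) * \<xi> a) = \<xi> a" for a
          using cm[OF \<xi>, of a] by (metis mult.left_commute mult.assoc mult_1 mult_zero_right)
      qed
    qed auto
    then have "(\<psi> n - 1) * (\<Sum>\<xi>\<in>dchars m. \<xi> n) = 0"
      by (simp add: left_diff_distrib flip: sum_distrib_left)
    with \<psi>(2) False show ?thesis by simp
  next
    case False': False
    then show ?thesis using dchar_eq_0[OF assms, of _ n] False by (auto intro!: sum.neutral)
  qed
qed

lemma dchars_orthogonality: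
  assumes "m > 1" "coprime a m"
  shows "(\<Sum>\<xi>\<in>dchars m. cnj (\<xi> a) * \<xi> n) = (if [n = a] (mod m) then of_nat (card (dchars m)) else 0)"
proof -
  obtain b where b: "[a * b = 1] (mod m)" using cong_solve_coprime_nat[OF assms(2)] by auto
  have "cnj (\<xi> a) = \<xi> b" if \<xi>: "\<xi> \<in> dchars m" for \<xi>
  proof -
    have "\<xi> a * \<xi> b = 1"
      using dchar_cong[OF assms(1) \<xi> b] dchar_mult[OF assms(1) \<xi>] dchar_1[OF assms(1) \<xi>] by simp
    then have "cnj (\<xi> a) * \<xi> a * \<xi> b = cnj (\<xi> a)" by (simp add: mult.assoc)
    then show ?thesis using dchar_cnj_mult[OF assms(1) \<xi> assms(2)] by simp
  qed
  then have "(\<Sum>\<xi>\<in>dchars m. cnj (\<xi> a) * \<xi> n) = (\<Sum>\<xi>\<in>dchars m. \<xi> (b * n))"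
    using dchar_mult[OF assms(1)] by (intro sum.cong) auto
  moreover have "[b * n = 1] (mod m) \<longleftrightarrow> [n = a] (mod m)"
  proof -
    have "coprime b m" using b by (metis cong_imp_coprime cong_sym coprime_1_left coprime_mult_left_iff)
    then have "[b * n = b * a] (mod m) \<longleftrightarrow> [n = a] (mod m)" by (rule cong_mult_lcancel_nat)
    moreover have "[b * a = 1] (mod m)" using b by (simp add: mult.commute)
    ultimately show ?thesis by (meson cong_sym cong_trans)
  qed
  ultimately show ?thesis using sum_dchars[OF assms(1), of "b * n"] by simp
qed

section \<open>Chebyshev and Mertens estimates\<close>

text \<open>Both sides run over the pairs (d, k) with d k \<le> N. All convolutions below, of
  logarithms, characters and Lambert series, are regrouped this way.\<close>

lemma sum_divisors_swap:
  fixes f :: "nat \<Rightarrow> nat \<Rightarrow> 'a :: comm_monoid_add"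
  shows "(\<Sum>n=1..N. \<Sum>d | d dvd n. f d (n div d)) = (\<Sum>d=1..N. \<Sum>k=1..N div d. f d k)"
proof -
  have "(\<Sum>n=1..N. \<Sum>d | d dvd n. f d (n div d))
      = (\<Sum>(n, d)\<in>(SIGMA n:{1..N}. {d. d dvd n}). f d (n div d))"
    by (intro sum.Sigma) auto
  also have "\<dots> = (\<Sum>(d, k)\<in>(SIGMA d:{1..N}. {1..N div d}). f d k)"
  proof (rule sum.reindex_bij_witness[of _ "\<lambda>(d, k). (d * k, d)" "\<lambda>(n, d). (d, n div d)"])
    fix x assume "x \<in> (SIGMA n:{1..N}. {d. d dvd n})"
    then obtain n d where x: "x = (n, d)" and n: "n \<in> {1..N}" and d: "d dvd n" by auto
    then obtain k where nk: "n = d * k" by (auto elim: dvdE)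
    with n have "d > 0" "k > 0" by (auto intro: Nat.gr0I)
    moreover from this nk have "n div d = k" "d \<le> n" by auto
    ultimately have "d > 0" "n div d > 0" "d \<le> N" using n by auto
    moreover have "n div d \<le> N div d" using n by (intro div_le_mono) auto
    ultimately show "(case x of (n, d) \<Rightarrow> (d, n div d)) \<in> (SIGMA d:{1..N}. {1..N div d})"
      unfolding x by auto
    show "(case case x of (n, d) \<Rightarrow> (d, n div d) of (d, k) \<Rightarrow> (d * k, d)) = x"
      "(case case x of (n, d) \<Rightarrow> (d, n div d) of (d, k) \<Rightarrow> f d k) = (case x of (n, d) \<Rightarrow> f d (n div d))"
      unfolding x using d by simp_all
  next
    fix x assume "x \<in> (SIGMA d:{1..N}. {1..N div d})"
    then obtain d k where x: "x = (d, k)" and dk: "d \<in> {1..N}" "k \<in> {1..N div d}" by auto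
    have "d * k \<le> d * (N div d)" using dk by simp
    also have "\<dots> \<le> N" by simp
    finally show "(case x of (d, k) \<Rightarrow> (d * k, d)) \<in> (SIGMA n:{1..N}. {d. d dvd n})"
      unfolding x using dk by auto
    show "(case case x of (d, k) \<Rightarrow> (d * k, d) of (n, d) \<Rightarrow> (d, n div d)) = x"
      unfolding x using dk by simp
  qed
  also have "\<dots> = (\<Sum>d=1..N. \<Sum>k=1..N div d. f d k)"
    by (rule sum.Sigma[symmetric]) auto
  finally show ?thesis .
qed

lemma ln_fact_mangoldt: "ln (fact N) = (\<Sum>d=1..N. mangoldt d * real (N div d))"
proof -
  have "ln (fact N :: real) = (\<Sum>n=1..N. ln (real n))"
    unfolding fact_prod by (subst ln_prod[symmetric]) (auto simp: of_nat_prod)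
  also have "\<dots> = (\<Sum>n=1..N. \<Sum>d | d dvd n. mangoldt d)"
    by (intro sum.cong refl) (subst mangoldt_sum, auto)
  also have "\<dots> = (\<Sum>d=1..N. \<Sum>k=1..N div d. mangoldt d)"
    by (rule sum_divisors_swap)
  finally show ?thesis by (simp add: mult.commute)
qed

lemma real_div_bounds:
  shows "real N / real d - 1 < real (N div d)" and "real (N div d) \<le> real N / real d"
proof -
  have "real_of_int \<lfloor>real N / real d\<rfloor> = real (N div d)" by (simp add: floor_divide_of_nat_eq)
  then show "real N / real d - 1 < real (N div d)" "real (N div d) \<le> real N / real d"
    using floor_correct[of "real N / real d"] by linarith+
qed

lemma ln_fact_le: "ln (fact N) \<le> real N * ln (real N)"
proof (cases "N = 0")
  case False
  have "ln (fact N :: real) \<le> ln (real N ^ N)"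
    using False fact_le_power[of N, where ?'a = real] by (subst ln_le_cancel_iff) auto
  also have "\<dots> = real N * ln (real N)" using False by (simp add: ln_realpow)
  finally show ?thesis .
qed simp

lemma ln_fact_ge: "real N * ln (real N) - real N \<le> ln (fact N)"
proof (induction N)
  case (Suc N)
  show ?case
  proof (cases "N = 0")
    case False
    have "ln (real (Suc N)) - ln (real N) = ln (1 + 1 / real N)"
      using False by (subst ln_divide_pos[symmetric]) (auto simp: add_divide_distrib add.commute)
    also have "\<dots> \<le> 1 / real N" by (rule ln_add_one_self_le_self) simp
    finally have "real N * (ln (real (Suc N)) - ln (real N)) \<le> 1"
      using False by (simp add: field_simps)
    moreover have "ln (fact (Suc N)) = ln (real (Suc N)) + ln (fact N)"
      by (subst fact_Suc, subst ln_mult) auto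
    ultimately show ?thesis using Suc by (simp add: algebra_simps)
  qed simp
qed simp

text \<open>Chebyshev's device: the weights f d are 1 for N < d \<le> 2 N and nonnegative elsewhere,
  and their full sum is the logarithm of the central binomial coefficient, at most 2 N ln 2.\<close>

lemma sum_mangoldt_double:
  "(\<Sum>d=N+1..2*N. mangoldt d) \<le> 2 * real N * ln 2"
proof -
  define f where "f d = real (2 * N div d) - 2 * real (N div d)" for d
  have f0: "f d \<ge> 0" for d
  proof -
    have "2 * (N div d) \<le> 2 * N div d"
      using div_add_self1[of d] by (cases "d = 0") (auto simp: less_eq_div_iff_mult_less_eq mult.assoc)
    then show ?thesis unfolding f_def by (simp flip: of_nat_le_iff)
  qed
  have "(\<Sum>d=N+1..2*N. mangoldt d) = (\<Sum>d=N+1..2*N. mangoldt d * f d)"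
  proof (intro sum.cong refl)
    fix d assume d: "d \<in> {N+1..2*N}"
    then have "2 * N div d = 1" by (intro div_nat_eqI) auto
    with d show "mangoldt d = mangoldt d * f d" by (simp add: f_def)
  qed
  also have "\<dots> \<le> (\<Sum>d=1..2*N. mangoldt d * f d)"
    using f0 by (intro sum_mono2) (auto intro!: mult_nonneg_nonneg mangoldt_nonneg)
  also have "\<dots> = (\<Sum>d=1..2*N. mangoldt d * real (2 * N div d)) - 2 * (\<Sum>d=1..2*N. mangoldt d * real (N div d))"
    by (simp add: f_def algebra_simps sum_subtractf sum_distrib_left)
  also have "(\<Sum>d=1..2*N. mangoldt d * real (N div d)) = (\<Sum>d=1..N. mangoldt d * real (N div d))"
    by (intro sum.mono_neutral_right) auto
  also have "(\<Sum>d=1..2*N. mangoldt d * real (2 * N div d)) - 2 * (\<Sum>d=1..N. mangoldt d * real (N div d))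
      = ln (fact (2 * N)) - 2 * ln (fact N)"
    by (simp only: ln_fact_mangoldt)
  also have "\<dots> = ln (real (2 * N choose N))"
  proof -
    have "fact N * fact N * (2 * N choose N) = (fact (2 * N) :: nat)"
      using binomial_fact_lemma[of N "2 * N"] by simp
    then have "fact N * fact N * real (2 * N choose N) = fact (2 * N)"
      by (metis of_nat_fact of_nat_mult)
    then have "ln (fact (2 * N)) = ln (fact N * fact N * real (2 * N choose N))" by simp
    then show ?thesis by (simp add: ln_mult)
  qed
  also have "\<dots> \<le> ln (2 ^ (2 * N))"
    using binomial_le_pow2[of "2 * N" N] by (subst ln_le_cancel_iff) (auto simp flip: of_nat_le_iff)
  also have "\<dots> = 2 * real N * ln 2" by (subst ln_realpow) auto
  finally show ?thesis .
qed

lemma chebyshev: "(\<Sum>d=1..N. mangoldt d) \<le> 6 * real N"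
proof (induction N rule: less_induct)
  case (less N)
  consider "N = 0" | "N = 1" | "N \<ge> 2" by linarith
  then show ?case
  proof cases
    case 3
    \<comment> \<open>The constant 6 closes the induction: 6 M + 2 M \<le> 4 (N + 1) \<le> 6 N from
      N = 2 on.\<close>
    define M where "M = (N + 1) div 2"
    have M: "M < N" "N \<le> 2 * M" "2 * M \<le> N + 1" using 3 by (auto simp: M_def)
    have "(\<Sum>d=1..N. mangoldt d) \<le> (\<Sum>d=1..2*M. mangoldt d :: real)"
      using M by (intro sum_mono2) (auto intro: mangoldt_nonneg)
    also have "{1..2*M} = {1..M} \<union> {M+1..2*M}" by auto
    also have "(\<Sum>d\<in>{1..M} \<union> {M+1..2*M}. mangoldt d) = (\<Sum>d=1..M. mangoldt d) + (\<Sum>d=M+1..2*M. mangoldt d :: real)"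
      by (intro sum.union_disjoint) auto
    also have "\<dots> \<le> 6 * real M + 2 * real M * ln 2"
      using less[OF M(1)] sum_mangoldt_double[of M] by linarith
    also have "\<dots> \<le> 6 * real M + 2 * real M * 1"
      using ln_2_less_1 by (intro add_left_mono mult_left_mono) auto
    also have "\<dots> \<le> 4 * real (N + 1)" using M(3) by (simp flip: of_nat_le_iff)
    also have "\<dots> \<le> 6 * real N" using 3 by simp
    finally show ?thesis .
  qed auto
qed

text \<open>Replacing \<open>N div d\<close> by N/d in the formula for ln N! costs at most the sum
  of \<open>mangoldt d\<close>, hence 6 N by \<open>chebyshev\<close>; division by N leaves the
  6.\<close>

lemma mertens_upper: "N > 0 \<Longrightarrow> (\<Sum>d=1..N. mangoldt d / real d) \<le> ln (real N) + 6"
proof -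
  assume N: "N > 0"
  have "real N * (\<Sum>d=1..N. mangoldt d / real d) - (\<Sum>d=1..N. mangoldt d)
      = (\<Sum>d=1..N. mangoldt d * (real N / real d - 1))"
    by (simp add: sum_distrib_left right_diff_distrib sum_subtractf mult_ac)
  also have "\<dots> \<le> (\<Sum>d=1..N. mangoldt d * real (N div d))"
  proof (intro sum_mono mult_left_mono)
    show "real N / real d - 1 \<le> real (N div d)" for d using real_div_bounds(1)[of N d] by simp
  qed (rule mangoldt_nonneg)
  also have "\<dots> \<le> real N * ln (real N)" using ln_fact_le[of N] unfolding ln_fact_mangoldt .
  finally have "real N * (\<Sum>d=1..N. mangoldt d / real d) \<le> real N * (ln (real N) + 6)"
    using chebyshev[of N] by (simp add: algebra_simps)
  then show ?thesis using N by simp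
qed

lemma mertens_lower: "N > 0 \<Longrightarrow> ln (real N) - 1 \<le> (\<Sum>d=1..N. mangoldt d / real d)"
proof -
  assume N: "N > 0"
  have "real N * ln (real N) - real N \<le> (\<Sum>d=1..N. mangoldt d * real (N div d))"
    using ln_fact_ge[of N] unfolding ln_fact_mangoldt .
  also have "\<dots> \<le> (\<Sum>d=1..N. mangoldt d * (real N / real d))"
    by (intro sum_mono mult_left_mono mangoldt_nonneg real_div_bounds(2))
  also have "\<dots> = real N * (\<Sum>d=1..N. mangoldt d / real d)"
    by (simp add: sum_distrib_left mult_ac)
  finally have "real N * (ln (real N) - 1) \<le> real N * (\<Sum>d=1..N. mangoldt d / real d)"
    by (simp add: algebra_simps)
  then show ?thesis using N by simp
qed

section \<open>The series \<open>L(1, \<xi>)\<close>\<close>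

lemma norm_sum_antimono_weight_le:
  fixes z :: "nat \<Rightarrow> complex" and g :: "nat \<Rightarrow> real"
  assumes z: "\<And>k. norm (\<Sum>n=a..k. z n) \<le> B"
    and g: "\<And>n. n \<ge> a \<Longrightarrow> g (Suc n) \<le> g n" "\<And>n. n \<ge> a \<Longrightarrow> g n \<ge> 0"
  shows "norm (\<Sum>n=a..b. z n * of_real (g n)) \<le> B * g a"
proof (cases "a \<le> b")
  case True
  define S where "S k = (\<Sum>n=a..k. z n)" for k
  have id: "(\<Sum>n=a..b. z n * of_real (g n)) = S b * of_real (g b) + (\<Sum>n=a..<b. S n * of_real (g n - g (Suc n)))"
    using True
  proof (induction b rule: dec_induct)
    case (step b)
    have "S (Suc b) = S b + z (Suc b)" using step.hyps by (simp add: S_def)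
    with step show ?case by (simp add: algebra_simps)
  qed (simp add: S_def)
  have "norm (\<Sum>n=a..b. z n * of_real (g n))
      \<le> norm (S b * of_real (g b)) + (\<Sum>n=a..<b. norm (S n * of_real (g n - g (Suc n))))"
    unfolding id by (intro order_trans[OF norm_triangle_ineq] add_left_mono norm_sum)
  also have "\<dots> \<le> B * g b + (\<Sum>n=a..<b. B * (g n - g (Suc n)))"
  proof (intro add_mono sum_mono)
    show "norm (S b * of_real (g b)) \<le> B * g b"
      using z[of b] g(2)[OF True] by (simp add: norm_mult S_def mult_right_mono)
    fix n assume "n \<in> {a..<b}"
    then show "norm (S n * of_real (g n - g (Suc n))) \<le> B * (g n - g (Suc n))"
      using z[of n] g(1)[of n] by (simp add: norm_mult S_def mult_right_mono del: of_real_diff)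
  qed
  also have "\<dots> = B * g a"
  proof -
    have "(\<Sum>n=a..<b. g n - g (Suc n)) = g a - g b"
      using sum_Suc_diff'[of a b g] True by (simp add: sum_subtractf)
    then have "(\<Sum>n=a..<b. B * (g n - g (Suc n))) = B * (g a - g b)"
      by (simp only: sum_distrib_left[symmetric])
    then show ?thesis by (simp add: right_diff_distrib)
  qed
  finally show ?thesis .
next
  case False
  have "0 \<le> B" using z[of a] norm_ge_zero by (rule order_trans[rotated])
  with False g(2)[of a] show ?thesis by simp
qed

definition Lsum :: "(nat \<Rightarrow> complex) \<Rightarrow> nat \<Rightarrow> complex" where
  "Lsum \<xi> N = (\<Sum>n=1..N. \<xi> n / of_nat n)"

text \<open>The limit exists for nonprincipal characters; every statement about \<open>Lone\<close>
  excludes the principal one.\<close>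

definition Lone :: "(nat \<Rightarrow> complex) \<Rightarrow> complex" where
  "Lone \<xi> = lim (Lsum \<xi>)"

text \<open>Partial sums at s = 1 of the Dirichlet series of -L'/L.\<close>

definition Tsum :: "(nat \<Rightarrow> complex) \<Rightarrow> nat \<Rightarrow> complex" where
  "Tsum \<xi> N = (\<Sum>n=1..N. \<xi> n * of_real (mangoldt n) / of_nat n)"

context
  fixes m :: nat and \<xi> :: "nat \<Rightarrow> complex"
  assumes m: "m > 1" and \<xi>: "\<xi> \<in> dchars m" and np: "\<xi> \<noteq> principal m"
begin

lemma norm_sum_dchar_div:
  assumes "a > 0"
  shows "norm (\<Sum>n=a..b. \<xi> n / of_nat n) \<le> 2 * real m / real a"
proof -
  have "norm (\<Sum>n=a..b. \<xi> n * of_real (1 / real n)) \<le> 2 * real m * (1 / real a)"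
    using assms by (intro norm_sum_antimono_weight_le norm_sum_dchar_interval[OF m \<xi> np]) (auto simp: frac_le)
  then show ?thesis by simp
qed

lemma Lsum_diff: "N \<le> M \<Longrightarrow> norm (Lsum \<xi> M - Lsum \<xi> N) \<le> 2 * real m / real (Suc N)"
proof -
  assume "N \<le> M"
  then have "{1..M} = {1..N} \<union> {Suc N..M}" by auto
  moreover have "(\<Sum>n\<in>{1..N} \<union> {Suc N..M}. \<xi> n / of_nat n) = Lsum \<xi> N + (\<Sum>n=Suc N..M. \<xi> n / of_nat n)"
    unfolding Lsum_def by (intro sum.union_disjoint) auto
  ultimately show ?thesis using norm_sum_dchar_div[of "Suc N" M] by (simp add: Lsum_def)
qed

lemma Lsum_tendsto: "Lsum \<xi> \<longlonglongrightarrow> Lone \<xi>"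
proof -
  have "Cauchy (Lsum \<xi>)"
  proof (rule CauchyI')
    fix e :: real assume e: "e > 0"
    obtain K where K: "2 * real m / e < real K" using reals_Archimedean2 by blast
    have "norm (Lsum \<xi> N - Lsum \<xi> M) < e" if "K \<le> N" "N < M" for N M
    proof -
      have "norm (Lsum \<xi> N - Lsum \<xi> M) \<le> 2 * real m / real (Suc N)"
        using Lsum_diff[of N M] that by (simp add: norm_minus_commute)
      also have "\<dots> < e"
      proof -
        have "2 * real m / e < real (Suc N)" using K that by simp
        then show ?thesis using e by (simp add: field_simps)
      qed
      finally show ?thesis .
    qed
    then show "\<exists>K. \<forall>N\<ge>K. \<forall>M>N. dist (Lsum \<xi> N) (Lsum \<xi> M) < e"
      unfolding dist_norm by blast
  qed
  then show ?thesis unfolding Lone_def by (simp add: Cauchy_convergent flip: convergent_LIMSEQ_iff)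
qed

lemma Lsum_Lone: "norm (Lsum \<xi> N - Lone \<xi>) \<le> 2 * real m / real (Suc N)"
proof -
  have lim: "(\<lambda>M. norm (Lsum \<xi> M - Lsum \<xi> N)) \<longlonglongrightarrow> norm (Lone \<xi> - Lsum \<xi> N)"
    by (intro tendsto_intros Lsum_tendsto)
  have "eventually (\<lambda>M. norm (Lsum \<xi> M - Lsum \<xi> N) \<le> 2 * real m / real (Suc N)) sequentially"
    using eventually_ge_at_top[of N] by eventually_elim (rule Lsum_diff)
  then have "norm (Lone \<xi> - Lsum \<xi> N) \<le> 2 * real m / real (Suc N)"
    by (rule tendsto_upperbound[OF lim]) simp
  then show ?thesis by (simp add: norm_minus_commute)
qed

lemma Lsum_Lone_div:
  assumes "d \<ge> 1" "N \<ge> 1"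
  shows "norm (Lsum \<xi> (N div d) - Lone \<xi>) \<le> 2 * real m * real d / real N"
proof -
  have "N < d * Suc (N div d)" using assms by (metis dividend_less_times_div mult_Suc_right not_one_le_zero not_gr_zero)
  then have "real N \<le> real d * real (Suc (N div d))" by (metis less_imp_le of_nat_le_iff of_nat_mult)
  then have "1 / real (Suc (N div d)) \<le> real d / real N"
    using assms by (simp add: field_simps del: of_nat_Suc)
  then have "2 * real m * (1 / real (Suc (N div d))) \<le> 2 * real m * (real d / real N)"
    by (rule mult_left_mono) simp
  then show ?thesis using Lsum_Lone[of "N div d"] by simp
qed

text \<open>Partial summation with the weight ln n / n, which decreases only from n = 3 on, because
  e \<le> 3; the first two terms are split off.\<close>

lemma sum_dchar_ln_bounded:
  obtains C where "\<And>N. norm (\<Sum>n=1..N. \<xi> n * of_real (ln (real n)) / of_nat n) \<le> C"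
proof -
  define g where "g n = ln (real n) / real n" for n
  have dec: "g (Suc n) \<le> g n" if "n \<ge> 3" for n
  proof -
    have "exp 1 \<le> (3::real)" by (rule exp_le)
    then have "1 \<le> ln (real n)" using that by (subst ln_ge_iff) auto
    have "real n * (ln (real (Suc n)) - ln (real n)) = real n * ln (1 + 1 / real n)"
      using that by (subst ln_divide_pos[symmetric]) (auto simp: add_divide_distrib add.commute)
    also have "\<dots> \<le> real n * (1 / real n)" by (intro mult_left_mono ln_add_one_self_le_self) auto
    also have "\<dots> \<le> ln (real n)" using \<open>1 \<le> ln (real n)\<close> that by simp
    finally have "real n * ln (real (Suc n)) \<le> real (Suc n) * ln (real n)" by (simp add: algebra_simps)
    then show ?thesis using that unfolding g_def by (simp add: divide_simps mult.commute)
  qed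
  have b: "norm (\<Sum>n=3..N. \<xi> n * of_real (g n)) \<le> 2 * real m * g 3" for N
    using dec by (intro norm_sum_antimono_weight_le norm_sum_dchar_interval[OF m \<xi> np]) (auto simp: g_def)
  have "norm (\<Sum>n=1..N. \<xi> n * of_real (g n)) \<le> norm (\<xi> 1 * of_real (g 1)) + norm (\<xi> 2 * of_real (g 2)) + 2 * real m * g 3" for N
  proof -
    have g3: "0 \<le> 2 * real m * g 3" by (auto simp: g_def)
    consider "N = 0" | "N = 1" | "N = 2" | "N \<ge> 3" by linarith
    then show ?thesis
    proof cases
      case 3
      then have "{1..N} = {1, 2}" by auto
      then have "norm (\<Sum>n=1..N. \<xi> n * of_real (g n)) \<le> norm (\<xi> 1 * of_real (g 1)) + norm (\<xi> 2 * of_real (g 2))"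
        using norm_triangle_ineq by simp
      with g3 show ?thesis by linarith
    next
      case 4
      then have "{1..N} = insert 1 (insert 2 {3..N})" by auto
      then have "(\<Sum>n=1..N. \<xi> n * of_real (g n)) = (\<xi> 1 * of_real (g 1) + \<xi> 2 * of_real (g 2)) + (\<Sum>n=3..N. \<xi> n * of_real (g n))"
        by simp
      also have "norm \<dots> \<le> norm (\<xi> 1 * of_real (g 1) + \<xi> 2 * of_real (g 2)) + norm (\<Sum>n=3..N. \<xi> n * of_real (g n))"
        by (rule norm_triangle_ineq)
      finally show ?thesis
        using b[of N] norm_triangle_ineq[of "\<xi> 1 * of_real (g 1)" "\<xi> 2 * of_real (g 2)"] by linarith
    qed (use g3 in auto)
  qed
  then show ?thesis by (intro that) (simp add: g_def)
qed

text \<open>Mertens' argument: writing ln n as a divisor sum of \<open>mangoldt\<close> turns the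
  bounded sum of \<xi>(n) ln n / n into \<open>Lone \<xi> * Tsum \<xi> N\<close> plus a bounded
  error, and the first factor is divided out.\<close>

lemma Tsum_bounded_if_Lone_nonzero:
  assumes "Lone \<xi> \<noteq> 0"
  obtains C where "\<And>N. N \<ge> 1 \<Longrightarrow> norm (Tsum \<xi> N) \<le> C"
proof -
  obtain C where C: "\<And>N. norm (\<Sum>n=1..N. \<xi> n * of_real (ln (real n)) / of_nat n) \<le> C"
    using sum_dchar_ln_bounded by blast
  have "norm (Tsum \<xi> N) \<le> (C + 12 * real m) / norm (Lone \<xi>)" if N: "N \<ge> 1" for N
  proof -
    define t where "t d = \<xi> d * of_real (mangoldt d) / of_nat d" for d
    have "(\<Sum>n=1..N. \<xi> n * of_real (ln (real n)) / of_nat n)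
        = (\<Sum>n=1..N. \<Sum>d | d dvd n. t d * (\<xi> (n div d) / of_nat (n div d)))"
    proof (intro sum.cong refl)
      fix n assume n: "n \<in> {1..N}"
      have "\<xi> n * of_real (ln (real n)) / of_nat n = (\<Sum>d | d dvd n. \<xi> n * of_real (mangoldt d) / of_nat n)"
        using mangoldt_sum[of n, where ?'a = real] n
        by (simp flip: sum_distrib_left sum_divide_distrib of_real_sum del: of_real_mangoldt)
      also have "\<dots> = (\<Sum>d | d dvd n. t d * (\<xi> (n div d) / of_nat (n div d)))"
      proof (intro sum.cong refl)
        fix d assume "d \<in> {d. d dvd n}"
        then have "n = d * (n div d)" by simp
        then have "\<xi> n = \<xi> d * \<xi> (n div d)" "of_nat n = (of_nat d * of_nat (n div d) :: complex)"
          using dchar_mult[OF m \<xi>] by (metis, metis of_nat_mult)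
        then show "\<xi> n * of_real (mangoldt d) / of_nat n = t d * (\<xi> (n div d) / of_nat (n div d))"
          by (simp add: t_def)
      qed
      finally show "\<xi> n * of_real (ln (real n)) / of_nat n = (\<Sum>d | d dvd n. t d * (\<xi> (n div d) / of_nat (n div d)))" .
    qed
    also have "\<dots> = (\<Sum>d=1..N. \<Sum>k=1..N div d. t d * (\<xi> k / of_nat k))"
      by (rule sum_divisors_swap)
    also have "\<dots> = (\<Sum>d=1..N. t d * Lsum \<xi> (N div d))" by (simp add: Lsum_def sum_distrib_left)
    also have "\<dots> = Lone \<xi> * Tsum \<xi> N + (\<Sum>d=1..N. t d * (Lsum \<xi> (N div d) - Lone \<xi>))"
    proof -
      have "Tsum \<xi> N = (\<Sum>d=1..N. t d)" by (simp add: Tsum_def t_def)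
      then show ?thesis by (simp add: right_diff_distrib sum_subtractf mult.commute[of _ "Lone \<xi>"] sum_distrib_left)
    qed
    finally have "Lone \<xi> * Tsum \<xi> N = (\<Sum>n=1..N. \<xi> n * of_real (ln (real n)) / of_nat n)
        - (\<Sum>d=1..N. t d * (Lsum \<xi> (N div d) - Lone \<xi>))" by simp
    then have "norm (Lone \<xi> * Tsum \<xi> N) \<le> C + norm (\<Sum>d=1..N. t d * (Lsum \<xi> (N div d) - Lone \<xi>))"
      by (simp only:) (rule order_trans[OF norm_triangle_ineq4 add_right_mono[OF C]])
    \<comment> \<open>The tail error, of order d/N, cancels the 1/d in t d, so Chebyshev's bound
      suffices.\<close>
    also have "norm (\<Sum>d=1..N. t d * (Lsum \<xi> (N div d) - Lone \<xi>)) \<le> (\<Sum>d=1..N. mangoldt d * (2 * real m / real N))"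
    proof (rule sum_norm_le)
      fix d assume d: "d \<in> {1..N}"
      have "norm (t d) \<le> mangoldt d / real d"
        unfolding t_def using norm_dchar_le[OF m \<xi>, of d] mangoldt_nonneg[of d]
        by (simp add: norm_mult norm_divide divide_right_mono mult_left_le_one_le)
      moreover have "norm (Lsum \<xi> (N div d) - Lone \<xi>) \<le> 2 * real m * real d / real N"
        using d N by (intro Lsum_Lone_div) auto
      ultimately have "norm (t d * (Lsum \<xi> (N div d) - Lone \<xi>)) \<le> (mangoldt d / real d) * (2 * real m * real d / real N)"
        unfolding norm_mult by (intro mult_mono) (auto simp: mangoldt_nonneg)
      also have "\<dots> = mangoldt d * (2 * real m / real N)" using d by simp
      finally show "norm (t d * (Lsum \<xi> (N div d) - Lone \<xi>)) \<le> mangoldt d * (2 * real m / real N)" .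
    qed
    also have "\<dots> = (\<Sum>d=1..N. mangoldt d) * (2 * real m / real N)" by (rule sum_distrib_right[symmetric])
    also have "\<dots> \<le> (6 * real N) * (2 * real m / real N)" by (intro mult_right_mono chebyshev) auto
    also have "\<dots> = 12 * real m" using N by simp
    finally show ?thesis using assms by (simp add: norm_mult field_simps)
  qed
  then show ?thesis using that by blast
qed

end

section \<open>Moebius inversion and characters with vanishing L(1)\<close>

definition mu_fun :: "nat \<Rightarrow> real" where
  "mu_fun n = (if squarefree n then (-1) ^ card (prime_factors n) else 0)"

lemma abs_mu_fun_le: "\<bar>mu_fun n\<bar> \<le> 1"
  by (simp add: mu_fun_def power_abs)

lemma mu_fun_prime_mult:
  assumes "prime p" "\<not> p dvd d"
  shows "mu_fun (p * d) = - mu_fun d"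
proof -
  have d: "d \<noteq> 0" using assms(2) by (intro notI) simp
  have cop: "coprime p d" using assms by (simp add: prime_imp_coprime)
  have "squarefree (p * d) \<longleftrightarrow> squarefree d"
    using assms cop squarefree_mult_coprime[of p d] squarefree_prime[of p] squarefree_multD(2)
    by blast
  moreover have "prime_factors (p * d) = insert p (prime_factors d)"
    using assms d by (subst prime_factors_product) (auto simp: prime_prime_factors)
  moreover have "p \<notin> prime_factors d" using assms by auto
  ultimately show ?thesis by (simp add: mu_fun_def)
qed

text \<open>For a prime p dividing n, the squarefree divisors fall into pairs d, p d with opposite
  signs.\<close>

lemma sum_mu_fun:
  assumes "n > 0"
  shows "(\<Sum>d | d dvd n. mu_fun d) = (if n = 1 then 1 else 0)"
proof (cases "n = 1")
  case False
  then obtain p where p: "prime p" "p dvd n" using prime_factor_nat by blast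
  define A where "A = {d. d dvd n \<and> squarefree d \<and> \<not> p dvd d}"
  have fin: "finite {d. d dvd n}" using assms by simp
  have finA: "finite A" by (rule finite_subset[OF _ fin]) (auto simp: A_def)
  have img: "{d. d dvd n \<and> squarefree d \<and> p dvd d} = (\<lambda>d. p * d) ` A"
  proof (intro equalityI subsetI)
    fix d assume "d \<in> {d. d dvd n \<and> squarefree d \<and> p dvd d}"
    then obtain e where e: "d = p * e" "p * e dvd n" "squarefree (p * e)" by (auto elim: dvdE)
    have "\<not> p dvd e"
    proof
      assume "p dvd e"
      then have "p ^ 2 dvd p * e" by (simp add: power2_eq_square)
      then have "is_unit p" using e(3) by (auto simp: squarefree_def)
      then show False using p(1) by auto
    qed
    moreover have "e dvd n" using e(2) dvd_mult_right by blast
    moreover have "squarefree e" using e(3) squarefree_multD(2) by blast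
    ultimately show "d \<in> (\<lambda>d. p * d) ` A" using e(1) by (auto simp: A_def)
  next
    fix d assume "d \<in> (\<lambda>d. p * d) ` A"
    then obtain e where e: "d = p * e" "e \<in> A" by auto
    then have "coprime p e" using p(1) by (simp add: A_def prime_imp_coprime)
    then have "p * e dvd n" "squarefree (p * e)"
      using e(2) p squarefree_mult_coprime[of p e] squarefree_prime[of p]
      by (auto simp: A_def intro: divides_mult)
    with e(1) show "d \<in> {d. d dvd n \<and> squarefree d \<and> p dvd d}" by simp
  qed
  have "(\<Sum>d | d dvd n. mu_fun d) = (\<Sum>d\<in>A \<union> (\<lambda>d. p * d) ` A. mu_fun d)"
    unfolding img[symmetric] using fin
    by (intro sum.mono_neutral_right) (auto simp: A_def mu_fun_def)
  also have "\<dots> = (\<Sum>d\<in>A. mu_fun d) + (\<Sum>d\<in>(\<lambda>d. p * d) ` A. mu_fun d)"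
    using finA by (intro sum.union_disjoint) (auto simp: A_def)
  also have "(\<Sum>d\<in>(\<lambda>d. p * d) ` A. mu_fun d) = (\<Sum>d\<in>A. mu_fun (p * d))"
    using p(1) by (subst sum.reindex) (auto intro!: inj_onI)
  also have "\<dots> = - (\<Sum>d\<in>A. mu_fun d)"
    using p(1) by (simp add: mu_fun_prime_mult A_def flip: sum_negf)
  finally show ?thesis using False by simp
qed (simp add: mu_fun_def)

lemma mangoldt_eq_sum_mu_fun:
  assumes "n > 0"
  shows "mangoldt n = (\<Sum>d | d dvd n. mu_fun d * ln (real (n div d)))"
proof -
  define V where "V = {d. d dvd n}"
  have V: "finite V" "\<And>d. d \<in> V \<Longrightarrow> d > 0" using assms by (auto simp: V_def intro: Nat.gr0I)
  have dv: "{e. e dvd n div d} = {e \<in> V. d * e dvd n}" if "d \<in> V" for d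
    using that V(2)[OF that] dvd_div_iff_mult[of d n]
    by (auto simp: V_def mult.commute dest: dvd_mult_right)
  have "(\<Sum>d | d dvd n. mu_fun d * ln (real (n div d)))
      = (\<Sum>d\<in>V. mu_fun d * (\<Sum>e | e dvd n div d. mangoldt e))"
  proof (unfold V_def, intro sum.cong refl)
    fix d assume "d \<in> {d. d dvd n}"
    then have "n div d \<noteq> 0" using assms by (auto simp: dvd_div_eq_0_iff)
    from mangoldt_sum[OF this, where ?'a = real]
    show "mu_fun d * ln (real (n div d)) = mu_fun d * (\<Sum>e | e dvd n div d. mangoldt e)" by simp
  qed
  also have "\<dots> = (\<Sum>d\<in>V. \<Sum>e\<in>{e \<in> V. d * e dvd n}. mu_fun d * mangoldt e)"
    by (intro sum.cong refl) (simp add: dv sum_distrib_left)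
  also have "\<dots> = (\<Sum>e\<in>V. \<Sum>d\<in>{d \<in> V. d * e dvd n}. mu_fun d * mangoldt e)"
    using V(1) by (intro sum.swap_restrict) auto
  also have "\<dots> = (\<Sum>e\<in>V. mangoldt e * (\<Sum>d | d dvd n div e. mu_fun d))"
    by (intro sum.cong refl) (simp add: dv sum_distrib_left mult.commute)
  also have "\<dots> = (\<Sum>e\<in>V. if e = n then mangoldt n else 0)"
  proof (intro sum.cong refl)
    fix e assume e: "e \<in> V"
    then have "n div e > 0" "n div e = 1 \<longleftrightarrow> e = n"
      using assms V(2)[OF e] by (auto simp: V_def dvd_div_eq_0_iff intro!: Nat.gr0I elim: dvdE)
    then show "mangoldt e * (\<Sum>d | d dvd n div e. mu_fun d) = (if e = n then mangoldt n else 0)"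
      using sum_mu_fun[of "n div e"] by auto
  qed
  also have "\<dots> = mangoldt n" using V(1) by (simp add: V_def)
  finally show ?thesis by simp
qed

text \<open>The divisor sum over n of mu(d) ln(N/d) is \<open>mangoldt n\<close>, plus ln N at n =
  1. As this weight depends on d and N alone, the left side regroups into the terms
  \<open>u d * Lsum \<xi> (N div d)\<close>, whose second factor is of order d/N when the limit is
  0.\<close>

lemma Tsum_if_Lone_zero:
  assumes m: "m > 1" and \<xi>: "\<xi> \<in> dchars m" and np: "\<xi> \<noteq> principal m"
    and L0: "Lone \<xi> = 0" and N: "N \<ge> 1"
  shows "norm (Tsum \<xi> N + of_real (ln (real N))) \<le> 2 * real m"
proof -
  define u where "u d = of_real (mu_fun d * ln (real N / real d)) * \<xi> d / of_nat d" for d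
  have inner: "(\<Sum>d | d dvd n. mu_fun d * ln (real N / real d))
      = (if n = 1 then ln (real N) else 0) + mangoldt n" if "n > 0" for n
  proof -
    have "(\<Sum>d | d dvd n. mu_fun d * ln (real N / real d))
        = (\<Sum>d | d dvd n. mu_fun d * ln (real (n div d)) + (ln (real N) - ln (real n)) * mu_fun d)"
    proof (intro sum.cong refl)
      fix d assume "d \<in> {d. d dvd n}"
      then obtain k where k: "n = d * k" by (auto elim: dvdE)
      with that have pos: "d > 0" "k > 0" by (auto intro: Nat.gr0I)
      have e1: "ln (real N / real d) = ln (real N) - ln (real d)"
        using pos N by (intro ln_divide_pos) auto
      have e2: "ln (real n) = ln (real d) + ln (real k)"
        unfolding k of_nat_mult using pos by (intro ln_mult_pos) auto
      have e3: "n div d = k" using pos k by simp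
      show "mu_fun d * ln (real N / real d)
          = mu_fun d * ln (real (n div d)) + (ln (real N) - ln (real n)) * mu_fun d"
        unfolding e1 e2 e3 by (simp add: algebra_simps)
    qed
    also have "\<dots> = mangoldt n + (ln (real N) - ln (real n)) * (if n = 1 then 1 else 0)"
      using mangoldt_eq_sum_mu_fun[OF that] sum_mu_fun[OF that]
      by (simp add: sum.distrib flip: sum_distrib_left)
    finally show ?thesis by auto
  qed
  have "(\<Sum>d=1..N. u d * Lsum \<xi> (N div d)) = (\<Sum>d=1..N. \<Sum>k=1..N div d. u d * (\<xi> k / of_nat k))"
    by (simp add: Lsum_def sum_distrib_left)
  also have "\<dots> = (\<Sum>n=1..N. \<Sum>d | d dvd n. u d * (\<xi> (n div d) / of_nat (n div d)))"
    by (rule sum_divisors_swap[symmetric])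
  also have "\<dots> = (\<Sum>n=1..N. \<xi> n * of_real (mangoldt n) / of_nat n + (if n = 1 then of_real (ln (real N)) else 0))"
  proof (intro sum.cong refl)
    fix n assume n: "n \<in> {1..N}"
    have "(\<Sum>d | d dvd n. u d * (\<xi> (n div d) / of_nat (n div d)))
        = (\<Sum>d | d dvd n. of_real (mu_fun d * ln (real N / real d)) * (\<xi> n / of_nat n))"
    proof (intro sum.cong refl)
      fix d assume "d \<in> {d. d dvd n}"
      then have "n = d * (n div d)" by simp
      then have "\<xi> n = \<xi> d * \<xi> (n div d)" "of_nat n = (of_nat d * of_nat (n div d) :: complex)"
        using dchar_mult[OF m \<xi>] by (metis, metis of_nat_mult)
      then show "u d * (\<xi> (n div d) / of_nat (n div d))
          = of_real (mu_fun d * ln (real N / real d)) * (\<xi> n / of_nat n)"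
        by (simp add: u_def)
    qed
    also have "\<dots> = of_real ((if n = 1 then ln (real N) else 0) + mangoldt n) * (\<xi> n / of_nat n)"
      using inner[of n] n by (simp only: sum_distrib_right[symmetric] of_real_sum[symmetric]) simp
    also have "\<dots> = \<xi> n * of_real (mangoldt n) / of_nat n + (if n = 1 then of_real (ln (real N)) else 0)"
      using dchar_1[OF m \<xi>] by (simp add: distrib_right mult.commute)
    finally show "(\<Sum>d | d dvd n. u d * (\<xi> (n div d) / of_nat (n div d)))
        = \<xi> n * of_real (mangoldt n) / of_nat n + (if n = 1 then of_real (ln (real N)) else 0)" .
  qed
  also have "\<dots> = Tsum \<xi> N + of_real (ln (real N))"
    using N by (simp add: Tsum_def sum.distrib)
  finally have eq: "Tsum \<xi> N + of_real (ln (real N)) = (\<Sum>d=1..N. u d * Lsum \<xi> (N div d))" ..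
  have "norm (\<Sum>d=1..N. u d * Lsum \<xi> (N div d)) \<le> (\<Sum>d=1..N. 2 * real m / real N * (ln (real N) - ln (real d)))"
  proof (rule sum_norm_le)
    fix d assume d: "d \<in> {1..N}"
    have ln: "ln (real N / real d) = ln (real N) - ln (real d)" "ln (real N) - ln (real d) \<ge> 0"
      using d N by (auto simp: ln_divide_pos)
    have "norm (u d) = \<bar>mu_fun d * ln (real N / real d)\<bar> * norm (\<xi> d) / real d"
      by (simp only: u_def norm_mult norm_divide norm_of_real norm_of_nat)
    also have "\<dots> = \<bar>mu_fun d\<bar> * (ln (real N) - ln (real d)) * norm (\<xi> d) / real d"
      unfolding ln(1) abs_mult using ln(2) by simp
    also have "\<dots> \<le> 1 * (ln (real N) - ln (real d)) * 1 / real d"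
      using abs_mu_fun_le[of d] norm_dchar_le[OF m \<xi>, of d] ln
      by (intro divide_right_mono mult_mono) auto
    finally have "norm (u d) \<le> (ln (real N) - ln (real d)) / real d" by simp
    moreover have "norm (Lsum \<xi> (N div d)) \<le> 2 * real m * real d / real N"
      using Lsum_Lone_div[OF m \<xi> np, of d N] d N L0 by simp
    ultimately have "norm (u d * Lsum \<xi> (N div d)) \<le> (ln (real N) - ln (real d)) / real d * (2 * real m * real d / real N)"
      unfolding norm_mult using ln d by (intro mult_mono) auto
    also have "\<dots> = 2 * real m / real N * (ln (real N) - ln (real d))" using d by simp
    finally show "norm (u d * Lsum \<xi> (N div d)) \<le> 2 * real m / real N * (ln (real N) - ln (real d))" .
  qed
  \<comment> \<open>The logarithmic weights add up to N ln N - ln N!, at most N, so no factor ln N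
    is lost.\<close>
  also have "\<dots> = 2 * real m / real N * (real N * ln (real N) - ln (fact N))"
  proof -
    have "ln (fact N :: real) = (\<Sum>n=1..N. ln (real n))"
      unfolding fact_prod by (subst ln_prod[symmetric]) (auto simp: of_nat_prod)
    then have "(\<Sum>d=1..N. ln (real N) - ln (real d)) = real N * ln (real N) - ln (fact N)"
      by (simp add: sum_subtractf)
    then show ?thesis by (simp only: sum_distrib_left[symmetric])
  qed
  also have "\<dots> \<le> 2 * real m / real N * real N"
    using ln_fact_ge[of N] by (intro mult_left_mono) auto
  finally show ?thesis using N unfolding eq by simp
qed

section \<open>Nonvanishing for real characters\<close>

lemma sum_divisors_coprime_mult:
  fixes x :: "nat \<Rightarrow> real"
  assumes "\<And>a b. x (a * b) = x a * x b" "coprime a b" "a > 0" "b > 0"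
  shows "(\<Sum>d | d dvd a * b. x d) = (\<Sum>d | d dvd a. x d) * (\<Sum>d | d dvd b. x d)"
proof -
  have "(\<Sum>d | d dvd a. x d) * (\<Sum>d | d dvd b. x d) = (\<Sum>(d, e)\<in>{d. d dvd a} \<times> {e. e dvd b}. x (d * e))"
    by (simp add: sum_product sum.cartesian_product assms(1))
  also have "\<dots> = (\<Sum>d | d dvd a * b. x d)"
  proof (rule sum.reindex_bij_witness[of _ "\<lambda>d. (gcd d a, gcd d b)" "\<lambda>(d, e). d * e"])
    have gcds: "gcd (d * e) a = d \<and> gcd (d * e) b = e" if de: "d dvd a" "e dvd b" for d e
    proof -
      have "coprime e a" "coprime d b"
        using de assms(2) by (meson coprime_commute coprime_divisors dvd_refl)+
      then have "gcd (d * e) a = gcd d a" "gcd (d * e) b = gcd e b"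
        by (auto intro!: gcd_mult_left_right_cancel gcd_mult_left_left_cancel simp: coprime_commute)
      moreover have "gcd d a = d" "gcd e b = e" using de by (auto intro: gcd_nat.absorb1)
      ultimately show ?thesis by simp
    qed
    show "(case z of (d, e) \<Rightarrow> d * e) \<in> {d. d dvd a * b}"
      "(gcd (case z of (d, e) \<Rightarrow> d * e) a, gcd (case z of (d, e) \<Rightarrow> d * e) b) = z"
      "x (case z of (d, e) \<Rightarrow> d * e) = (case z of (d, e) \<Rightarrow> x (d * e))"
      if "z \<in> {d. d dvd a} \<times> {e. e dvd b}" for z
      using that gcds by (auto intro: mult_dvd_mono)
    fix d assume "d \<in> {d. d dvd a * b}"
    then obtain d1 d2 where "d = d1 * d2" "d1 dvd a" "d2 dvd b" using division_decomp[of d a b] by auto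
    then show "(case (gcd d a, gcd d b) of (d, e) \<Rightarrow> d * e) = d"
      "(gcd d a, gcd d b) \<in> {d. d dvd a} \<times> {e. e dvd b}" using gcds by auto
  qed
  finally show ?thesis ..
qed

text \<open>The sum is multiplicative. At p^k it is k + 1, 1, or alternately 1 and 0, for x p equal
  to 1, 0 or -1; so it is nonnegative, and at least 1 for even k.\<close>

lemma sum_divisors_real_char:
  fixes x :: "nat \<Rightarrow> real"
  assumes mult: "\<And>a b. x (a * b) = x a * x b" and x1: "x 1 = 1" and vals: "\<And>a. x a \<in> {-1, 0, 1}"
    and n: "n > 0"
  shows "(\<Sum>d | d dvd n. x d) \<ge> 0 \<and>
    ((\<forall>p. prime p \<longrightarrow> even (multiplicity p n)) \<longrightarrow> (\<Sum>d | d dvd n. x d) \<ge> 1)"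
  using n
proof (induction n rule: less_induct)
  case (less n)
  show ?case
  proof (cases "n = 1")
    case False
    then obtain p where p: "prime p" "p dvd n" using prime_factor_nat by blast
    define k where "k = multiplicity p n"
    obtain r where r: "n = p ^ k * r" "\<not> p dvd r"
      using multiplicity_decompose'[of n p] less.prems p(1) unfolding k_def by (metis not_prime_unit less_numeral_extra(3))
    have k: "k > 0" using p r(1) less.prems not_prime_unit unfolding k_def
      by (simp add: prime_multiplicity_gt_zero_iff)
    have rp: "r > 0" using r(2) by (intro Nat.gr0I notI) simp
    have "p ^ k > 1" by (rule one_less_power[OF prime_gt_1_nat[OF p(1)] k])
    then have rn: "r < n" using r(1) rp by simp
    have cop: "coprime (p ^ k) r" using p(1) r(2) by (simp add: prime_imp_coprime)
    have xp: "x (p ^ i) = x p ^ i" for i using mult x1 by (induction i) auto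
    have "(\<Sum>d | d dvd p ^ k. x d) = (\<Sum>i\<le>k. x (p ^ i))"
    proof -
      have "{d. d dvd p ^ k} = (\<lambda>i. p ^ i) ` {..k}" using p(1) by (auto simp: divides_primepow_nat)
      moreover have "inj_on (\<lambda>i. p ^ i) {..k}"
        by (intro inj_onI) (metis p(1) power_inject_exp prime_gt_1_nat)
      ultimately show ?thesis by (simp add: sum.reindex)
    qed
    also have "\<dots> = (\<Sum>i\<le>k. x p ^ i)" by (simp add: xp)
    finally have sp: "(\<Sum>d | d dvd p ^ k. x d) = (\<Sum>i\<le>k. x p ^ i)" .
    have alt: "(\<Sum>i\<le>k. (-1) ^ i) = (if even k then 1 else 0 :: real)" for k
      by (induction k) auto
    have zer: "(\<Sum>i\<le>k. 0 ^ i) = (1 :: real)" for k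
      by (induction k) auto
    have ge: "(\<Sum>i\<le>k. x p ^ i) \<ge> (if even k then 1 else 0)"
      using vals[of p] alt[of k] zer[of k] by auto
    have prod: "(\<Sum>d | d dvd n. x d) = (\<Sum>i\<le>k. x p ^ i) * (\<Sum>d | d dvd r. x d)"
      unfolding r(1) using sum_divisors_coprime_mult[OF mult cop _ rp] p(1) sp by (simp add: prime_gt_0_nat)
    have IH: "(\<Sum>d | d dvd r. x d) \<ge> 0"
      "(\<forall>p. prime p \<longrightarrow> even (multiplicity p r)) \<Longrightarrow> (\<Sum>d | d dvd r. x d) \<ge> 1"
      using less.IH[OF rn rp] by auto
    show ?thesis
    proof (intro conjI impI)
      show "(\<Sum>d | d dvd n. x d) \<ge> 0"
        unfolding prod using ge IH(1) by (intro mult_nonneg_nonneg) (auto split: if_splits)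
      assume ev: "\<forall>q. prime q \<longrightarrow> even (multiplicity q n)"
      have "even (multiplicity q r)" if q: "prime q" for q
      proof (cases "q = p")
        case True
        then show ?thesis using r(2) by (simp add: not_dvd_imp_multiplicity_0)
      next
        case False
        have "multiplicity q n = multiplicity q (p ^ k) + multiplicity q r"
          unfolding r(1) using q rp p(1) by (intro prime_elem_multiplicity_mult_distrib) auto
        moreover have "multiplicity q (p ^ k) = 0"
          using False p(1) q by (simp add: multiplicity_distinct_prime_power)
        moreover have "even (multiplicity q n)" using ev q by blast
        ultimately show ?thesis by simp
      qed
      then have "(\<Sum>d | d dvd r. x d) \<ge> 1" by (intro IH(2)) auto
      moreover have "(\<Sum>i\<le>k. x p ^ i) \<ge> 1" using ge ev p(1) by (simp add: k_def)
      ultimately have "1 * 1 \<le> (\<Sum>i\<le>k. x p ^ i) * (\<Sum>d | d dvd r. x d)" by (intro mult_mono) auto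
      then show "(\<Sum>d | d dvd n. x d) \<ge> 1" unfolding prod by simp
    qed
  qed (use x1 in auto)
qed

text \<open>By the inequality of arithmetic and geometric means, applied to \<open>t\<^sup>i\<close> and \<open>t\<^sup>n\<^sup>-\<^sup>1\<^sup>-\<^sup>i\<close>.\<close>

lemma geometric_sum_ge:
  assumes "s \<ge> (0::real)"
  shows "real n * s ^ (n - 1) \<le> (\<Sum>i<n. (s ^ 2) ^ i)"
proof -
  have "2 * (\<Sum>i<n. (s ^ 2) ^ i) = (\<Sum>i<n. (s ^ 2) ^ i) + (\<Sum>i<n. (s ^ 2) ^ (n - Suc i))"
    by (simp add: sum.nat_diff_reindex)
  also have "\<dots> = (\<Sum>i<n. (s ^ 2) ^ i + (s ^ 2) ^ (n - Suc i))" by (simp add: sum.distrib)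
  also have "\<dots> \<ge> (\<Sum>i<n. 2 * s ^ (n - 1))"
  proof (rule sum_mono)
    fix i assume "i \<in> {..<n}"
    then have "n - 1 = i + (n - Suc i)" by auto
    then have "s ^ (n - 1) = s ^ i * s ^ (n - Suc i)" by (metis power_add)
    moreover have "0 \<le> (s ^ i - s ^ (n - Suc i)) ^ 2" by simp
    moreover have "(s ^ 2) ^ k = (s ^ k) ^ 2" for k by (metis power_mult mult.commute)
    ultimately show "2 * s ^ (n - 1) \<le> (s ^ 2) ^ i + (s ^ 2) ^ (n - Suc i)"
      unfolding power2_diff by simp
  qed
  finally show ?thesis by simp
qed

text \<open>The Lambert weight t^n / (1 - t^n) behaves like 1 / (n (1 - t)) near t = 1; this is the
  difference.\<close>

definition monsky :: "real \<Rightarrow> nat \<Rightarrow> real" where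
  "monsky t n = 1 / (real n * (1 - t)) - t ^ n / (1 - t ^ n)"

text \<open>With G n = 1 + ... + t^(n-1), monotonicity amounts to n (n + 1) t^n \<le> G n * G (n +
  1). For s = sqrt t, \<open>geometric_sum_ge\<close> bounds the right side below by n (n + 1) s^(2
  n - 1).\<close>

lemma monsky_decreasing:
  assumes t: "0 < t" "t < 1" and n: "n \<ge> 1"
  shows "monsky t (Suc n) \<le> monsky t n" "monsky t n \<ge> 0"
proof -
  define G where "G k = (\<Sum>i<k. t ^ i)" for k
  define s where "s = sqrt t"
  have s: "s \<ge> 0" "s \<le> 1" "s ^ 2 = t" using t by (auto simp: s_def)
  have Gge: "real k * s ^ (k - 1) \<le> G k" for k
    using geometric_sum_ge[OF s(1), of k] by (simp add: G_def s(3))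
  have G: "1 - t ^ k = (1 - t) * G k" for k unfolding G_def by (rule one_diff_power_eq)
  have Gpos: "G k > 0" if "k \<ge> 1" for k
  proof -
    have "t ^ k < 1" using t that by (intro power_less_one_iff[THEN iffD2] conjI) auto
    then have "0 < (1 - t) * G k" unfolding G[symmetric] by simp
    then show ?thesis using t by (simp add: zero_less_mult_iff)
  qed
  have mk: "monsky t k = (1 / real k - t ^ k / G k) / (1 - t)" if "k \<ge> 1" for k
    unfolding monsky_def G by (simp add: diff_divide_distrib mult.commute)
  have "real n * t ^ n \<le> G n"
  proof -
    have "s ^ (2 * n) \<le> s ^ (n - 1)" using s by (intro power_decreasing) auto
    then have "real n * t ^ n \<le> real n * s ^ (n - 1)"
      by (intro mult_left_mono) (auto simp: power_mult s(3))
    then show ?thesis using Gge[of n] by simp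
  qed
  then have "t ^ n / G n \<le> 1 / real n" using Gpos[OF n] n by (simp add: field_simps)
  then show "monsky t n \<ge> 0" unfolding mk[OF n] using t by simp
  have "real n * real (Suc n) * t ^ n \<le> G n * G (Suc n)"
  proof -
    have "real n * real (Suc n) * t ^ n = real n * real (Suc n) * s ^ (2 * n)" by (simp add: power_mult s(3))
    also have "\<dots> \<le> real n * real (Suc n) * s ^ ((n - 1) + n)"
      using s by (intro mult_left_mono power_decreasing) auto
    also have "\<dots> = (real n * s ^ (n - 1)) * (real (Suc n) * s ^ (Suc n - 1))" by (simp add: power_add)
    also have "\<dots> \<le> G n * G (Suc n)"
      using s Gge[of n] Gge[of "Suc n"] Gpos[OF n] by (intro mult_mono) (auto intro!: mult_nonneg_nonneg)
    finally show ?thesis .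
  qed
  then have "t ^ n / (G n * G (Suc n)) \<le> 1 / (real n * real (Suc n))"
    using Gpos[OF n] Gpos[of "Suc n"] n by (simp add: divide_simps mult_ac del: of_nat_Suc)
  also have "\<dots> = 1 / real n - 1 / real (Suc n)" using n by (simp add: field_simps)
  also have "t ^ n / (G n * G (Suc n)) = t ^ n / G n - t ^ Suc n / G (Suc n)"
  proof -
    have "G (Suc n) = 1 + t * G n"
      unfolding G_def by (subst sum.lessThan_Suc_shift) (simp add: sum_distrib_left)
    then have "t ^ n * G (Suc n) - t ^ Suc n * G n = t ^ n" by (simp add: algebra_simps)
    then show ?thesis using Gpos[OF n] Gpos[of "Suc n"] by (simp add: diff_frac_eq)
  qed
  finally have "1 / real (Suc n) - t ^ Suc n / G (Suc n) \<le> 1 / real n - t ^ n / G n" by simp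
  then show "monsky t (Suc n) \<le> monsky t n"
    unfolding mk[OF n] using mk[of "Suc n"] t by (simp add: divide_right_mono)
qed

text \<open>Monsky's argument: the Lambert series \<open>\<Sum> \<xi>(n) t\<^sup>n / (1 - t\<^sup>n)\<close> has nonnegative power series
  coefficients that are at least one at squares, so it is unbounded as \<open>t \<rightarrow> 1\<close>; subtracting the
  vanishing \<open>L(1, \<xi>) / (1 - t)\<close> turns its weights into a monotone sequence bounded by one.\<close>

lemma Lone_nonzero_if_real:
  assumes m: "m > 1" and \<xi>: "\<xi> \<in> dchars m" and np: "\<xi> \<noteq> principal m"
    and real: "\<And>n. cnj (\<xi> n) = \<xi> n"
  shows "Lone \<xi> \<noteq> 0"
proof
  assume L0: "Lone \<xi> = 0"
  define x where "x n = Re (\<xi> n)" for n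
  have \<xi>x: "\<xi> n = of_real (x n)" for n
    using real[of n] unfolding x_def by (auto simp: complex_eq_iff)
  have xm: "x (a * b) = x a * x b" for a b
    using dchar_mult[OF m \<xi>, of a b] unfolding \<xi>x by (simp flip: of_real_mult)
  have x1: "x 1 = 1" using dchar_1[OF m \<xi>] by (simp add: x_def)
  have xv: "x a \<in> {-1, 0, 1}" for a
    using norm_dchar[OF m \<xi>, of a] dchar_eq_0[OF m \<xi>, of a] unfolding \<xi>x
    by (cases "coprime a m") (auto simp: abs_if split: if_splits)
  define f where "f n = (\<Sum>d | d dvd n. x d)" for n
  have f0: "f n \<ge> 0" if "n > 0" for n
    using sum_divisors_real_char[of x n] xm x1 xv that unfolding f_def by blast
  have f1: "f (k ^ 2) \<ge> 1" if "k > 0" for k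
    using sum_divisors_real_char[of x "k ^ 2"] xm x1 xv that unfolding f_def
    by (simp add: prime_elem_multiplicity_power_distrib)
  have fin: "(\<Sum>k=1..M. t ^ (k ^ 2)) \<le> 2 * real m + (2 * real m / real (Suc N) + real N * t ^ N) / (1 - t)"
    if t: "0 < t" "t < 1" and N: "M ^ 2 \<le> N" for t M N
  proof -
    have "(\<Sum>k=1..M. t ^ (k ^ 2)) = (\<Sum>n\<in>(\<lambda>k. k ^ 2) ` {1..M}. t ^ n)"
      by (subst sum.reindex) (auto intro!: inj_onI)
    also have "\<dots> \<le> (\<Sum>n\<in>(\<lambda>k. k ^ 2) ` {1..M}. f n * t ^ n)"
      using f1 t by (intro sum_mono) auto
    also have "\<dots> \<le> (\<Sum>n=1..N. f n * t ^ n)"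
    proof (rule sum_mono2)
      have "k ^ 2 \<le> N" if "k \<le> M" for k
        using order_trans[OF power_mono[OF that le0] N] .
      then show "(\<lambda>k. k ^ 2) ` {1..M} \<subseteq> {1..N}" by (auto simp: Suc_le_eq)
    qed (use f0 t in auto)
    also have "\<dots> = (\<Sum>n=1..N. \<Sum>d | d dvd n. x d * t ^ (d * (n div d)))"
      by (simp add: f_def sum_distrib_right)
    also have "\<dots> = (\<Sum>d=1..N. \<Sum>k=1..N div d. x d * t ^ (d * k))"
      by (rule sum_divisors_swap)
    \<comment> \<open>Each inner geometric series is completed; its missing tail begins at an
      exponent above N, and N such errors still vanish as N grows.\<close>
    also have "\<dots> \<le> (\<Sum>d=1..N. x d * (t ^ d / (1 - t ^ d)) + t ^ N / (1 - t))"
    proof (rule sum_mono)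
      fix d assume d: "d \<in> {1..N}"
      have td: "t ^ d < 1" "t ^ d \<le> t" using t d power_decreasing[of 1 d t]
        by (auto intro!: power_less_one_iff[THEN iffD2])
      have "(1 - c) * (\<Sum>k=1..K. c ^ k) = c - c ^ Suc K" for c :: real and K
        using sum_gp_multiplied[of 1 K c] by (cases "K = 0") simp_all
      from this[of "t ^ d"]
      have "(\<Sum>k=1..K. t ^ (d * k)) = (t ^ d - t ^ (d * Suc K)) / (1 - t ^ d)" for K
        using td(1) by (simp only: power_mult) (simp add: eq_divide_eq mult.commute)
      from this[of "N div d"]
      have e: "(\<Sum>k=1..N div d. x d * t ^ (d * k)) = x d * (t ^ d / (1 - t ^ d)) - x d * (t ^ (d * Suc (N div d)) / (1 - t ^ d))"
        by (simp add: sum_distrib_left[symmetric] diff_divide_distrib right_diff_distrib)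
      have b: "- (x d * (t ^ (d * Suc (N div d)) / (1 - t ^ d))) \<le> 1 * (t ^ N / (1 - t))"
      proof -
        have "N < d * Suc (N div d)"
          using d by (metis atLeastAtMost_iff dividend_less_times_div mult_Suc_right not_one_le_zero not_gr_zero)
        then have "t ^ (d * Suc (N div d)) \<le> t ^ N" using t by (intro power_decreasing) auto
        then have "t ^ (d * Suc (N div d)) / (1 - t ^ d) \<le> t ^ N / (1 - t)"
          using t td by (intro frac_le) auto
        moreover have "- x d \<le> 1" using xv[of d] by auto
        moreover have "0 \<le> t ^ (d * Suc (N div d)) / (1 - t ^ d)" using t td by simp
        ultimately have "(- x d) * (t ^ (d * Suc (N div d)) / (1 - t ^ d)) \<le> 1 * (t ^ N / (1 - t))"
          by (intro mult_mono) auto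
        then show ?thesis by simp
      qed
      show "(\<Sum>k=1..N div d. x d * t ^ (d * k)) \<le> x d * (t ^ d / (1 - t ^ d)) + t ^ N / (1 - t)"
        unfolding e using b by linarith
    qed
    also have "\<dots> = (\<Sum>d=1..N. x d * (t ^ d / (1 - t ^ d))) + real N * t ^ N / (1 - t)"
      by (simp add: sum.distrib)
    \<comment> \<open>Trading the Lambert weights for 1 / (d (1 - t)) exposes a partial sum of L(1),
      which is of order 1/N by assumption.\<close>
    also have "(\<Sum>d=1..N. x d * (t ^ d / (1 - t ^ d)))
        = (\<Sum>d=1..N. x d / real d) / (1 - t) - (\<Sum>d=1..N. x d * monsky t d)"
      by (simp add: monsky_def sum_divide_distrib algebra_simps flip: sum_subtractf)
    also have "\<dots> \<le> 2 * real m / real (Suc N) / (1 - t) + 2 * real m"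
    proof -
      have "Lsum \<xi> N = of_real (\<Sum>d=1..N. x d / real d)" by (simp add: Lsum_def \<xi>x)
      then have "\<bar>\<Sum>d=1..N. x d / real d\<bar> \<le> 2 * real m / real (Suc N)"
        using Lsum_Lone[OF m \<xi> np, of N] L0 by (metis diff_zero norm_of_real)
      then have "(\<Sum>d=1..N. x d / real d) / (1 - t) \<le> 2 * real m / real (Suc N) / (1 - t)"
        using t by (intro divide_right_mono) auto
      moreover have "norm (\<Sum>d=1..N. \<xi> d * of_real (monsky t d)) \<le> 2 * real m * monsky t 1"
        using monsky_decreasing[OF t]
        by (intro norm_sum_antimono_weight_le norm_sum_dchar_interval[OF m \<xi> np]) auto
      then have "\<bar>\<Sum>d=1..N. x d * monsky t d\<bar> \<le> 2 * real m * monsky t 1"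
        unfolding \<xi>x of_real_mult[symmetric] of_real_sum[symmetric] norm_of_real .
      moreover have "monsky t 1 = 1" using t by (simp add: monsky_def flip: diff_divide_distrib)
      ultimately show ?thesis by simp
    qed
    finally show ?thesis by (simp add: add_divide_distrib)
  qed
  have fin': "(\<Sum>k=1..M. t ^ (k ^ 2)) \<le> 2 * real m" if t: "0 < t" "t < 1" for t M
  proof -
    have "(\<lambda>N. real N * t ^ N) \<longlonglongrightarrow> 0" using t by (intro powser_times_n_limit_0) auto
    moreover have "(\<lambda>N. 2 * real m / real (Suc N)) \<longlonglongrightarrow> 0"
      using tendsto_mult_right_zero[OF LIMSEQ_inverse_real_of_nat, of "2 * real m"]
      by (simp add: divide_inverse)
    ultimately have "(\<lambda>N. 2 * real m + (2 * real m / real (Suc N) + real N * t ^ N) / (1 - t))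
        \<longlonglongrightarrow> 2 * real m + (0 + 0) / (1 - t)"
      using t by (intro tendsto_intros) auto
    moreover have "eventually (\<lambda>N. (\<Sum>k=1..M. t ^ (k ^ 2)) \<le> 2 * real m + (2 * real m / real (Suc N) + real N * t ^ N) / (1 - t)) sequentially"
      using eventually_ge_at_top[of "M ^ 2"] by eventually_elim (rule fin[OF t])
    ultimately have "(\<Sum>k=1..M. t ^ (k ^ 2)) \<le> 2 * real m + (0 + 0) / (1 - t)"
      by (rule tendsto_lowerbound) simp
    then show ?thesis by simp
  qed
  \<comment> \<open>As t tends to 1 the sum over squares tends to M, so one term more than 2 m is
    enough.\<close>
  define M where "M = 2 * m + 1"
  have "((\<lambda>t. \<Sum>k=1..M. t ^ (k ^ 2)) \<longlongrightarrow> (\<Sum>k=1..M. 1 ^ (k ^ 2))) (at_left (1::real))"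
    by (intro tendsto_intros)
  moreover have "eventually (\<lambda>t. (\<Sum>k=1..M. t ^ (k ^ 2)) \<le> 2 * real m) (at_left (1::real))"
    unfolding eventually_at_left_field using fin' by (intro exI[of _ 0]) auto
  ultimately have "(\<Sum>k=1..M. 1 ^ (k ^ 2)) \<le> 2 * real m"
    by (rule tendsto_upperbound) simp
  then show False by (simp add: M_def)
qed

section \<open>Primes in arithmetic progressions\<close>

lemma Lone_cnj:
  assumes "m > 1" "\<xi> \<in> dchars m" "\<xi> \<noteq> principal m"
  shows "Lone (\<lambda>n. cnj (\<xi> n)) = cnj (Lone \<xi>)" "(\<lambda>n. cnj (\<xi> n)) \<noteq> principal m"
proof -
  show np: "(\<lambda>n. cnj (\<xi> n)) \<noteq> principal m"
  proof
    assume *: "(\<lambda>n. cnj (\<xi> n)) = principal m"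
    have "\<xi> n = principal m n" for n
      using fun_cong[OF *, of n] by (auto simp: principal_def complex_eq_iff split: if_splits)
    with assms(3) show False by auto
  qed
  have "Lsum (\<lambda>n. cnj (\<xi> n)) = (\<lambda>N. cnj (Lsum \<xi> N))" by (auto simp: Lsum_def)
  then have "Lsum (\<lambda>n. cnj (\<xi> n)) \<longlonglongrightarrow> cnj (Lone \<xi>)"
    using tendsto_cnj[OF Lsum_tendsto[OF assms]] by simp
  then show "Lone (\<lambda>n. cnj (\<xi> n)) = cnj (Lone \<xi>)"
    using Lsum_tendsto[OF assms(1) cnj_dchar[OF assms(1,2)] np] LIMSEQ_unique by blast
qed

lemma Re_Tsum_le:
  assumes "m > 1" "\<xi> \<in> dchars m" "\<xi> \<noteq> principal m"
  obtains C where "\<And>N. N \<ge> 1 \<Longrightarrow> Re (Tsum \<xi> N) \<le> C - (if Lone \<xi> = 0 then ln (real N) else 0)"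
proof (cases "Lone \<xi> = 0")
  case True
  have "Re (Tsum \<xi> N) \<le> 2 * real m - ln (real N)" if "N \<ge> 1" for N
    using Tsum_if_Lone_zero[OF assms True that] complex_Re_le_cmod[of "Tsum \<xi> N + of_real (ln (real N))"]
    by simp
  with True show ?thesis by (intro that) auto
next
  case False
  then obtain C where "\<And>N. N \<ge> 1 \<Longrightarrow> norm (Tsum \<xi> N) \<le> C"
    using Tsum_bounded_if_Lone_nonzero[OF assms] by blast
  with False show ?thesis
    by (intro that[of C]) (auto intro: order_trans[OF complex_Re_le_cmod])
qed

lemma Re_Tsum_principal_le: "N \<ge> 1 \<Longrightarrow> Re (Tsum (principal m) N) \<le> ln (real N) + 6"
proof -
  assume N: "N \<ge> 1"
  have "Re (Tsum (principal m) N) = (\<Sum>n=1..N. Re (principal m n * of_real (mangoldt n) / of_nat n))"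
    by (simp add: Tsum_def)
  also have "\<dots> \<le> (\<Sum>n=1..N. mangoldt n / real n)"
    by (intro sum_mono) (auto simp: principal_def mangoldt_nonneg)
  also have "\<dots> \<le> ln (real N) + 6" using N by (intro mertens_upper) auto
  finally show ?thesis .
qed

text \<open>If \<open>L(1, \<xi>)\<close> vanished for a nonreal \<open>\<xi>\<close>, it would also vanish for the conjugate character;
  then the sum of \<open>\<Lambda>(n)/n\<close> over \<open>n \<equiv> 1\<close> would tend to \<open>-\<infinity>\<close>.\<close>

lemma Lone_nonzero:
  assumes m: "m > 1" and \<xi>: "\<xi> \<in> dchars m" and np: "\<xi> \<noteq> principal m"
  shows "Lone \<xi> \<noteq> 0"
proof
  assume L0: "Lone \<xi> = 0"
  define Z where "Z = {\<psi> \<in> dchars m - {principal m}. Lone \<psi> = 0}"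
  define \<xi>' where "\<xi>' = (\<lambda>n. cnj (\<xi> n))"
  have "\<exists>n. cnj (\<xi> n) \<noteq> \<xi> n" using Lone_nonzero_if_real[OF m \<xi> np] L0 by blast
  then have ne: "\<xi>' \<noteq> \<xi>" unfolding \<xi>'_def by metis
  have "\<xi>' \<in> Z"
    using Lone_cnj[OF m \<xi> np] cnj_dchar[OF m \<xi>] L0 unfolding Z_def \<xi>'_def by simp
  moreover have "\<xi> \<in> Z" using \<xi> np L0 by (simp add: Z_def)
  ultimately have "{\<xi>, \<xi>'} \<subseteq> Z" by simp
  have finD: "finite (dchars m)" by (rule finite_dchars[OF m])
  have finZ: "finite Z" using finD by (simp add: Z_def)
  \<comment> \<open>The principal character contributes one ln N and each member of Z takes one
    away; two of them outweigh it.\<close>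
  have card: "card Z \<ge> 2"
    using card_mono[OF finZ \<open>{\<xi>, \<xi>'} \<subseteq> Z\<close>] ne by simp
  have "\<exists>C. \<forall>N\<ge>1. Re (Tsum \<psi> N) \<le> C - (if Lone \<psi> = 0 then ln (real N) else 0)"
    if "\<psi> \<in> dchars m - {principal m}" for \<psi>
    using Re_Tsum_le[OF m, of \<psi>] that by (metis DiffD1 DiffD2 singletonI)
  then obtain C where C: "\<And>\<psi> N. \<psi> \<in> dchars m - {principal m} \<Longrightarrow> N \<ge> 1 \<Longrightarrow>
      Re (Tsum \<psi> N) \<le> C \<psi> - (if Lone \<psi> = 0 then ln (real N) else 0)" by metis
  define K where "K = 6 + (\<Sum>\<psi>\<in>dchars m - {principal m}. C \<psi>)"
  have le: "ln (real N) \<le> K" if N: "N \<ge> 1" for N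
  proof -
    \<comment> \<open>Summed over all characters only the n congruent to 1 remain, with nonnegative
      weights.\<close>
    have "(\<Sum>\<psi>\<in>dchars m. Tsum \<psi> N) = (\<Sum>n=1..N. (\<Sum>\<psi>\<in>dchars m. \<psi> n) * of_real (mangoldt n) / of_nat n)"
      unfolding Tsum_def by (subst sum.swap) (simp add: sum_distrib_right sum_divide_distrib)
    also have "Re \<dots> = (\<Sum>n=1..N. (if [n = 1] (mod m) then real (card (dchars m)) else 0) * mangoldt n / real n)"
      by (simp add: sum_dchars[OF m] Re_sum if_distrib[of Re] if_distrib[of "\<lambda>x. x * _"] cong: if_cong)
    also have "\<dots> \<ge> 0" by (intro sum_nonneg) (auto intro!: divide_nonneg_nonneg mult_nonneg_nonneg mangoldt_nonneg)
    finally have "0 \<le> (\<Sum>\<psi>\<in>dchars m. Re (Tsum \<psi> N))" by simp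
    also have "\<dots> = Re (Tsum (principal m) N) + (\<Sum>\<psi>\<in>dchars m - {principal m}. Re (Tsum \<psi> N))"
      using finD principal_dchar[OF m] by (rule sum.remove)
    also have "\<dots> \<le> (ln (real N) + 6) + (\<Sum>\<psi>\<in>dchars m - {principal m}. C \<psi> - (if Lone \<psi> = 0 then ln (real N) else 0))"
      using C N by (intro add_mono Re_Tsum_principal_le sum_mono) auto
    also have "(\<Sum>\<psi>\<in>dchars m - {principal m}. C \<psi> - (if Lone \<psi> = 0 then ln (real N) else 0))
        = (\<Sum>\<psi>\<in>dchars m - {principal m}. C \<psi>) - real (card Z) * ln (real N)"
    proof -
      have "(\<Sum>\<psi>\<in>dchars m - {principal m}. if Lone \<psi> = 0 then ln (real N) else 0) = (\<Sum>\<psi>\<in>Z. ln (real N))"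
        unfolding Z_def using finD by (intro sum.inter_filter[symmetric]) simp
      then show ?thesis by (simp add: sum_subtractf)
    qed
    finally have "real (card Z) * ln (real N) \<le> ln (real N) + K" by (simp add: K_def)
    moreover have "2 * ln (real N) \<le> real (card Z) * ln (real N)"
      using card N by (intro mult_right_mono) auto
    ultimately show ?thesis by simp
  qed
  define N where "N = nat \<lceil>exp (K + 1)\<rceil>"
  have "exp (K + 1) \<le> real N" unfolding N_def by (rule real_nat_ceiling_ge)
  moreover have "exp (K + 1) > 0" by simp
  ultimately have "real N > 0" by linarith
  with \<open>exp (K + 1) \<le> real N\<close> have "N \<ge> 1" "K + 1 \<le> ln (real N)" by (simp_all add: ln_ge_iff)
  with le[of N] show False by simp
qed

text \<open>For q = 1/p \<le> 1/2 the powers of q from the square on add up to at most 2 q^2, and ln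
  p \<le> 2 sqrt p; so the proper powers of p contribute at most 4 p^(-3/2).\<close>

lemma sum_mangoldt_nonprime_bounded:
  obtains c where "\<And>N. (\<Sum>n | n \<in> {1..N} \<and> \<not> prime n. mangoldt n / real n) \<le> c"
proof -
  define g where "g p = 4 * real p powr (-3/2)" for p :: nat
  have sg: "summable g" unfolding g_def by (intro summable_mult) (simp add: summable_real_powr_iff)
  have "(\<Sum>n | n \<in> {1..N} \<and> \<not> prime n. mangoldt n / real n) \<le> suminf g" for N
  proof -
    define I where "I = {p. prime p \<and> p \<le> N} \<times> {2..N}"
    have "(\<Sum>n | n \<in> {1..N} \<and> \<not> prime n. mangoldt n / real n)
        = (\<Sum>n | n \<in> {1..N} \<and> \<not> prime n \<and> primepow n. mangoldt n / real n)"
      by (intro sum.mono_neutral_right) (auto simp: mangoldt_def)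
    also have "\<dots> \<le> (\<Sum>n\<in>(\<lambda>(p, k). p ^ k) ` I. mangoldt n / real n)"
    proof (rule sum_mono2)
      show "{n. n \<in> {1..N} \<and> \<not> prime n \<and> primepow n} \<subseteq> (\<lambda>(p, k). p ^ k) ` I"
      proof
        fix n assume "n \<in> {n. n \<in> {1..N} \<and> \<not> prime n \<and> primepow n}"
        then have n: "n \<le> N" "\<not> prime n" "primepow n" by auto
        from n(3) obtain p k where pk: "prime p" "k > 0" "n = p ^ k" unfolding primepow_def by blast
        then have "k \<noteq> 1" using n(2) by auto
        moreover have "k < p ^ k" using prime_gt_1_nat[OF pk(1)] by (intro power_gt_expt) auto
        moreover have "p \<le> p ^ k" using prime_ge_1_nat[OF pk(1)] pk(2) by (rule self_le_power)
        ultimately show "n \<in> (\<lambda>(p, k). p ^ k) ` I"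
          using pk n(1) unfolding I_def by (intro image_eqI[of _ _ "(p, k)"]) auto
      qed
    qed (auto simp: I_def mangoldt_nonneg)
    also have "\<dots> \<le> (\<Sum>(p, k)\<in>I. mangoldt (p ^ k) / real (p ^ k))"
      using sum_image_le[of I "\<lambda>n. mangoldt n / real n" "\<lambda>(p, k). p ^ k"]
      by (simp add: I_def mangoldt_nonneg case_prod_unfold)
    also have "\<dots> = (\<Sum>p | prime p \<and> p \<le> N. \<Sum>k=2..N. mangoldt (p ^ k) / real (p ^ k))"
      unfolding I_def by (rule sum.cartesian_product[symmetric])
    also have "\<dots> \<le> (\<Sum>p | prime p \<and> p \<le> N. g p)"
    proof (rule sum_mono)
      fix p assume "p \<in> {p. prime p \<and> p \<le> N}"
      then have p: "prime p" "real p \<ge> 2" using prime_ge_2_nat by auto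
      define q where "q = 1 / real p"
      have q: "0 < q" "q \<le> 1 / 2" using p by (auto simp: q_def field_simps)
      have "(\<Sum>k=2..N. mangoldt (p ^ k) / real (p ^ k)) = ln (real p) * (\<Sum>k=2..N. q ^ k)"
        using p by (simp add: sum_distrib_left q_def power_divide)
      also have "\<dots> \<le> ln (real p) * (2 * q ^ 2)"
      proof (rule mult_left_mono)
        have "(1 - q) * (\<Sum>k=2..N. q ^ k) \<le> q ^ 2"
          using sum_gp_multiplied[of 2 N q] q by (cases "2 \<le> N") auto
        moreover have "(1 / 2) * (\<Sum>k=2..N. q ^ k) \<le> (1 - q) * (\<Sum>k=2..N. q ^ k)"
          using q by (intro mult_right_mono sum_nonneg) auto
        ultimately show "(\<Sum>k=2..N. q ^ k) \<le> 2 * q ^ 2" by simp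
      qed (use p in auto)
      also have "\<dots> \<le> (2 * real p powr (1/2)) * (2 * q ^ 2)"
      proof (rule mult_right_mono)
        have "ln (real p) = 2 * ln (real p powr (1/2))" using p by (simp add: ln_powr)
        also have "\<dots> \<le> 2 * real p powr (1/2)" using p by (intro mult_left_mono ln_bound) auto
        finally show "ln (real p) \<le> 2 * real p powr (1/2)" .
      qed simp
      also have "\<dots> = g p"
      proof -
        have "real p powr (-3/2) = real p powr (1/2 + (-2))" by simp
        also have "\<dots> = real p powr (1/2) * real p powr (-2)" by (rule powr_add)
        also have "real p powr (-2) = q ^ 2" using p by (simp add: powr_minus q_def power_divide inverse_eq_divide)
        finally show ?thesis by (simp add: g_def)
      qed
      finally show "(\<Sum>k=2..N. mangoldt (p ^ k) / real (p ^ k)) \<le> g p" .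
    qed
    also have "\<dots> \<le> suminf g" by (rule sum_le_suminf[OF sg]) (auto simp: g_def)
    finally show ?thesis .
  qed
  then show ?thesis by (rule that)
qed

lemma sum_union_le:
  fixes f :: "nat \<Rightarrow> real"
  assumes "finite A" "finite B" "\<And>n. f n \<ge> 0"
  shows "sum f (A \<union> B) \<le> sum f A + sum f B"
  using sum.union_inter[OF assms(1,2), of f] sum_nonneg[of "A \<inter> B" f] assms(3) by simp

text \<open>Orthogonality writes h times the sum of \<open>mangoldt n / n\<close> over the class of
  a as a combination of the \<open>Tsum\<close>. Only the principal one is unbounded, growing like
  ln N; hence c = 1/h, with h the number of characters.\<close>

lemma sum_ln_primes_progression_ge:
  assumes m: "m > 1" and a: "coprime a m"
  obtains c C where "c > 0"
    "\<And>N. N \<ge> 1 \<Longrightarrow> c * ln (real N) - C \<le> (\<Sum>p | p \<in> {1..N} \<and> prime p \<and> [p = a] (mod m). ln (real p) / real p)"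
proof -
  define h where "h = real (card (dchars m))"
  have finD: "finite (dchars m)" by (rule finite_dchars[OF m])
  have h: "h > 0" using finD principal_dchar[OF m] unfolding h_def by (auto simp: card_gt_0_iff)
  obtain c0 where c0: "\<And>N. (\<Sum>n | n \<in> {1..N} \<and> \<not> prime n. mangoldt n / real n) \<le> c0"
    using sum_mangoldt_nonprime_bounded by blast
  have "\<exists>C. \<forall>N\<ge>1. norm (Tsum \<psi> N) \<le> C" if "\<psi> \<in> dchars m - {principal m}" for \<psi>
    using Tsum_bounded_if_Lone_nonzero[OF m, of \<psi>] Lone_nonzero[OF m, of \<psi>] that
    by (metis DiffD1 DiffD2 singletonI)
  then obtain B where B: "\<And>\<psi> N. \<psi> \<in> dchars m - {principal m} \<Longrightarrow> N \<ge> 1 \<Longrightarrow> norm (Tsum \<psi> N) \<le> B \<psi>"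
    by metis
  define B' where "B' = (\<Sum>\<psi>\<in>dchars m - {principal m}. B \<psi>)"
  define E where "E = (\<Sum>p\<in>prime_factors m. ln (real p) / real p)"
  define f where "f n = mangoldt n / real n" for n :: nat
  have f0: "f n \<ge> 0" for n by (simp add: f_def mangoldt_nonneg)
  have main: "ln (real N) - 1 - c0 - E - B' \<le> h * ((\<Sum>p | p \<in> {1..N} \<and> prime p \<and> [p = a] (mod m). ln (real p) / real p) + c0)"
    if N: "N \<ge> 1" for N
  proof -
    have "ln (real N) - 1 \<le> (\<Sum>n=1..N. f n)" unfolding f_def using N by (intro mertens_lower) auto
    also have "\<dots> \<le> (\<Sum>n | n \<in> {1..N} \<and> coprime n m. f n) + ((\<Sum>n | n \<in> {1..N} \<and> \<not> prime n. f n) + (\<Sum>p\<in>prime_factors m. f p))"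
    proof -
      have "(\<Sum>n=1..N. f n) \<le> (\<Sum>n\<in>{n. n \<in> {1..N} \<and> coprime n m} \<union> ({n. n \<in> {1..N} \<and> \<not> prime n} \<union> prime_factors m). f n)"
      proof (rule sum_mono2)
        \<comment> \<open>A number not coprime to m is either not prime or a prime factor of m; both
          kinds contribute boundedly.\<close>
        show "{1..N} \<subseteq> {n. n \<in> {1..N} \<and> coprime n m} \<union> ({n. n \<in> {1..N} \<and> \<not> prime n} \<union> prime_factors m)"
          using m by (auto simp: prime_factors_dvd dest: prime_imp_coprime)
      qed (use f0 in auto)
      also have "\<dots> \<le> (\<Sum>n | n \<in> {1..N} \<and> coprime n m. f n) + (\<Sum>n\<in>{n. n \<in> {1..N} \<and> \<not> prime n} \<union> prime_factors m. f n)"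
        using f0 by (intro sum_union_le) auto
      also have "(\<Sum>n\<in>{n. n \<in> {1..N} \<and> \<not> prime n} \<union> prime_factors m. f n) \<le> (\<Sum>n | n \<in> {1..N} \<and> \<not> prime n. f n) + (\<Sum>p\<in>prime_factors m. f p)"
        using f0 by (intro sum_union_le) auto
      finally show ?thesis by simp
    qed
    also have "(\<Sum>p\<in>prime_factors m. f p) = E"
      unfolding E_def by (intro sum.cong) (auto simp: f_def mangoldt_prime in_prime_factors_iff)
    also have "(\<Sum>n | n \<in> {1..N} \<and> \<not> prime n. f n) \<le> c0" unfolding f_def by (rule c0)
    finally have 1: "ln (real N) - 1 - c0 - E \<le> (\<Sum>n | n \<in> {1..N} \<and> coprime n m. f n)" by simp
    have P: "Re (Tsum (principal m) N) = (\<Sum>n | n \<in> {1..N} \<and> coprime n m. f n)"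
    proof -
      have "Re (Tsum (principal m) N) = (\<Sum>n=1..N. if coprime n m then f n else 0)"
        unfolding Tsum_def Re_sum by (intro sum.cong) (auto simp: principal_def f_def)
      also have "\<dots> = (\<Sum>n | n \<in> {1..N} \<and> coprime n m. f n)"
        by (rule sum.inter_filter[symmetric]) simp
      finally show ?thesis .
    qed
    have "(\<Sum>\<psi>\<in>dchars m. cnj (\<psi> a) * Tsum \<psi> N)
        = (\<Sum>n=1..N. (\<Sum>\<psi>\<in>dchars m. cnj (\<psi> a) * \<psi> n) * of_real (f n))"
      unfolding Tsum_def f_def sum_distrib_left by (subst sum.swap) (simp add: sum_distrib_right sum_divide_distrib mult.assoc)
    also have "\<dots> = of_real (\<Sum>n=1..N. if [n = a] (mod m) then h * f n else 0)"
      unfolding dchars_orthogonality[OF m a] h_def of_real_sum by (intro sum.cong) auto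
    also have "(\<Sum>n=1..N. if [n = a] (mod m) then h * f n else 0) = h * (\<Sum>n | n \<in> {1..N} \<and> [n = a] (mod m). f n)"
      unfolding sum_distrib_left by (rule sum.inter_filter[symmetric]) simp
    finally have T: "(\<Sum>\<psi>\<in>dchars m. cnj (\<psi> a) * Tsum \<psi> N) = of_real (h * (\<Sum>n | n \<in> {1..N} \<and> [n = a] (mod m). f n))" .
    have "(\<Sum>\<psi>\<in>dchars m. cnj (\<psi> a) * Tsum \<psi> N)
        = cnj (principal m a) * Tsum (principal m) N + (\<Sum>\<psi>\<in>dchars m - {principal m}. cnj (\<psi> a) * Tsum \<psi> N)"
      using finD principal_dchar[OF m] by (rule sum.remove)
    then have "Tsum (principal m) N = of_real (h * (\<Sum>n | n \<in> {1..N} \<and> [n = a] (mod m). f n))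
        - (\<Sum>\<psi>\<in>dchars m - {principal m}. cnj (\<psi> a) * Tsum \<psi> N)"
      using a T by (simp add: principal_def)
    then have "Re (Tsum (principal m) N) \<le> h * (\<Sum>n | n \<in> {1..N} \<and> [n = a] (mod m). f n)
        + norm (\<Sum>\<psi>\<in>dchars m - {principal m}. cnj (\<psi> a) * Tsum \<psi> N)"
      using abs_Re_le_cmod[of "\<Sum>\<psi>\<in>dchars m - {principal m}. cnj (\<psi> a) * Tsum \<psi> N"] by simp
    also have "norm (\<Sum>\<psi>\<in>dchars m - {principal m}. cnj (\<psi> a) * Tsum \<psi> N) \<le> B'"
      unfolding B'_def
    proof (rule sum_norm_le)
      fix \<psi> assume \<psi>: "\<psi> \<in> dchars m - {principal m}"
      then have "norm (\<psi> a) = 1" using norm_dchar[OF m _ a] by blast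
      then show "norm (cnj (\<psi> a) * Tsum \<psi> N) \<le> B \<psi>" using B[OF \<psi> N] by (simp add: norm_mult)
    qed
    finally have 2: "Re (Tsum (principal m) N) \<le> h * (\<Sum>n | n \<in> {1..N} \<and> [n = a] (mod m). f n) + B'" by simp
    have "(\<Sum>n | n \<in> {1..N} \<and> [n = a] (mod m). f n)
        \<le> (\<Sum>n\<in>{n. n \<in> {1..N} \<and> prime n \<and> [n = a] (mod m)} \<union> {n. n \<in> {1..N} \<and> \<not> prime n}. f n)"
      using f0 by (intro sum_mono2) auto
    also have "\<dots> \<le> (\<Sum>n | n \<in> {1..N} \<and> prime n \<and> [n = a] (mod m). f n) + (\<Sum>n | n \<in> {1..N} \<and> \<not> prime n. f n)"
      using f0 by (intro sum_union_le) auto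
    also have "(\<Sum>n | n \<in> {1..N} \<and> prime n \<and> [n = a] (mod m). f n)
        = (\<Sum>p | p \<in> {1..N} \<and> prime p \<and> [p = a] (mod m). ln (real p) / real p)"
      by (intro sum.cong) (auto simp: f_def mangoldt_prime)
    also have "(\<Sum>n | n \<in> {1..N} \<and> \<not> prime n. f n) \<le> c0" unfolding f_def by (rule c0)
    finally have "h * (\<Sum>n | n \<in> {1..N} \<and> [n = a] (mod m). f n)
        \<le> h * ((\<Sum>p | p \<in> {1..N} \<and> prime p \<and> [p = a] (mod m). ln (real p) / real p) + c0)"
      using h by (intro mult_left_mono) auto
    with 1 2 P show ?thesis by simp
  qed
  show ?thesis
  proof (rule that[of "1 / h" "(1 + c0 + E + B') / h + c0"])
    show "1 / h > 0" using h by simp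
    fix N :: nat assume "N \<ge> 1"
    from main[OF this] have "(ln (real N) - 1 - c0 - E - B') / h
        \<le> (\<Sum>p | p \<in> {1..N} \<and> prime p \<and> [p = a] (mod m). ln (real p) / real p) + c0"
      using h by (simp add: divide_le_eq mult.commute)
    then show "1 / h * ln (real N) - ((1 + c0 + E + B') / h + c0)
        \<le> (\<Sum>p | p \<in> {1..N} \<and> prime p \<and> [p = a] (mod m). ln (real p) / real p)"
      by (simp add: diff_divide_distrib add_divide_distrib)
  qed
qed

text \<open>If the reciprocals were summable, those from some K on would sum to less than c/2.
  Bounding ln p by ln N there leaves at most (c/2) ln N plus a constant for the sum of ln p / p,
  below its lower bound c ln N - C for large N.\<close>

theorem not_summable_primes_progression:
  assumes m: "m > 1" and a: "coprime a m"
  shows "\<not> (\<lambda>p. 1 / real p) summable_on {p. prime p \<and> [p = a] (mod m)}"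
proof
  define P where "P = {p. prime p \<and> [p = a] (mod m)}"
  assume "(\<lambda>p. 1 / real p) summable_on {p. prime p \<and> [p = a] (mod m)}"
  then have sP: "(\<lambda>p. 1 / real p) summable_on P" unfolding P_def .
  obtain c C where c: "c > 0"
    "\<And>N. N \<ge> 1 \<Longrightarrow> c * ln (real N) - C \<le> (\<Sum>p | p \<in> {1..N} \<and> prime p \<and> [p = a] (mod m). ln (real p) / real p)"
    using sum_ln_primes_progression_ge[OF m a] by blast
  define g where "g p = (if p \<in> P then 1 / real p else 0)" for p
  have "summable g"
  proof (rule summableI_nonneg_bounded)
    show "g n \<ge> 0" for n by (simp add: g_def)
    show "(\<Sum>n<k. g n) \<le> infsum (\<lambda>p. 1 / real p) P" for k
    proof -
      have "(\<Sum>n<k. g n) = (\<Sum>n\<in>{n \<in> {..<k}. n \<in> P}. 1 / real n)"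
        unfolding g_def by (rule sum.inter_filter[symmetric]) simp
      also have "\<dots> \<le> infsum (\<lambda>p. 1 / real p) P" using sP by (intro finite_sum_le_infsum) auto
      finally show ?thesis .
    qed
  qed
  then obtain K where K: "\<And>n. norm (sum g {K..<n}) < c / 2"
    unfolding summable_Cauchy using c(1) by (metis half_gt_zero order_refl)
  define D where "D = (\<Sum>p<K. ln (real p) / real p)"
  have le: "c / 2 * ln (real N) \<le> C + D" if N: "N \<ge> 1" for N
  proof -
    have "c * ln (real N) - C \<le> (\<Sum>p | p \<in> {1..N} \<and> p \<in> P. ln (real p) / real p)"
      using c(2)[OF N] unfolding P_def by (simp add: conj_assoc)
    also have "\<dots> \<le> (\<Sum>p\<in>{..<K} \<union> {p. p \<in> {K..<Suc N} \<and> p \<in> P}. ln (real p) / real p)"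
    proof (intro sum_mono2)
      fix p assume "p \<in> {..<K} \<union> {p. p \<in> {K..<Suc N} \<and> p \<in> P} - {p. p \<in> {1..N} \<and> p \<in> P}"
      show "0 \<le> ln (real p) / real p" by (cases "p = 0") auto
    qed auto
    also have "\<dots> = D + (\<Sum>p | p \<in> {K..<Suc N} \<and> p \<in> P. ln (real p) / real p)"
      unfolding D_def by (intro sum.union_disjoint) auto
    also have "(\<Sum>p | p \<in> {K..<Suc N} \<and> p \<in> P. ln (real p) / real p) \<le> (\<Sum>p | p \<in> {K..<Suc N} \<and> p \<in> P. ln (real N) * (1 / real p))"
    proof (rule sum_mono)
      fix p assume p: "p \<in> {p. p \<in> {K..<Suc N} \<and> p \<in> P}"
      then have "p > 0" "p \<le> N" by (auto simp: P_def prime_gt_0_nat)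
      then have "ln (real p) \<le> ln (real N)" by simp
      then show "ln (real p) / real p \<le> ln (real N) * (1 / real p)" by (simp add: divide_right_mono)
    qed
    also have "\<dots> = ln (real N) * sum g {K..<Suc N}"
    proof -
      have "sum g {K..<Suc N} = (\<Sum>p | p \<in> {K..<Suc N} \<and> p \<in> P. 1 / real p)"
        unfolding g_def by (rule sum.inter_filter[symmetric]) simp
      then show ?thesis by (simp only: sum_distrib_left)
    qed
    also have "\<dots> \<le> ln (real N) * (c / 2)"
      using K[of "Suc N"] N by (intro mult_left_mono) auto
    finally show ?thesis by (simp add: algebra_simps)
  qed
  define N where "N = nat \<lceil>exp ((C + D + 1) * 2 / c)\<rceil>"
  have "exp ((C + D + 1) * 2 / c) \<le> real N" unfolding N_def by (rule real_nat_ceiling_ge)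
  moreover have "exp ((C + D + 1) * 2 / c) > 0" by simp
  ultimately have "real N > 0" by linarith
  with \<open>exp ((C + D + 1) * 2 / c) \<le> real N\<close> have N: "N \<ge> 1" "(C + D + 1) * 2 / c \<le> ln (real N)"
    by (simp_all add: ln_ge_iff)
  then have "C + D + 1 \<le> c / 2 * ln (real N)" using c(1) by (simp add: field_simps)
  with le[OF N(1)] show False by simp
qed

section \<open>The density of the set of values of \<open>gcd(n, F\<^sub>n)\<close>\<close>

lemma gcd_fib_set_dvd:
  assumes "n \<in> gcd_fib_set" "p dvd n" "q dvd n"
    and "\<And>m. p dvd fib m \<Longrightarrow> 2 ^ k dvd m" "\<And>m. q dvd fib m \<Longrightarrow> 3 dvd m"
  shows "2 ^ k dvd n"
proof -
  obtain m where m: "n = gcd m (fib m)" using assms(1) by (auto simp: gcd_fib_set_def)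
  have "p dvd fib m" "q dvd fib m" using assms(2,3) unfolding m by simp_all
  then have k: "2 ^ k dvd m" and "3 dvd m" using assms(4,5) by blast+
  moreover have "coprime 3 ((2::nat) ^ k)" by simp
  ultimately have "3 * 2 ^ k dvd m" by (intro divides_mult)
  then have "fib (3 * 2 ^ k) dvd fib m"
    using fib_gcd[of "3 * 2 ^ k" m] by (metis gcd_dvd2 gcd_nat.absorb1)
  then have "2 ^ k dvd fib m" using two_power_dvd_fib dvd_trans by blast
  with k show ?thesis unfolding m by simp
qed

text \<open>Three sets cover the values, each of density at most e/3: multiples of 2^k, integers
  coprime to M, and integers coprime to L, where M and L are products of primes of the first and the
  second kind.\<close>

lemma card_gcd_fib_set_le:
  assumes e: "e > 0"
  obtains C :: real where "\<And>N. real (card {n \<in> gcd_fib_set. 1 \<le> n \<and> n \<le> N}) \<le> e * real N + C"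
proof -
  obtain k0 where k0: "(1 / 2) ^ k0 < e / 3"
    using real_arch_pow_inv[of "e / 3" "1 / 2"] e by auto
  \<comment> \<open>The added 2 secures \<open>k \<ge> 2\<close> for
    \<open>two_power_dvd_index\<close>.\<close>
  define k where "k = k0 + 2"
  have k: "k \<ge> 2" "(1 / 2 :: real) ^ k \<le> e / 3"
  proof -
    have "(1 / 2 :: real) ^ k \<le> (1 / 2) ^ k0" unfolding k_def by (intro power_decreasing) auto
    with k0 show "(1 / 2 :: real) ^ k \<le> e / 3" by linarith
  qed (simp add: k_def)
  define P where "P = {p. prime p \<and> (\<forall>m. p dvd fib m \<longrightarrow> 2 ^ k dvd m)}"
  define Q where "Q = {q. prime q \<and> (\<forall>m. q dvd fib m \<longrightarrow> 3 dvd m)}"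
  have "\<not> (\<lambda>p. 1 / real p) summable_on P"
  proof
    assume sP: "(\<lambda>p. 1 / real p) summable_on P"
    have cop: "coprime ((2::nat) ^ k) 5" by simp
    obtain a :: nat where a: "[a = 2 ^ k - 1] (mod 2 ^ k)" "[a = 2] (mod 5)"
      using binary_chinese_remainder_nat[OF cop] by blast
    have "coprime (2 ^ k - 1) ((2::nat) ^ k)"
      using coprime_diff_one_left_nat[of "2 ^ k"] by simp
    then have "coprime a (2 ^ k)" using a(1) cong_imp_coprime cong_sym by blast
    moreover have "coprime (2::nat) 5" by simp
    then have "coprime a 5" using a(2) cong_imp_coprime cong_sym by blast
    ultimately have "coprime a (2 ^ k * 5)" by simp
    moreover have "{p. prime p \<and> [p = a] (mod 2 ^ k * 5)} \<subseteq> P"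
    proof
      fix p assume "p \<in> {p. prime p \<and> [p = a] (mod 2 ^ k * 5)}"
      then have p: "prime p" "[p = a] (mod 2 ^ k)" "[p = a] (mod 5)"
        by (auto elim: cong_dvd_modulus_nat)
      have "[p + 1 = 2 ^ k - 1 + 1] (mod 2 ^ k)"
        using p(2) a(1) by (intro cong_add cong_refl) (rule cong_trans)
      then have "[p + 1 = 0] (mod 2 ^ k)" by (simp add: Cong.cong_def)
      moreover have "p mod 5 = 2" using cong_trans[OF p(3) a(2)] by (simp add: Cong.cong_def)
      ultimately show "p \<in> P" using two_power_dvd_index[OF p(1) k(1)] p(1) by (auto simp: P_def)
    qed
    moreover have "2 ^ k * 5 > (1::nat)" using one_le_power[of "2::nat" k] by linarith
    ultimately show False
      using not_summable_primes_progression summable_on_subset_banach[OF sP] by blast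
  qed
  then obtain M where M: "M > 0" "\<And>p. prime p \<Longrightarrow> p dvd M \<Longrightarrow> p \<in> P" "real (totient M) < e / 3 * real M"
    using small_totient_ratio[of P "e / 3"] e by (auto simp: P_def)
  have "{p. prime p \<and> [p = 1] (mod 60)} = {p::nat. prime p \<and> p mod 60 = 1}"
    by (simp add: Cong.cong_def)
  then have "\<not> (\<lambda>p. 1 / real p) summable_on Q"
    using not_summable_three_dvd_index not_summable_primes_progression[of 60 1] unfolding Q_def by simp
  then obtain L where L: "L > 0" "\<And>p. prime p \<Longrightarrow> p dvd L \<Longrightarrow> p \<in> Q" "real (totient L) < e / 3 * real L"
    using small_totient_ratio[of Q "e / 3"] e by (auto simp: Q_def)
  have cop: "real (card {n\<in>{1..N}. coprime n K}) \<le> e / 3 * real N + real (totient K)"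
    if "K > 0" "real (totient K) < e / 3 * real K" for N K
  proof -
    have "real (card {n\<in>{1..N}. coprime n K}) \<le> real (totient K * (N div K + 1))"
      using card_coprime_le[OF that(1)] of_nat_mono by blast
    also have "\<dots> = real (totient K) * real (N div K) + real (totient K)" by (simp add: algebra_simps)
    also have "real (totient K) * real (N div K) \<le> (e / 3 * real K) * (real N / real K)"
      using that e real_div_bounds(2)[of N K] by (intro mult_mono) auto
    also have "\<dots> = e / 3 * real N" using that by simp
    finally show ?thesis by simp
  qed
  have dvd: "real (card {n\<in>{1..N}. 2 ^ k dvd n}) \<le> e / 3 * real N" for N
  proof -
    have "{n\<in>{1..N}. 2 ^ k dvd n} \<subseteq> (\<lambda>j. 2 ^ k * j) ` {1..N div 2 ^ k}"
    proof
      fix n assume n: "n \<in> {n\<in>{1..N}. 2 ^ k dvd n}"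
      then obtain j where j: "n = 2 ^ k * j" by (auto elim: dvdE)
      with n have "j \<ge> 1" "2 ^ k * j \<le> N" by (auto intro: Nat.gr0I simp: Suc_le_eq)
      then have "j \<le> N div 2 ^ k" by (simp add: less_eq_div_iff_mult_less_eq mult.commute)
      with \<open>j \<ge> 1\<close> j show "n \<in> (\<lambda>j. 2 ^ k * j) ` {1..N div 2 ^ k}" by auto
    qed
    then have "card {n\<in>{1..N}. 2 ^ k dvd n} \<le> card {1..N div 2 ^ k}"
      by (meson surj_card_le finite_atLeastAtMost)
    then have "real (card {n\<in>{1..N}. 2 ^ k dvd n}) \<le> real (N div 2 ^ k)" by simp
    also have "\<dots> \<le> real N / real (2 ^ k)" by (rule real_div_bounds(2))
    also have "\<dots> = (1 / 2) ^ k * real N" by (simp add: power_divide)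
    also have "\<dots> \<le> e / 3 * real N" using k(2) by (intro mult_right_mono) auto
    finally show ?thesis .
  qed
  show ?thesis
  proof (rule that[of "real (totient M) + real (totient L)"])
    fix N
    define X Y Z where "X = {n\<in>{1..N}. 2 ^ k dvd n}" and "Y = {n\<in>{1..N}. coprime n M}"
      and "Z = {n\<in>{1..N}. coprime n L}"
    have "{n \<in> gcd_fib_set. 1 \<le> n \<and> n \<le> N} \<subseteq> X \<union> Y \<union> Z"
    proof
      fix n assume n: "n \<in> {n \<in> gcd_fib_set. 1 \<le> n \<and> n \<le> N}"
      have "2 ^ k dvd n" if nc: "\<not> coprime n M" "\<not> coprime n L"
      proof -
        have common: "\<exists>p. prime p \<and> p dvd n \<and> p dvd K" if "\<not> coprime n K" for K
        proof -
          have "gcd n K \<noteq> 1" using that coprime_iff_gcd_eq_1 by blast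
          then obtain p where "prime p" "p dvd gcd n K" using prime_factor_nat by blast
          then show ?thesis by auto
        qed
        obtain p where p: "prime p" "p dvd n" "p dvd M" using common[OF nc(1)] by blast
        obtain q where q: "prime q" "q dvd n" "q dvd L" using common[OF nc(2)] by blast
        have "p \<in> P" "q \<in> Q" using M(2) L(2) p q by blast+
        moreover have "n \<in> gcd_fib_set" using n by blast
        ultimately show ?thesis
          unfolding P_def Q_def using gcd_fib_set_dvd[of n p q k] p(2) q(2) by blast
      qed
      moreover have "n \<in> {1..N}" using n by simp
      ultimately show "n \<in> X \<union> Y \<union> Z" unfolding X_def Y_def Z_def by blast
    qed
    then have "card {n \<in> gcd_fib_set. 1 \<le> n \<and> n \<le> N} \<le> card (X \<union> Y \<union> Z)"
      by (intro card_mono) (auto simp: X_def Y_def Z_def)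
    also have "\<dots> \<le> card X + card Y + card Z"
      using card_Un_le[of "X \<union> Y" Z] card_Un_le[of X Y] by linarith
    finally have "real (card {n \<in> gcd_fib_set. 1 \<le> n \<and> n \<le> N}) \<le> real (card X) + real (card Y) + real (card Z)"
      by linarith
    also have "\<dots> \<le> e / 3 * real N + (e / 3 * real N + real (totient M)) + (e / 3 * real N + real (totient L))"
      unfolding X_def Y_def Z_def
      by (intro add_mono dvd cop[OF M(1,3)] cop[OF L(1,3)])
    finally show "real (card {n \<in> gcd_fib_set. 1 \<le> n \<and> n \<le> N}) \<le> e * real N + (real (totient M) + real (totient L))"
      by simp
  qed
qed

theorem theorem1p3:
  shows "(\<lambda>x::real. real (card {a \<in> gcd_fib_set. 1 \<le> real a \<and> real a \<le> x}))
           \<in> o[at_top](\<lambda>x. x)"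
proof (rule landau_o.smallI)
  fix c :: real assume c: "c > 0"
  obtain C where C: "\<And>N. real (card {n \<in> gcd_fib_set. 1 \<le> n \<and> n \<le> N}) \<le> c / 2 * real N + C"
    using card_gcd_fib_set_le[of "c / 2"] c by auto
  show "eventually (\<lambda>x. norm (real (card {a \<in> gcd_fib_set. 1 \<le> real a \<and> real a \<le> x})) \<le> c * norm x) at_top"
    using eventually_ge_at_top[of "max 0 (2 * C / c)"]
  proof eventually_elim
    case (elim x)
    then have x: "x \<ge> 0" "C \<le> c / 2 * x" using c by (auto simp: field_simps)
    have "real a \<le> x \<longleftrightarrow> a \<le> nat \<lfloor>x\<rfloor>" for a
      using x(1) le_nat_floor[of a x] of_nat_floor[of x] by fastforce
    then have "{a \<in> gcd_fib_set. 1 \<le> real a \<and> real a \<le> x} = {n \<in> gcd_fib_set. 1 \<le> n \<and> n \<le> nat \<lfloor>x\<rfloor>}"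
      by auto
    then have "real (card {a \<in> gcd_fib_set. 1 \<le> real a \<and> real a \<le> x}) \<le> c / 2 * real (nat \<lfloor>x\<rfloor>) + C"
      using C by simp
    also have "\<dots> \<le> c / 2 * x + c / 2 * x"
      using x c of_nat_floor[of x] by (intro add_mono mult_left_mono) auto
    finally show ?case using x by simp
  qed
qed

end
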